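(* Let $\Bbbk$ be a field and $R=\Bbbk[x_1,\dots,x_n]_{(x_1,\dots,x_n)}$. Assume that the set of variables $\{x_1,\dots,x_n\}$ is partitioned into (non-empty) subsets $X_1,\dots,X_s$. For $k=1,\dots,s$ let $I_k$ be a monomial ideal in $R_k=\Bbbk[X_k]_{(X_k)}$, and let $I=I_1R+\dots+I_sR$. Then $$j(I)=j(I_1)\cdots j(I_s),$$ where $j(I)$ is the $j$-multiplicity of the ideal $I$ of $R$ and $j(I_k)$ is the $j$-multiplicity of the ideal $I_k$ of $R_k$.
   Context: For an ideal $I$ in a Noetherian local ring $(R,\mathfrak m)$ of Krull dimension $n\ge 1$, the $j$-multiplicity is $$j(I)=(n-1)!\lim_{t\to\infty}\frac{\lambda_R\big(\Gamma_{\mathfrak m}(I^t/I^{t+1})\big)}{t^{\,n-1}},$$ where $\lambda_R$ is length and $\Gamma_{\mathfrak m}(M)=\{x\in M: \mathfrak m^r x=0 \text{ for some } r\}$ is the zeroth local cohomology; the limit exists. $\Bbbk[X_k]_{(X_k)}$ is the polynomial ring in the variables $X_k$ localized at the ideal generated by $X_k$. A monomial ideal is an ideal generated by monomials in the variables. *)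

theory Defs
  imports
    "HOL-Algebra.Algebra"
    "HOL-Algebra.Algebraic_Closure_Type"
    "HOL-Library.Poly_Mapping"
    "HOL-Library.Extended_Nat"
    "HOL-Library.Disjoint_Sets"
    "HOL-Computational_Algebra.Fraction_Field"
    Complex_Main
begin

section \<open>Commutative algebra: dimension, length, local cohomology, $j$-multiplicity\<close>

definition krull_dim :: "('a, 'm) ring_scheme \<Rightarrow> enat" where
  "krull_dim R = Sup {enat l | l. \<exists>P :: nat \<Rightarrow> 'a set.
     (\<forall>i\<le>l. primeideal (P i) R) \<and> (\<forall>i<l. P i \<subset> P (Suc i))}"

text \<open>For a local ring this is its unique maximal ideal.\<close>

definition max_ideal :: "('a, 'm) ring_scheme \<Rightarrow> 'a set" where
  "max_ideal R = (THE \<mm>. maximalideal \<mm> R)"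

definition ideal_power :: "('a, 'm) ring_scheme \<Rightarrow> 'a set \<Rightarrow> nat \<Rightarrow> 'a set" where
  "ideal_power R I t = I [^]\<^bsub>ideals_set R\<^esub> t"

text \<open>The length of a module is the supremum of the lengths of chains of submodules.\<close>

definition module_length ::
    "('a, 'm) ring_scheme \<Rightarrow> ('a, 'b, 'n) module_scheme \<Rightarrow> enat" where
  "module_length R M = Sup {enat l | l. \<exists>N :: nat \<Rightarrow> 'b set.
     (\<forall>i\<le>l. submodule (N i) R M) \<and> (\<forall>i<l. N i \<subset> N (Suc i))}"

text \<open>The record type of modules inherits a multiplication and a unit from rings. They play no
  role for modules; in the two constructions below they are filled in canonically.\<close>

definition self_module :: "('a, 'm) ring_scheme \<Rightarrow> ('a, 'a) module" where
  "self_module R = \<lparr>carrier = carrier R, monoid.mult = monoid.mult R, one = \<one>\<^bsub>R\<^esub>,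
     ring.zero = \<zero>\<^bsub>R\<^esub>, ring.add = ring.add R, module.smult = monoid.mult R\<rparr>"

definition quot_module ::
    "('a, 'b, 'n) module_scheme \<Rightarrow> 'b set \<Rightarrow> ('a, 'b set) module" where
  "quot_module M N = \<lparr>carrier = a_rcosets\<^bsub>M\<^esub> N, monoid.mult = rcoset_mult M N,
     one = N +>\<^bsub>M\<^esub> \<one>\<^bsub>M\<^esub>, ring.zero = N, ring.add = set_add M,
     module.smult = (\<lambda>a C. \<Union>x\<in>C. N +>\<^bsub>M\<^esub> (a \<odot>\<^bsub>M\<^esub> x))\<rparr>"

text \<open>The zeroth local cohomology $\Gamma_{\mathfrak m}(M)$, as a set and as a module.\<close>

definition torsion_part ::
    "('a, 'm) ring_scheme \<Rightarrow> 'a set \<Rightarrow> ('a, 'b, 'n) module_scheme \<Rightarrow> 'b set" where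
  "torsion_part R \<mm> M =
     {x \<in> carrier M. \<exists>r. \<forall>a\<in>ideal_power R \<mm> r. a \<odot>\<^bsub>M\<^esub> x = \<zero>\<^bsub>M\<^esub>}"

definition torsion_module ::
    "('a, 'm) ring_scheme \<Rightarrow> 'a set \<Rightarrow> ('a, 'b) module \<Rightarrow> ('a, 'b) module" where
  "torsion_module R \<mm> M = M\<lparr>carrier := torsion_part R \<mm> M\<rparr>"

text \<open>The module $I^t/I^{t+1}$ over $R$.\<close>

definition graded_piece :: "('a, 'm) ring_scheme \<Rightarrow> 'a set \<Rightarrow> nat \<Rightarrow> ('a, 'a set) module" where
  "graded_piece R I t =
     quot_module ((self_module R)\<lparr>carrier := ideal_power R I t\<rparr>) (ideal_power R I (Suc t))"

text \<open>Intended for a Noetherian local ring \<open>R\<close> of dimension at least one. The dimension and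
  the lengths that occur are then finite, since the torsion part of a finitely generated module is annihilated
  by a power of the maximal ideal, so \<^const>\<open>the_enat\<close> loses nothing; and the limit exists.\<close>

definition j_multiplicity :: "('a, 'm) ring_scheme \<Rightarrow> 'a set \<Rightarrow> real" where
  "j_multiplicity R I = (let n = the_enat (krull_dim R) in
     fact (n - 1) *
     lim (\<lambda>t. real (the_enat (module_length R
                     (torsion_module R (max_ideal R) (graded_piece R I t))))
              / real t ^ (n - 1)))"

text \<open>The sum of a family of ideals (or of additive subgroups).\<close>

definition ideal_sum :: "('a, 'm) ring_scheme \<Rightarrow> 'i set \<Rightarrow> ('i \<Rightarrow> 'a set) \<Rightarrow> 'a set" where
  "ideal_sum R A J = {finsum R a A | a. a \<in> (\<Pi> k\<in>A. J k)}"


section \<open>Localized polynomial rings\<close>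

text \<open>Polynomials in variables $x_i$ ($i \in \mathbb{N}$): finitely supported functions from
  exponent vectors to coefficients, with the convolution product. For a set \<open>V\<close> of variable
  indices, all rings below are subrings of this polynomial ring, respectively of its field of
  fractions.\<close>

type_synonym 'k mpoly = "(nat \<Rightarrow>\<^sub>0 nat) \<Rightarrow>\<^sub>0 'k"

definition mpoly_ring :: "nat set \<Rightarrow> 'k::field mpoly ring" where
  "mpoly_ring V = ring_of_type_algebra
     \<lparr>carrier := {p. \<forall>m\<in>Poly_Mapping.keys p. Poly_Mapping.keys m \<subseteq> V}\<rparr>"

definition pvar :: "nat \<Rightarrow> 'k::field mpoly" where
  "pvar i = Poly_Mapping.single (Poly_Mapping.single i 1) 1"

definition irrelevant_ideal :: "nat set \<Rightarrow> 'k::field mpoly set" where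
  "irrelevant_ideal V = Idl\<^bsub>mpoly_ring V\<^esub> (pvar ` V)"

text \<open>The ring $\Bbbk[V]_{(V)}$ of fractions $f/g$ with $f, g \in \Bbbk[V]$ and $g \notin (V)$.\<close>

definition loc_ring :: "nat set \<Rightarrow> 'k::field mpoly fract ring" where
  "loc_ring V = ring_of_type_algebra
     \<lparr>carrier := {Fract f g | f g. f \<in> carrier (mpoly_ring V) \<and>
                                   g \<in> carrier (mpoly_ring V) - irrelevant_ideal V}\<rparr>"

definition monomials :: "nat set \<Rightarrow> 'k::field mpoly fract set" where
  "monomials V = {Fract (Poly_Mapping.single m 1) 1 | m. Poly_Mapping.keys m \<subseteq> V}"

definition monomial_ideal :: "nat set \<Rightarrow> 'k::field mpoly fract set \<Rightarrow> bool" where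
  "monomial_ideal V I \<longleftrightarrow> (\<exists>S \<subseteq> monomials V. I = Idl\<^bsub>loc_ring V\<^esub> S)"

end

theory Submission
  imports Defs "HOL-Real_Asymp.Real_Asymp"
begin

text \<open>A monomial ideal is determined by its set \<open>E\<close> of exponents, and the length of the torsion of
  $I^t/I^{t+1}$ is the number $a(t)$ of exponents $u \in tE \setminus (t+1)E$ that are pushed into
  $(t+1)E$ by every monomial of sufficiently large degree. The exponents of this kind for $I_1R + I_2R$ in degree $t$ are
  exactly the sums of those of $I_1$ in degree $i$ and of $I_2$ in degree $t - i$, so $a$ is the
  convolution of $a_1$ and $a_2$. Once $a_k(t) \sim j(I_k)\, t^{d_k-1}/(d_k-1)!$ is known,
  $a_k$ may be compared with $\binom{t+d_k-1}{d_k-1}$, and the Vandermonde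
  identity for these binomials gives the product formula.

  The limits exist because $a_k$ is eventually polynomial (it counts the difference of two upward closed sets of
  exponents by degree) and its partial sums are at most of order $t^{d_k}$, all exponents
  counted up to $t$ lying in a box of side $O(t)$.\<close>

section \<open>Upward closed sets of exponents\<close>

text \<open>The definition takes its limit with \<open>lim\<close>, whose value carries no
  information without convergence, so convergence must be proved for every factor. It rests on
  finite generation: Dickson's lemma bounds the exponents of the generators, hence the boxes, and
  gives the chain condition behind eventual polynomiality. A box alone bounds each a(t) only by
  order t^d, one power too many; the torsion sets for different t are disjoint and share one box, so
  the same bound holds for their sum, which saves the power.

  Localization is the other obstacle, since elements are fractions. A high power of the maximal
  ideal kills a torsion class, so its denominator can be inverted by a truncated geometric series,
  and the class has a polynomial representative supported on the finitely many torsion exponents.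
  Chains of submodules thereby become chains of subspaces. The normalizing exponent of t is the
  Krull dimension minus one, so the dimension is computed too; its upper bound uses algebraic
  relations along a prime chain.\<close>

type_synonym expo = "nat \<Rightarrow>\<^sub>0 nat"

abbreviation coef where "coef \<equiv> Poly_Mapping.lookup"
abbreviation supp where "supp \<equiv> Poly_Mapping.keys"

definition exps :: "nat set \<Rightarrow> expo set" where
  "exps V = {m. supp m \<subseteq> V}"

text \<open>The degree is taken in the variables \<open>W\<close> only: \<open>W\<close> is the full
  variable set for powers of the maximal ideal, and the set of added generator variables when the
  associated graded ring is presented.\<close>

definition wt :: "nat set \<Rightarrow> expo \<Rightarrow> nat" where
  "wt W m = (\<Sum>i\<in>W. coef m i)"

definition msum :: "'a::plus set \<Rightarrow> 'a set \<Rightarrow> 'a set" where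
  "msum A B = {a + b | a b. a \<in> A \<and> b \<in> B}"

definition upset :: "nat set \<Rightarrow> expo set \<Rightarrow> bool" where
  "upset V E \<longleftrightarrow> E \<subseteq> exps V \<and> (\<forall>u\<in>E. \<forall>v\<in>exps V. u + v \<in> E)"

text \<open>Exponents of the powers of an ideal; the zeroth power is the whole ring, whence
  \<open>exps V\<close>.\<close>

primrec epow :: "nat set \<Rightarrow> expo set \<Rightarrow> nat \<Rightarrow> expo set" where
  "epow V E 0 = exps V"
| "epow V E (Suc t) = msum (epow V E t) E"

text \<open>One projection serves two levels: on exponents it keeps some variables, on polynomials
  it keeps some terms.\<close>

definition restr :: "'a set \<Rightarrow> ('a \<Rightarrow>\<^sub>0 'b) \<Rightarrow> ('a \<Rightarrow>\<^sub>0 'b::zero)" where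
  "restr A p = Poly_Mapping.mapp (\<lambda>k c. if k \<in> A then c else 0) p"

lemma coef_restr [simp]: "coef (restr A p) k = (if k \<in> A then coef p k else 0)"
  by (simp add: restr_def lookup_mapp when_def in_keys_iff)

lemma supp_restr [simp]: "supp (restr A p) = supp p \<inter> A"
  by (auto simp: in_keys_iff split: if_splits)

lemma restr_add: "restr A (p + q) = restr A p + restr A (q :: _ \<Rightarrow>\<^sub>0 'b::monoid_add)"
  by (rule poly_mapping_eqI) (simp add: lookup_add)

lemma restr_split: "p = restr A p + restr (- A) (p :: _ \<Rightarrow>\<^sub>0 'b::monoid_add)"
  by (rule poly_mapping_eqI) (simp add: lookup_add)

lemma restr_exps [simp]: "restr V m \<in> exps V"
  by (simp add: exps_def)

lemma restr_id: "supp p \<subseteq> A \<Longrightarrow> restr A p = p"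
  by (rule poly_mapping_eqI) (auto simp: in_keys_iff)

lemma supp_add_nat: "supp (a + b) = supp a \<union> supp (b :: expo)"
  by (auto simp: in_keys_iff lookup_add)

lemma exps_add [simp]: "a + b \<in> exps V \<longleftrightarrow> a \<in> exps V \<and> b \<in> exps V"
  by (simp add: exps_def supp_add_nat)

lemma exps_zero [simp]: "0 \<in> exps V"
  by (simp add: exps_def)

lemma exps_mono: "V \<subseteq> W \<Longrightarrow> exps V \<subseteq> exps W"
  by (auto simp: exps_def)

lemma exps_coef: "m \<in> exps V \<Longrightarrow> i \<notin> V \<Longrightarrow> coef m i = 0"
  by (auto simp: exps_def in_keys_iff)

lemma wt_add: "wt W (a + b) = wt W a + wt W b"
  by (simp add: wt_def lookup_add sum.distrib)

lemma wt_zero [simp]: "wt W 0 = 0"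
  by (simp add: wt_def)

lemma wt_eq_0: "finite V \<Longrightarrow> m \<in> exps V \<Longrightarrow> wt V m = 0 \<longleftrightarrow> m = 0"
  by (auto simp: wt_def intro!: poly_mapping_eqI) (metis exps_coef)

lemma coef_le_wt: "finite V \<Longrightarrow> i \<in> V \<Longrightarrow> coef m i \<le> wt V m"
  unfolding wt_def by (rule member_le_sum) auto

lemma msumI: "a \<in> A \<Longrightarrow> b \<in> B \<Longrightarrow> a + b \<in> msum A B"
  by (auto simp: msum_def)

lemma msumE: "x \<in> msum A B \<Longrightarrow> (\<And>a b. x = a + b \<Longrightarrow> a \<in> A \<Longrightarrow> b \<in> B \<Longrightarrow> P) \<Longrightarrow> P"
  by (auto simp: msum_def)

lemma msum_mono: "A \<subseteq> A' \<Longrightarrow> B \<subseteq> B' \<Longrightarrow> msum A B \<subseteq> msum A' B'"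
  unfolding msum_def by blast

lemma upset_exps [simp]: "upset V (exps V)"
  by (simp add: upset_def)

lemma upset_subset: "upset V E \<Longrightarrow> E \<subseteq> exps V"
  by (simp add: upset_def)

lemma upsetD: "upset V E \<Longrightarrow> u \<in> E \<Longrightarrow> v \<in> exps V \<Longrightarrow> u + v \<in> E"
  by (simp add: upset_def)

lemma upset_msum: "M \<subseteq> exps V \<Longrightarrow> upset V E \<Longrightarrow> upset V (msum M E)"
  unfolding upset_def msum_def by (auto simp: add.assoc) blast

lemma upset_gen: "M \<subseteq> exps V \<Longrightarrow> upset V (msum M (exps V))"
  by (simp add: upset_msum)

lemma subset_gen: "M \<subseteq> msum M (exps V)"
  using msumI[of _ M 0] by fastforce

lemma upset_epow: "upset V E \<Longrightarrow> upset V (epow V E t)"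
  by (induction t) (auto intro!: upset_msum dest: upset_subset)

lemma epow_Suc_subset: "upset V E \<Longrightarrow> epow V E (Suc t) \<subseteq> epow V E t"
  using upset_epow[of V E t] by (auto simp: upset_def msum_def)

lemma epow_antimono: "upset V E \<Longrightarrow> i \<le> j \<Longrightarrow> epow V E j \<subseteq> epow V E i"
  using lift_Suc_antimono_le[of "epow V E" i j] epow_Suc_subset by blast

lemma epow_add:
  assumes "upset V E" "a \<in> epow V E s" "b \<in> epow V E t"
  shows "a + b \<in> epow V E (s + t)"
  using assms(3)
proof (induction t arbitrary: b)
  case 0
  then show ?case using upset_epow[OF assms(1)] assms(2) by (auto dest: upsetD)
next
  case (Suc t)
  then obtain c e where "b = c + e" "c \<in> epow V E t" "e \<in> E" by (auto elim: msumE)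
  then show ?case using Suc.IH[of c] by (auto simp: add.assoc[symmetric] intro: msumI)
qed

section \<open>Dickson's lemma and the ascending chain condition\<close>

lemma nat_mono_subseq:
  fixes f :: "nat \<Rightarrow> nat"
  shows "\<exists>r :: nat \<Rightarrow> nat. strict_mono r \<and> (\<forall>i j. i \<le> j \<longrightarrow> f (r i) \<le> f (r j))"
proof -
  have ex: "\<exists>m > k. \<forall>l > k. f m \<le> f l" for k
  proof -
    define v where "v = (LEAST v. v \<in> f ` {k<..})"
    have "v \<in> f ` {k<..}" unfolding v_def by (rule LeastI[of _ "f (Suc k)"]) auto
    moreover have "v \<le> f l" if "l > k" for l
      unfolding v_def by (rule Least_le) (use that in auto)
    ultimately show ?thesis by auto
  qed
  \<comment> \<open>\<open>nx k\<close> is a position beyond \<open>k\<close> where \<open>f\<close>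
    attains its minimum over the whole tail beyond \<open>k\<close>. Iterating it can only increase
    the value, since each later position already belonged to the earlier tail.\<close>
  define nx where "nx k = (SOME m. m > k \<and> (\<forall>l > k. f m \<le> f l))" for k
  have nx: "nx k > k" "\<And>l. l > k \<Longrightarrow> f (nx k) \<le> f l" for k
    using someI_ex[OF ex[of k]] unfolding nx_def by auto
  define r where "r n = (nx ^^ n) (nx 0)" for n
  have r: "r (Suc n) = nx (r n)" for n by (simp add: r_def)
  have sm: "strict_mono r" by (simp add: strict_mono_Suc_iff r nx)
  have step: "f (r n) \<le> f (r (Suc n))" for n
  proof (cases n)
    case 0
    then show ?thesis using nx(2)[of 0 "nx (nx 0)"] nx(1)[of 0] nx(1)[of "nx 0"] by (simp add: r_def)
  next
    case (Suc m)
    then show ?thesis using nx(2)[of "r m" "nx (nx (r m))"] nx(1)[of "r m"] nx(1)[of "nx (r m)"] by (simp add: r)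
  qed
  have "f (r i) \<le> f (r j)" if "i \<le> j" for i j
    using lift_Suc_mono_le[of "\<lambda>n. f (r n)", OF step that] .
  with sm show ?thesis by (intro exI[of _ r]) simp
qed

text \<open>The variables are treated one at a time: thinning the sequence further for a new
  variable preserves the monotonicity already reached in the earlier ones.\<close>

lemma dickson_seq:
  fixes f :: "nat \<Rightarrow> expo"
  assumes "finite V"
  shows "\<exists>r :: nat \<Rightarrow> nat. strict_mono r \<and> (\<forall>i j. i \<le> j \<longrightarrow> (\<forall>x\<in>V. coef (f (r i)) x \<le> coef (f (r j)) x))"
  using assms
proof (induction V)
  case empty
  show ?case by (intro exI[of _ "\<lambda>n. n"]) (simp add: strict_mono_def)
next
  case (insert x V)
  then obtain r :: "nat \<Rightarrow> nat" where r: "strict_mono r"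
    "\<And>i j y. i \<le> j \<Longrightarrow> y \<in> V \<Longrightarrow> coef (f (r i)) y \<le> coef (f (r j)) y" by blast
  obtain q :: "nat \<Rightarrow> nat" where q: "strict_mono q" "\<And>i j. i \<le> j \<Longrightarrow> coef (f (r (q i))) x \<le> coef (f (r (q j))) x"
    using nat_mono_subseq[of "\<lambda>n. coef (f (r n)) x"] by blast
  have "strict_mono (\<lambda>n. r (q n))" using r(1) q(1) by (simp add: strict_mono_def)
  moreover have "coef (f (r (q i))) y \<le> coef (f (r (q j))) y" if "i \<le> j" "y \<in> insert x V" for i j y
  proof -
    have "q i \<le> q j" using that(1) by (simp add: strict_mono_less_eq[OF q(1)])
    then show ?thesis using that q(2) r(2) by blast
  qed
  ultimately show ?case by (intro exI[of _ "\<lambda>n. r (q n)"]) blast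
qed

lemma exps_le_add:
  assumes "u \<in> exps V" "w \<in> exps V" "\<And>x. x \<in> V \<Longrightarrow> coef u x \<le> coef w x"
  obtains v where "v \<in> exps V" "w = u + v"
proof
  have le: "coef u x \<le> coef w x" for x
    using assms exps_coef[of u V x] by (cases "x \<in> V") auto
  show "w = u + (w - u)" by (rule poly_mapping_eqI) (simp add: lookup_add lookup_minus le)
  then show "w - u \<in> exps V" using assms(2) by (metis exps_add)
qed

text \<open>Dickson's lemma, with the elements minimal for divisibility as generators. Infinitely
  many of them would contain a coordinatewise monotone sequence, hence two distinct elements one of
  which divides the other. Descent on the total degree leads from every element to a minimal
  one.\<close>

lemma dickson:
  assumes "finite V" "M \<subseteq> exps V"
  obtains M0 where "finite M0" "M0 \<subseteq> M" "M \<subseteq> msum M0 (exps V)"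
proof -
  define M0 where "M0 = {u \<in> M. \<forall>w\<in>M. \<forall>v\<in>exps V. u = w + v \<longrightarrow> v = 0}"
  have "finite M0"
  proof (rule ccontr)
    assume "infinite M0"
    then obtain f :: "nat \<Rightarrow> expo" where f: "inj f" "range f \<subseteq> M0"
      using infinite_countable_subset by blast
    then have fV: "f i \<in> exps V" for i using assms(2) by (auto simp: M0_def)
    obtain r :: "nat \<Rightarrow> nat" where r: "strict_mono r"
      "\<And>i j. i \<le> j \<Longrightarrow> (\<forall>x\<in>V. coef (f (r i)) x \<le> coef (f (r j)) x)"
      using dickson_seq[OF assms(1)] by blast
    obtain v where v: "v \<in> exps V" "f (r 1) = f (r 0) + v"
      using exps_le_add[OF fV fV] r(2)[of 0 1] by (metis zero_le_one)
    have "f (r 0) \<in> M" "f (r 1) \<in> M0" using f(2) by (auto simp: M0_def)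
    then have "v = 0" using v unfolding M0_def by blast
    then have "r 1 = r 0" using v f(1) by (auto dest: injD)
    then show False using strict_mono_less[OF r(1), of 0 1] by simp
  qed
  moreover have "u \<in> msum M0 (exps V)" if "u \<in> M" for u
    using that
  proof (induction "wt V u" arbitrary: u rule: less_induct)
    case less
    show ?case
    proof (cases "u \<in> M0")
      case True
      then show ?thesis using msumI[of u M0 0] by simp
    next
      case False
      then obtain w v where wv: "w \<in> M" "v \<in> exps V" "u = w + v" "v \<noteq> 0"
        using less.prems by (auto simp: M0_def)
      then have "wt V w < wt V u" using wt_eq_0[OF assms(1) wv(2)] by (simp add: wt_add)
      from less.hyps[OF this wv(1)] obtain a b where "w = a + b" "a \<in> M0" "b \<in> exps V"
        by (auto elim: msumE)
      then show ?thesis using wv msumI[of a M0 "b + v" "exps V"] by (simp add: add.assoc)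
    qed
  qed
  ultimately show ?thesis using that[of M0] by (auto simp: M0_def)
qed

text \<open>Noetherianity: the union of the chain has finitely many generators, and all of them are
  present from some index on.\<close>

lemma upset_chain_stable:
  assumes "finite V" "\<And>i. upset V (A i)" "\<And>i. A i \<subseteq> A (Suc i)"
  shows "\<exists>N. \<forall>i\<ge>N. A i = A N"
proof -
  have mono: "A i \<subseteq> A j" if "i \<le> j" for i j
    using that lift_Suc_mono_le[of A, OF assms(3)] by blast
  obtain M0 where M0: "finite M0" "M0 \<subseteq> (\<Union>i. A i)" "(\<Union>i. A i) \<subseteq> msum M0 (exps V)"
    using dickson[OF assms(1), of "\<Union>i. A i"] upset_subset[OF assms(2)] by (metis UN_least)
  obtain g where g: "\<And>u. u \<in> M0 \<Longrightarrow> u \<in> A (g u)" using M0(2) by (meson UN_E subsetD)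
  define N where "N = Max (insert 0 (g ` M0))"
  have "M0 \<subseteq> A N"
  proof
    fix u assume "u \<in> M0"
    then have "g u \<le> N" unfolding N_def using M0(1) by (intro Max_ge) auto
    then show "u \<in> A N" using g[OF \<open>u \<in> M0\<close>] mono by blast
  qed
  then have "msum M0 (exps V) \<subseteq> A N" using assms(2)[of N] by (auto simp: msum_def upset_def)
  then have "A i \<subseteq> A N" for i using M0(3) by blast
  then show ?thesis using mono by blast
qed

section \<open>Eventually polynomial functions\<close>

definition dif :: "(nat \<Rightarrow> real) \<Rightarrow> nat \<Rightarrow> real" where
  "dif f t = f (Suc t) - f t"

text \<open>An iterated difference that vanishes from some point on describes eventual polynomials
  without a type of polynomials. No degree is tracked; it is recovered later from the growth of the
  sequence.\<close>

definition evpoly :: "(nat \<Rightarrow> real) \<Rightarrow> bool" where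
  "evpoly f \<longleftrightarrow> (\<exists>k N. \<forall>t\<ge>N. (dif ^^ k) f t = 0)"

lemma dif_pow_ge: "\<lbrakk>\<forall>t\<ge>N. (dif ^^ k) f t = 0; k \<le> l; t \<ge> N\<rbrakk> \<Longrightarrow> (dif ^^ l) f t = 0"
proof (induction l arbitrary: t)
  case (Suc l)
  then show ?case by (cases "k = Suc l") (auto simp: dif_def[of "(dif ^^ l) f"])
qed auto

lemma dif_pow_add: "(dif ^^ k) (\<lambda>t. f t + g t) t = (dif ^^ k) f t + (dif ^^ k) g t"
  by (induction k arbitrary: t) (auto simp: dif_def[of "(dif ^^ _) _"])

lemma dif_pow_shift: "s \<ge> n \<Longrightarrow> (dif ^^ k) (\<lambda>t. f (t - n)) s = (dif ^^ k) f (s - n)"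
  by (induction k arbitrary: s) (auto simp: dif_def[of "(dif ^^ _) _"] Suc_diff_le)

lemma dif_pow_cong: "\<forall>t\<ge>N. f t = g t \<Longrightarrow> t \<ge> N \<Longrightarrow> (dif ^^ k) f t = (dif ^^ k) g t"
  by (induction k arbitrary: t) (auto simp: dif_def[of "(dif ^^ _) _"])

lemma evpoly_cong: "\<forall>t\<ge>N. f t = g t \<Longrightarrow> evpoly f \<Longrightarrow> evpoly g"
  unfolding evpoly_def using dif_pow_cong[of N f g]
  by (metis (no_types, opaque_lifting) max.bounded_iff)

lemma evpoly_add:
  assumes "evpoly f" "evpoly g"
  shows "evpoly (\<lambda>t. f t + g t)"
proof -
  obtain k N where k: "\<forall>t\<ge>N. (dif ^^ k) f t = 0" using assms by (auto simp: evpoly_def)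
  obtain l M where l: "\<forall>t\<ge>M. (dif ^^ l) g t = 0" using assms by (auto simp: evpoly_def)
  have "\<forall>t\<ge>max N M. (dif ^^ max k l) (\<lambda>t. f t + g t) t = 0"
    using dif_pow_ge[OF k, of "max k l"] dif_pow_ge[OF l, of "max k l"] by (simp add: dif_pow_add)
  then show ?thesis unfolding evpoly_def by blast
qed

lemma evpoly_zero: "evpoly (\<lambda>t. 0)"
  unfolding evpoly_def by (intro exI[of _ 0]) simp

lemma evpoly_sum: "finite A \<Longrightarrow> (\<And>i. i \<in> A \<Longrightarrow> evpoly (f i)) \<Longrightarrow> evpoly (\<lambda>t. \<Sum>i\<in>A. f i t)"
  by (induction A rule: finite_induct) (auto intro: evpoly_add evpoly_zero)

lemma evpoly_shift: "evpoly f \<Longrightarrow> evpoly (\<lambda>t. f (t - n))"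
  unfolding evpoly_def
proof (elim exE)
  fix k N assume "\<forall>t\<ge>N. (dif ^^ k) f t = 0"
  then show "\<exists>k N. \<forall>t\<ge>N. (dif ^^ k) (\<lambda>t. f (t - n)) t = 0"
    by (intro exI[of _ k] exI[of _ "N + n"]) (simp add: dif_pow_shift)
qed

lemma evpoly_partial_sum: 
  assumes "evpoly f"
  shows "evpoly (\<lambda>t. \<Sum>i\<le>t. f i)"
proof -
  obtain k N where k: "\<forall>t\<ge>N. (dif ^^ k) f t = 0" using assms by (auto simp: evpoly_def)
  have "dif (\<lambda>t. \<Sum>i\<le>t. f i) = (\<lambda>t. f (Suc t))" by (simp add: dif_def fun_eq_iff)
  then have "(dif ^^ Suc k) (\<lambda>t. \<Sum>i\<le>t. f i) = (dif ^^ k) (\<lambda>t. f (Suc t))"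
    by (simp add: funpow_Suc_right del: funpow.simps)
  moreover have "(dif ^^ k) (\<lambda>t. f (Suc t)) t = (dif ^^ k) f (Suc t)" for t
    by (induction k arbitrary: t) (auto simp: dif_def[of "(dif ^^ _) _"])
  ultimately show ?thesis unfolding evpoly_def using k
    by (intro exI[of _ "Suc k"] exI[of _ N]) simp
qed

text \<open>From \<open>N\<close> on the inner sequences coincide, so the tail of the convolution is
  a partial sum of the single sequence \<open>c N\<close>, shifted by \<open>N\<close>, and the
  finitely many earlier terms are shifts. Partial summation costs one more difference, shifting
  none.\<close>

lemma evpoly_convolution:
  assumes "\<And>i. evpoly (c i)" "\<And>i. i \<ge> N \<Longrightarrow> c i = c N"
  shows "evpoly (\<lambda>t. \<Sum>i\<le>t. c i (t - i))"
proof -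
  let ?g = "\<lambda>t. (\<Sum>i<N. c i (t - i)) + (\<Sum>s\<le>t - N. c N s)"
  have "evpoly ?g" using assms(1)
    by (intro evpoly_add evpoly_sum evpoly_shift[of "\<lambda>t. \<Sum>s\<le>t. c N s"] evpoly_partial_sum)
       (auto intro: evpoly_shift)
  moreover have "?g t = (\<Sum>i\<le>t. c i (t - i))" if "t \<ge> N" for t
  proof -
    have "{..t} = {..<N} \<union> {N..t}" using that by auto
    moreover have "{..<N} \<inter> {N..t} = {}" by auto
    ultimately have "(\<Sum>i\<le>t. c i (t - i)) = (\<Sum>i<N. c i (t - i)) + (\<Sum>i=N..t. c i (t - i))"
      by (simp only: sum.union_disjoint finite_lessThan finite_atLeastAtMost)
    also have "(\<Sum>i=N..t. c i (t - i)) = (\<Sum>i=N..t. c N (t - i))"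
      by (intro sum.cong refl) (metis assms(2) atLeastAtMost_iff)
    also have "\<dots> = (\<Sum>s\<le>t - N. c N s)"
      by (rule sum.reindex_bij_witness[of _ "\<lambda>s. t - s" "\<lambda>i. t - i"]) (use that in auto)
    finally show ?thesis by simp
  qed
  ultimately show ?thesis using evpoly_cong[of N ?g] by simp
qed

text \<open>Newton's forward difference formula; it turns a vanishing difference into a finite
  expansion in binomial coefficients.\<close>

lemma newton_forward:
  "f (n + s) = (\<Sum>r\<le>s. real (s choose r) * (dif ^^ r) f n)"
proof (induction s arbitrary: f)
  case (Suc s)
  have "f (n + Suc s) = f (n + s) + dif f (n + s)" by (simp add: dif_def)
  also have "f (n + s) = (\<Sum>r\<le>Suc s. real (s choose r) * (dif ^^ r) f n)" using Suc by simp
  also have "\<dots> = f n + (\<Sum>r\<le>s. real (s choose Suc r) * (dif ^^ Suc r) f n)"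
    by (subst sum.atMost_Suc_shift) simp
  also have "dif f (n + s) = (\<Sum>r\<le>s. real (s choose r) * (dif ^^ Suc r) f n)"
    using Suc[of "dif f"] by (simp add: funpow_Suc_right del: funpow.simps)
  finally show ?case
    by (subst sum.atMost_Suc_shift) (simp add: sum.distrib algebra_simps)
qed simp

lemma evpoly_binomial:
  assumes "evpoly f"
  obtains N k c where "\<And>s. f (N + s) = (\<Sum>r<k. c r * real (s choose r))"
proof -
  obtain k N where k: "\<forall>t\<ge>N. (dif ^^ k) f t = 0" using assms by (auto simp: evpoly_def)
  have "f (N + s) = (\<Sum>r<k. (dif ^^ r) f N * real (s choose r))" for s
  proof -
    have "f (N + s) = (\<Sum>r\<le>s. (dif ^^ r) f N * real (s choose r))"
      by (simp add: newton_forward mult.commute)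
    also have "\<dots> = (\<Sum>r\<in>{..s} \<inter> {..<k}. (dif ^^ r) f N * real (s choose r))"
      using dif_pow_ge[OF k, of _ N] by (intro sum.mono_neutral_right) (auto simp: not_less)
    also have "\<dots> = (\<Sum>r<k. (dif ^^ r) f N * real (s choose r))"
      by (intro sum.mono_neutral_left) auto
    finally show ?thesis .
  qed
  then show ?thesis by (rule that)
qed

text \<open>This is the Hilbert function of a quotient of monomial ideals, graded by the variables
  in \<open>W\<close>. The induction removes a variable \<open>x\<close> and cuts both sets into
  slices by the exponent of \<open>x\<close>; the slices grow with that exponent and stabilize,
  which is the situation of \<open>evpoly_convolution\<close>. For \<open>x\<close> outside
  \<open>W\<close> the degree does not limit the exponent of \<open>x\<close>, and the finiteness
  assumption takes over.\<close>

lemma upset_slice_count_evpoly: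
  assumes "finite K" "W \<subseteq> K" "upset K A" "upset K B" "\<And>t. finite {m \<in> A - B. wt W m = t}"
  shows "evpoly (\<lambda>t. real (card {m \<in> A - B. wt W m = t}))"
  using assms
proof (induction K arbitrary: W A B)
  case empty
  then show ?case
    by (intro evpoly_cong[of 1, OF _ evpoly_zero]) (auto simp: wt_def)
next
  case (insert x K W A B)
  let ?s = "\<lambda>i. Poly_Mapping.single x (i::nat) :: expo"
  define sl where "sl A i = {m \<in> exps K. m + ?s i \<in> A}" for A i
  define D where "D i t = {m \<in> sl A i - sl B i. wt (W - {x}) m = t}" for i t
  define S where "S t = {m \<in> A - B. wt W m = t}" for t
  have s_exps: "?s i \<in> exps (insert x K)" for i by (simp add: exps_def)
  have sub: "exps K \<subseteq> exps (insert x K)" by (auto simp: exps_def)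
  have coefx: "m \<in> exps K \<Longrightarrow> coef m x = 0" for m using insert.hyps by (auto intro: exps_coef)
  have up: "upset K (sl U i)" if "upset (insert x K) U" for U i
    using upsetD[OF that] sub unfolding upset_def sl_def by (auto simp: add.assoc add.commute[of _ "?s i"]) (metis add.assoc subsetD)
  have "sl U i \<subseteq> sl U (Suc i)" if "upset (insert x K) U" for U i
  proof
    fix m assume "m \<in> sl U i"
    moreover have "m + ?s (Suc i) = (m + ?s i) + ?s 1" by (simp add: add.assoc flip: single_add)
    ultimately show "m \<in> sl U (Suc i)" using upsetD[OF that _ s_exps[of 1]] by (auto simp: sl_def)
  qed
  note inc = this
  have stab: "\<exists>N. \<forall>i\<ge>N. sl U i = sl U N" if "upset (insert x K) U" for U
    by (rule upset_chain_stable[of K "sl U", OF insert.hyps(1) up[OF that] inc[OF that]])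
  obtain N1 where N1: "\<forall>i\<ge>N1. sl A i = sl A N1" using stab[OF insert.prems(2)] by (elim exE)
  obtain N2 where N2: "\<forall>i\<ge>N2. sl B i = sl B N2" using stab[OF insert.prems(3)] by (elim exE)
  define N where "N = max N1 N2"
  have DN: "D i = D N" if "i \<ge> N" for i
  proof -
    have "sl A i = sl A N" "sl B i = sl B N" using that N1[rule_format, of i] N1[rule_format, of N] N2[rule_format, of i] N2[rule_format, of N] by (simp_all add: N_def)
    then show ?thesis by (simp add: D_def fun_eq_iff)
  qed
  have wtW: "wt W (m + ?s i) = wt (W - {x}) m + (if x \<in> W then i else 0)" if "m \<in> exps K" for m i
  proof -
    have fin: "finite W" using insert.prems(1) insert.hyps(1) finite_subset by blast
    have "wt W m = wt (W - {x}) m"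
      using sum.remove[OF fin, of x "coef m"] coefx[OF that] by (cases "x \<in> W") (simp_all add: wt_def)
    moreover have "wt W (?s i) = (if x \<in> W then i else 0)"
      using fin by (simp add: wt_def lookup_single when_def)
    ultimately show ?thesis by (simp add: wt_add)
  qed
  have dec: "\<exists>m'\<in>exps K. \<exists>i. m = m' + ?s i" if "m \<in> exps (insert x K)" for m
  proof (intro bexI exI)
    show "m = restr K m + ?s (coef m x)"
      using insert.hyps(2) exps_coef[OF that] by (intro poly_mapping_eqI) (auto simp: lookup_add lookup_single when_def)
  qed simp
  have inj: "m = m' \<and> i = j" if "m + ?s i = m' + ?s j" "m \<in> exps K" "m' \<in> exps K" for m m' i j
  proof -
    have "coef (m + ?s i) x = coef (m' + ?s j) x" using that by simp
    then have "i = j" using coefx[OF that(2)] coefx[OF that(3)] by (simp add: lookup_add)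
    then show ?thesis using that(1) by simp
  qed
  \<comment> \<open>If \<open>x\<close> counts for the degree, exponent \<open>i\<close> leaves
    degree \<open>t - i\<close>; the side condition \<open>i \<le> t\<close> keeps the truncated
    subtraction from producing spurious pairs.\<close>
  have S: "S t = (\<lambda>(i, m). m + ?s i) ` {(i, m). m \<in> D i (t - (if x \<in> W then i else 0)) \<and> (x \<in> W \<longrightarrow> i \<le> t)}" (is "_ = ?f ` ?R t") for t
  proof (intro subset_antisym subsetI)
    fix m assume m: "m \<in> S t"
    then have "m \<in> exps (insert x K)" using upset_subset[OF insert.prems(2)] by (auto simp: S_def)
    then obtain m' i where "m' \<in> exps K" "m = m' + ?s i" using dec by blast
    then have "(i, m') \<in> ?R t" using m wtW[of m' i]
      by (cases "x \<in> W") (auto simp: S_def D_def sl_def)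
    then show "m \<in> ?f ` ?R t" using \<open>m = _\<close> by (intro image_eqI[of _ _ "(i, m')"]) simp_all
  next
    fix m assume "m \<in> ?f ` ?R t"
    then show "m \<in> S t" by (auto simp: S_def D_def sl_def wtW split: if_splits)
  qed
  have injf: "inj_on ?f (?R t)" for t
  proof (rule inj_onI, clarify)
    fix i m j m' assume "m \<in> D i (t - (if x \<in> W then i else 0))" "m' \<in> D j (t - (if x \<in> W then j else 0))" "m + ?s i = m' + ?s j"
    then show "i = j \<and> m = m'" using inj[of m i m' j] by (simp add: D_def sl_def)
  qed
  have cardS: "card (S t) = card (?R t)" for t by (simp add: S card_image injf)
  have finR: "finite (?R t)" for t
    using insert.prems(4)[of t] S[of t] finite_imageD[OF _ injf[of t]] by (simp add: S_def)
  have finD: "finite (D i t)" for i t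
  proof -
    have "(\<lambda>m. (i, m)) ` D i t \<subseteq> ?R (t + (if x \<in> W then i else 0))" by auto
    then have "finite ((\<lambda>m. (i, m)) ` D i t)" using finR finite_subset by blast
    then show ?thesis by (rule finite_imageD) (simp add: inj_on_def)
  qed
  have ev: "evpoly (\<lambda>t. real (card (D i t)))" for i
    unfolding D_def
  proof (rule insert.IH)
    show "finite {m \<in> sl A i - sl B i. wt (W - {x}) m = t}" for t using finD[of i t] by (simp add: D_def)
  qed (use insert.prems up in auto)
  show ?case
  proof (cases "x \<in> W")
    case True
    have "card (S t) = (\<Sum>i\<le>t. card (D i (t - i)))" for t
    proof -
      have "?R t = (SIGMA i:{..t}. D i (t - i))" using True by auto
      then show ?thesis using finD by (simp add: cardS)
    qed
    moreover have "evpoly (\<lambda>t. \<Sum>i\<le>t. real (card (D i (t - i))))"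
    proof (rule evpoly_convolution[of "\<lambda>i t. real (card (D i t))" N, OF ev])
      fix i assume "i \<ge> N"
      show "(\<lambda>t. real (card (D i t))) = (\<lambda>t. real (card (D N t)))" unfolding DN[OF \<open>i \<ge> N\<close>] ..
    qed
    ultimately show ?thesis by (simp add: S_def)
  next
    case False
    \<comment> \<open>Here \<open>x\<close> does not contribute to the degree. A point in a stable
      slice would reappear for every larger exponent of \<open>x\<close>, all in the same degree
      \<open>t\<close>, against finiteness.\<close>
    have emp: "D i t = {}" if "i \<ge> N" for i t
    proof (rule ccontr)
      assume "D i t \<noteq> {}"
      then obtain m where m: "m \<in> D N t" unfolding DN[OF \<open>i \<ge> N\<close>] by auto
      have "m \<in> D j t" if "j \<ge> N" for j using m unfolding DN[OF that] .
      then have "(\<lambda>i. (i, m)) ` {N..} \<subseteq> ?R t" using False by auto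
      then have "finite ((\<lambda>i. (i, m)) ` {N..})" using finR finite_subset by blast
      then have "finite {N..}" by (rule finite_imageD) (simp add: inj_on_def)
      then show False by (simp add: infinite_Ici)
    qed
    have "card (S t) = (\<Sum>i<N. card (D i t))" for t
    proof -
      have "?R t = (SIGMA i:{..<N}. D i t)" using False emp by (auto simp: not_less) (metis emptyE linorder_not_le)
      then show ?thesis using finD by (simp add: cardS)
    qed
    moreover have "evpoly (\<lambda>t. \<Sum>i<N. real (card (D i t)))"
      by (intro evpoly_sum ev) auto
    ultimately show ?thesis by (simp add: S_def)
  qed
qed

section \<open>Growth of binomial sums and convergence\<close>

lemma tendsto_zero_norm_bound:
  fixes f g :: "nat \<Rightarrow> real"
  assumes "eventually (\<lambda>s. norm (f s) \<le> g s) sequentially" "g \<longlonglongrightarrow> 0"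
  shows "f \<longlonglongrightarrow> 0"
  by (rule tendsto_norm_zero_cancel, rule tendsto_sandwich[OF _ assms(1) tendsto_const assms(2)]) auto

lemma shift_ratio_tendsto: "(\<lambda>s. ((real N + real s) / real s) ^ d) \<longlonglongrightarrow> 1"
proof -
  have "(\<lambda>s. (real N + real s) / real s) \<longlonglongrightarrow> 1" by real_asymp
  then show ?thesis using tendsto_power[of _ 1 _ d] by fastforce
qed

lemma choose_tendsto: "(\<lambda>s. real (s choose r) / real s ^ r) \<longlonglongrightarrow> 1 / fact r"
proof (induction r)
  case (Suc r)
  have eq: "real (s choose Suc r) / real s ^ Suc r
      = real (s choose r) / real s ^ r * ((real s - real r) / real s) / (real r + 1)" for s
  proof -
    have "real (s choose Suc r) * (real r + 1) = real (s choose r) * (real s - real r)"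
    proof (cases "r \<le> s")
      case True
      have "(s choose Suc r) * Suc r = (s choose r) * (s - r)"
        using binomial_absorb_comp[of s r] Suc_times_binomial_add[of r "s - r - 1"] True
        by (metis binomial_absorption mult.commute)
      then have "real ((s choose Suc r) * Suc r) = real ((s choose r) * (s - r))" by (rule arg_cong)
      then show ?thesis using True by (simp add: of_nat_diff algebra_simps)
    qed (simp add: binomial_eq_0)
    then have "real (s choose Suc r) = real (s choose r) * (real s - real r) / (real r + 1)"
      by (simp add: field_simps)
    then show ?thesis by simp
  qed
  have "(\<lambda>s. (real s - real r) / real s) \<longlonglongrightarrow> 1" by real_asymp
  from tendsto_divide[OF tendsto_mult[OF Suc.IH this] tendsto_const[of "real r + 1"]]
  show ?case unfolding eq by (simp add: field_simps)
qed simp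

lemma choose_over_power_tendsto_0:
  assumes "r < m"
  shows "(\<lambda>s. real (s choose r) / real s ^ m) \<longlonglongrightarrow> 0"
proof -
  have "(\<lambda>s. (1 / real s) ^ (m - r)) \<longlonglongrightarrow> 0 ^ (m - r)" by (intro tendsto_power) real_asymp
  then have "(\<lambda>s. real (s choose r) / real s ^ r * (1 / real s) ^ (m - r)) \<longlonglongrightarrow> 0"
    using tendsto_mult[OF choose_tendsto[of r]] assms by (fastforce simp: power_0_left)
  moreover have "real s ^ m = real s ^ r * real s ^ (m - r)" for s
    using assms by (simp flip: power_add)
  ultimately show ?thesis by (simp add: power_divide)
qed

lemma choose_sum_tendsto:
  "(\<lambda>s. (\<Sum>r<Suc k. c r * real (s choose r)) / real s ^ k) \<longlonglongrightarrow> c k / fact k"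
proof -
  have "(\<lambda>s. (\<Sum>r<Suc k. c r * (real (s choose r) / real s ^ k))) \<longlonglongrightarrow> (\<Sum>r<Suc k. if r = k then c k / fact k else 0)"
  proof (intro tendsto_sum)
    fix r assume "r \<in> {..<Suc k}"
    then show "(\<lambda>s. c r * (real (s choose r) / real s ^ k)) \<longlonglongrightarrow> (if r = k then c k / fact k else 0)"
      using tendsto_mult[OF tendsto_const choose_tendsto[of k], of "c k"]
        tendsto_mult[OF tendsto_const choose_over_power_tendsto_0[of r k], of "c r"]
      by (cases "r = k") auto
  qed
  then show ?thesis by (simp add: sum_divide_distrib del: sum.lessThan_Suc)
qed

text \<open>Dividing by the power of \<open>s\<close> that belongs to the top term isolates its
  coefficient, while the bound, being of lower degree, tends to zero. The induction strips top
  coefficients until \<open>r\<close> is reached.\<close>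

lemma choose_sum_growth:
  assumes "\<And>s. \<bar>\<Sum>r<k. c r * real (s choose r)\<bar> \<le> C * (real N + real s) ^ d" "r < k" "d < r"
  shows "c r = 0"
  using assms
proof (induction k)
  case (Suc k)
  have dk: "d < k" using Suc.prems by simp
  have "(\<lambda>s. (\<Sum>r<Suc k. c r * real (s choose r)) / real s ^ k) \<longlonglongrightarrow> 0"
  proof (rule tendsto_zero_norm_bound)
    show "\<forall>\<^sub>F s in sequentially. norm ((\<Sum>r<Suc k. c r * real (s choose r)) / real s ^ k)
      \<le> C * (((real N + real s) / real s) ^ d * (1 / real s) ^ (k - d))"
    proof (rule always_eventually, rule allI)
      fix s
      have "real s ^ k = real s ^ d * real s ^ (k - d)"
        using dk by (simp flip: power_add)
      then have "C * (((real N + real s) / real s) ^ d * (1 / real s) ^ (k - d)) = C * (real N + real s) ^ d / real s ^ k"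
        by (simp add: power_divide)
      then show "norm ((\<Sum>r<Suc k. c r * real (s choose r)) / real s ^ k)
      \<le> C * (((real N + real s) / real s) ^ d * (1 / real s) ^ (k - d))"
        using Suc.prems(1)[of s] by (simp add: divide_right_mono del: sum.lessThan_Suc)
    qed
    have "(\<lambda>s. (1 / real s) ^ (k - d)) \<longlonglongrightarrow> 0 ^ (k - d)" by (intro tendsto_power) real_asymp
    then have "(\<lambda>s. ((real N + real s) / real s) ^ d * (1 / real s) ^ (k - d)) \<longlonglongrightarrow> 1 * 0 ^ (k - d)"
      by (intro tendsto_mult shift_ratio_tendsto)
    then have "(\<lambda>s. C * (((real N + real s) / real s) ^ d * (1 / real s) ^ (k - d))) \<longlonglongrightarrow> C * (1 * 0 ^ (k - d))"
      by (rule tendsto_mult[OF tendsto_const])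
    then show "(\<lambda>s. C * (((real N + real s) / real s) ^ d * (1 / real s) ^ (k - d))) \<longlonglongrightarrow> 0"
      using dk by (simp add: power_0_left)
  qed
  then have "c k / fact k = 0" using LIMSEQ_unique choose_sum_tendsto by blast
  then have ck: "c k = 0" by simp
  show ?case
  proof (cases "r = k")
    case False
    have "\<bar>\<Sum>r<k. c r * real (s choose r)\<bar> \<le> C * (real N + real s) ^ d" for s
      using Suc.prems(1)[of s] ck by simp
    then show ?thesis using Suc.IH Suc.prems False by (simp add: less_Suc_eq)
  qed (simp add: ck)
qed simp

text \<open>Summation raises the degree of a polynomial by one, so partial sums of order
  \<open>t ^ d\<close> force degree at most \<open>d - 1\<close> on the summand, exactly what the
  normalization needs.\<close>

lemma evpoly_tendsto:
  assumes "evpoly f" "\<And>t. f t \<ge> 0" "\<And>t. (\<Sum>i\<le>t. f i) \<le> C * (real t + 1) ^ d" "d \<ge> 1"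
  shows "convergent (\<lambda>t. f t / real t ^ (d - 1))"
proof -
  obtain N k c where c: "\<And>s. f (N + s) = (\<Sum>r<k. c r * real (s choose r))"
    using evpoly_binomial[OF assms(1)] by metis
  have C: "C \<ge> 0" using assms(2)[of 0] assms(3)[of 0] by simp
  \<comment> \<open>By the hockey stick identity, summing moves the coefficient of
    \<open>s choose r\<close> to \<open>s choose Suc r\<close>; there is no constant term because
    the sum over an empty range is zero.\<close>
  define c' where "c' r = (case r of 0 \<Rightarrow> 0 | Suc r \<Rightarrow> c r)" for r
  have G: "(\<Sum>i<s. f (N + i)) = (\<Sum>r<Suc k. c' r * real (s choose r))" for s
  proof -
    have hockey: "(\<Sum>i<s. real (i choose r)) = real (s choose Suc r)" for r
      by (induction s) auto
    have "(\<Sum>i<s. f (N + i)) = (\<Sum>r<k. \<Sum>i<s. c r * real (i choose r))"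
      unfolding c by (rule sum.swap)
    also have "\<dots> = (\<Sum>r<k. c r * real (s choose Suc r))"
      by (simp add: hockey flip: sum_distrib_left)
    also have "\<dots> = (\<Sum>r<Suc k. c' r * real (s choose r))"
      by (subst sum.lessThan_Suc_shift) (simp add: c'_def)
    finally show ?thesis .
  qed
  have "\<bar>\<Sum>r<Suc k. c' r * real (s choose r)\<bar> \<le> C * (real N + real s) ^ d" for s
  proof (cases s)
    case 0
    then show ?thesis using G[of 0] C by (simp del: sum.lessThan_Suc)
  next
    case (Suc s')
    have "(\<Sum>i<s. f (N + i)) = (\<Sum>i\<in>(\<lambda>i. N + i) ` {..<s}. f i)" by (simp add: sum.reindex)
    also have "\<dots> \<le> (\<Sum>i\<le>N + s'. f i)" using assms(2) Suc by (intro sum_mono2) auto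
    also have "\<dots> \<le> C * (real N + real s) ^ d" using assms(3)[of "N + s'"] Suc by (simp add: add_ac)
    finally show ?thesis unfolding G[symmetric] using assms(2) by (simp add: sum_nonneg)
  qed
  from choose_sum_growth[OF this] have c0: "c r = 0" if "r < k" "d \<le> r" for r
    using that by (force simp: c'_def dest: spec[of _ "Suc r"])
  have "f (N + s) = (\<Sum>r<Suc (d - 1). (if r < k then c r else 0) * real (s choose r))" for s
  proof -
    have "f (N + s) = (\<Sum>r\<in>{..<k} \<inter> {..<d}. c r * real (s choose r))"
      unfolding c using c0 by (intro sum.mono_neutral_right) (auto, meson linorder_not_le)
    also have "\<dots> = (\<Sum>r<d. (if r < k then c r else 0) * real (s choose r))"
      by (intro sum.mono_neutral_cong_left) auto
    finally show ?thesis using assms(4) by simp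
  qed
  then have "(\<lambda>s. f (N + s) / real s ^ (d - 1)) \<longlonglongrightarrow> (if d - 1 < k then c (d - 1) else 0) / fact (d - 1)" (is "_ \<longlonglongrightarrow> ?L")
    using choose_sum_tendsto[of "\<lambda>r. if r < k then c r else 0" "d - 1"] by (simp only:)
  \<comment> \<open>So far \<open>f (N + s)\<close> is compared with a power of \<open>s\<close>;
    dividing by a power of \<open>(N + s) / s\<close>, which tends to 1, turns this into a
    comparison with the true argument.\<close>
  from tendsto_divide[OF this shift_ratio_tendsto[of N "d - 1"]]
  have "(\<lambda>s. (f (N + s) / real s ^ (d - 1)) / ((real N + real s) / real s) ^ (d - 1)) \<longlonglongrightarrow> ?L" by simp
  then have "(\<lambda>s. f (N + s) / (real N + real s) ^ (d - 1)) \<longlonglongrightarrow> ?L"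
    by (rule Lim_transform_eventually) (rule eventually_mono[OF eventually_gt_at_top[of 0]], simp add: power_divide)
  then have "(\<lambda>s. f (s + N) / real (s + N) ^ (d - 1)) \<longlonglongrightarrow> ?L" by (simp add: add.commute)
  from LIMSEQ_offset[OF this] show ?thesis by (auto simp: convergent_def)
qed

section \<open>Torsion monomials of the graded pieces\<close>

definition torsion_exps :: "nat set \<Rightarrow> expo set \<Rightarrow> expo set \<Rightarrow> expo set" where
  "torsion_exps V E F = {u \<in> E. u \<notin> F \<and> (\<exists>r. \<forall>v\<in>exps V. r \<le> wt V v \<longrightarrow> u + v \<in> F)}"

definition tset :: "nat set \<Rightarrow> expo set \<Rightarrow> nat \<Rightarrow> expo set" where
  "tset V E t = torsion_exps V (epow V E t) (epow V E (Suc t))"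

section \<open>A box around the torsion exponents\<close>

lemma box_card:
  assumes "finite V"
  shows "finite {u \<in> exps V. \<forall>i\<in>V. coef u i < n}" "card {u \<in> exps V. \<forall>i\<in>V. coef u i < n} \<le> n ^ card V"
proof -
  let ?B = "{u \<in> exps V. \<forall>i\<in>V. coef u i < n}"
  let ?g = "\<lambda>u. \<lambda>i\<in>V. coef u i"
  have inj: "inj_on ?g ?B"
  proof (rule inj_onI, rule poly_mapping_eqI)
    fix u v k assume *: "u \<in> ?B" "v \<in> ?B" "?g u = ?g v"
    have "k \<in> V \<Longrightarrow> coef u k = coef v k" using fun_cong[OF *(3), of k] by simp
    then show "coef u k = coef v k"
      using exps_coef[of u V k] exps_coef[of v V k] *(1,2) by (cases "k \<in> V") auto
  qed
  have sub: "?g ` ?B \<subseteq> (\<Pi>\<^sub>E i\<in>V. {..<n})" by auto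
  have fin: "finite (\<Pi>\<^sub>E i\<in>V. {..<n})" using assms by (intro finite_PiE) auto
  show "finite ?B" using finite_imageD[OF finite_subset[OF sub fin] inj] .
  have "card ?B = card (?g ` ?B)" using inj by (simp add: card_image)
  also have "\<dots> \<le> card (\<Pi>\<^sub>E i\<in>V. {..<n})" by (rule card_mono[OF fin sub])
  also have "\<dots> = n ^ card V" using assms by (simp add: card_PiE)
  finally show "card ?B \<le> n ^ card V" .
qed

text \<open>An element of the \<open>t\<close>-th power is a multiple of a product of
  \<open>t\<close> generators, and each of these raises a coordinate by at most
  \<open>b\<close>.\<close>

lemma epow_bounded_factor:
  assumes "upset V E" "M \<subseteq> E" "E \<subseteq> msum M (exps V)" "\<And>e i. e \<in> M \<Longrightarrow> coef e i \<le> b" "w \<in> epow V E t"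
  shows "\<exists>g\<in>epow V E t. \<exists>v\<in>exps V. w = g + v \<and> (\<forall>i. coef g i \<le> t * b)"
  using assms(5)
proof (induction t arbitrary: w)
  case 0
  show ?case
    by (rule bexI[of _ 0], rule bexI[of _ w]) (use 0 in simp_all)
next
  case (Suc t)
  then obtain a e where "w = a + e" "a \<in> epow V E t" "e \<in> E" by (auto elim: msumE)
  moreover from Suc.IH[OF this(2)] obtain g v where "g \<in> epow V E t" "v \<in> exps V" "a = g + v" and gb: "\<And>i. coef g i \<le> t * b"
    by blast
  moreover from \<open>e \<in> E\<close> obtain m v' where "m \<in> M" "v' \<in> exps V" "e = m + v'" using subsetD[OF assms(3)] by (blast elim: msumE)
  moreover have "coef g i + coef m i \<le> Suc t * b" for i
    using add_mono[OF assms(4)[OF \<open>m \<in> M\<close>, of i] gb[of i]] by (simp add: add.commute)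
  ultimately show ?case using assms(2) gb
    by (intro bexI[of _ "g + m"] bexI[of _ "v + v'"]) (auto simp: add_ac lookup_add intro: msumI)
qed

text \<open>Suppose one coordinate \<open>i\<close> of a torsion exponent \<open>u\<close> is large.
  Multiplying by a high power of the variable \<open>i\<close> leads into the next power of the
  ideal, so some product \<open>g\<close> of generators divides the result. Since the coordinates of
  \<open>g\<close> are small, \<open>g\<close> already divides \<open>u\<close>; then
  \<open>u\<close> lies in the next power, which torsion exponents avoid.\<close>

lemma tset_bounded:
  assumes "finite V" "upset V E"
  shows "\<exists>b. \<forall>t. tset V E t \<subseteq> {u \<in> exps V. \<forall>i\<in>V. coef u i < Suc t * b}"
proof -
  obtain M where M: "finite M" "M \<subseteq> E" "E \<subseteq> msum M (exps V)"
    using dickson[OF assms(1) upset_subset[OF assms(2)]] by metis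
  define b where "b = (\<Sum>e\<in>M. \<Sum>i\<in>supp e. coef e i)"
  have b: "coef e i \<le> b" if "e \<in> M" for e i
  proof (cases "i \<in> supp e")
    case True
    then have "coef e i \<le> (\<Sum>i\<in>supp e. coef e i)" by (intro member_le_sum) auto
    also have "\<dots> \<le> b" unfolding b_def using M(1) that by (intro member_le_sum) auto
    finally show ?thesis .
  qed (simp add: in_keys_iff)
  have "coef u i < Suc t * b" if u: "u \<in> tset V E t" and i: "i \<in> V" for t u i
  proof (rule ccontr)
    assume *: "\<not> coef u i < Suc t * b"
    have uV: "u \<in> exps V" using u upset_subset[OF upset_epow[OF assms(2)]] by (auto simp: tset_def torsion_exps_def)
    obtain r where r: "\<And>v. v \<in> exps V \<Longrightarrow> r \<le> wt V v \<Longrightarrow> u + v \<in> epow V E (Suc t)"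
      using u by (auto simp: tset_def torsion_exps_def)
    let ?v = "Poly_Mapping.single i r"
    have "?v \<in> exps V" "wt V ?v = r"
      using i assms(1) by (auto simp: exps_def wt_def lookup_single when_def)
    then have "u + ?v \<in> epow V E (Suc t)" using r by simp
    then obtain g w where g: "g \<in> epow V E (Suc t)" "w \<in> exps V" "u + ?v = g + w" "\<And>i. coef g i \<le> Suc t * b"
      using epow_bounded_factor[OF assms(2) M(2,3) b] by metis
    have "coef g j \<le> coef u j" for j
    proof (cases "j = i")
      case True
      then show ?thesis using g(4)[of i] * by simp
    next
      case False
      have "coef (u + ?v) j = coef (g + w) j" using g(3) by simp
      then show ?thesis using False by (simp add: lookup_add lookup_single)
    qed
    moreover have "g \<in> exps V" using g(1) upset_subset[OF upset_epow[OF assms(2)]] by blast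
    ultimately obtain v where "v \<in> exps V" "u = g + v" using exps_le_add uV by metis
    then have "u \<in> epow V E (Suc t)" using upsetD[OF upset_epow[OF assms(2)] g(1)] by simp
    then show False using u by (simp add: tset_def torsion_exps_def)
  qed
  moreover have "tset V E t \<subseteq> exps V" for t
    using upset_subset[OF upset_epow[OF assms(2)]] by (auto simp: tset_def torsion_exps_def)
  ultimately have "tset V E t \<subseteq> {u \<in> exps V. \<forall>i\<in>V. coef u i < Suc t * b}" for t by blast
  then show ?thesis by blast
qed

lemma finite_tset:
  assumes "finite V" "upset V E"
  shows "finite (tset V E t)"
proof -
  obtain b where "\<forall>t. tset V E t \<subseteq> {u \<in> exps V. \<forall>i\<in>V. coef u i < Suc t * b}"
    using tset_bounded[OF assms] by (elim exE)
  then show ?thesis using box_card(1)[OF assms(1)] finite_subset by blast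
qed

text \<open>A torsion exponent of degree \<open>i\<close> avoids the power \<open>i + 1\<close>,
  which contains all higher powers.\<close>

lemma tset_disjoint:
  assumes "upset V E" "i \<noteq> j"
  shows "tset V E i \<inter> tset V E j = {}"
proof -
  have "tset V E i \<inter> tset V E j = {}" if "i < j" for i j
    using epow_antimono[OF assms(1), of "Suc i" j] that by (auto simp: tset_def torsion_exps_def)
  then show ?thesis using assms(2) by (metis Int_commute linorder_neqE_nat)
qed

lemma tset_sum_bound:
  assumes "finite V" "upset V E"
  shows "\<exists>C. \<forall>t. (\<Sum>i\<le>t. real (card (tset V E i))) \<le> C * (real t + 1) ^ card V"
proof -
  obtain b where "\<forall>t. tset V E t \<subseteq> {u \<in> exps V. \<forall>i\<in>V. coef u i < Suc t * b}"
    using tset_bounded[OF assms] by (elim exE)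
  note b = this[rule_format]
  have "(\<Sum>i\<le>t. real (card (tset V E i))) \<le> real b ^ card V * (real t + 1) ^ card V" for t
  proof -
    let ?B = "{u \<in> exps V. \<forall>i\<in>V. coef u i < Suc t * b}"
    have "tset V E i \<subseteq> ?B" if "i \<le> t" for i
    proof -
      have "Suc i * b \<le> Suc t * b" using that by simp
      have "coef u j < Suc t * b" if "u \<in> tset V E i" "j \<in> V" for u j
        by (rule less_le_trans[OF _ \<open>Suc i * b \<le> Suc t * b\<close>]) (use b[of i] that in blast)
      then show ?thesis using b[of i] by blast
    qed
    then have UB: "(\<Union>i\<le>t. tset V E i) \<subseteq> ?B" by blast
    have "(\<Sum>i\<le>t. card (tset V E i)) = card (\<Union>i\<le>t. tset V E i)"
      using tset_disjoint[OF assms(2)] finite_tset[OF assms] by (subst card_UN_disjoint) auto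
    also have "\<dots> \<le> (Suc t * b) ^ card V"
      using card_mono[OF box_card(1)[OF assms(1)] UB] box_card(2)[OF assms(1), of "Suc t * b"] by linarith
    finally have "real (\<Sum>i\<le>t. card (tset V E i)) \<le> real ((Suc t * b) ^ card V)" by (rule of_nat_mono)
    also have "real ((Suc t * b) ^ card V) = real b ^ card V * (real t + 1) ^ card V"
      by (simp only: of_nat_power of_nat_mult of_nat_Suc power_mult_distrib mult.commute add.commute)
    finally show ?thesis by simp
  qed
  then show ?thesis by blast
qed

text \<open>The \<open>c\<close>-fold sum of \<open>e\<close>. Exponents are finitely supported
  functions on \<open>nat\<close> and so form a semiring under convolution, in which
  \<open>Poly_Mapping.single 0 c\<close> is the constant \<open>c\<close>; additivity in
  \<open>c\<close> is then distributivity.\<close>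

definition expo_scale :: "nat \<Rightarrow> expo \<Rightarrow> expo" where
  "expo_scale c e = Poly_Mapping.single 0 c * e"

lemma expo_scale_simps:
  "expo_scale 0 e = 0" "expo_scale 1 e = e" "expo_scale (a + b) e = expo_scale a e + expo_scale b e"
  unfolding expo_scale_def single_one mult_1_left by (simp_all add: single_add distrib_right)

lemma epow_1: "E \<subseteq> epow V E 1"
  by (auto simp: msum_def) (metis add_0 exps_zero)

lemma expo_scale_epow: "upset V E \<Longrightarrow> e \<in> E \<Longrightarrow> expo_scale c e \<in> epow V E c"
proof (induction c)
  case (Suc c)
  have "expo_scale (c + 1) e \<in> epow V E (c + 1)"
    unfolding expo_scale_simps using Suc epow_1 by (intro epow_add) (auto simp del: One_nat_def)
  then show ?case by simp
qed (simp add: expo_scale_simps)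

text \<open>The presentation of the associated graded module over a polynomial ring in the variables \<open>V\<close>
  and one extra variable \<open>w\<close> for each generator: the torsion monomials of degree \<open>t\<close> correspond
  to the minimal preimages, which form the difference of two upward closed sets of exponents.\<close>

lemma tset_evpoly:
  assumes "finite V" "upset V E"
  shows "evpoly (\<lambda>t. real (card (tset V E t)))"
proof -
  obtain M where M: "finite M" "M \<subseteq> E" "E \<subseteq> msum M (exps V)"
    using dickson[OF assms(1) upset_subset[OF assms(2)]] by metis
  obtain h where h: "bij_betw h {0..<card M} M" using ex_bij_betw_nat_finite[OF M(1)] by blast
  \<comment> \<open>Every element of \<open>V\<close> is at most the sum of \<open>V\<close>, so the
    indices from \<open>l\<close> on are fresh and can name the generators.\<close>
  define l where "l = Suc (\<Sum>V)"
  define W where "W = {l..<l + card M}"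
  define e where "e w = h (w - l)" for w
  have "bij_betw (\<lambda>w. w - l) W {0..<card M}"
    unfolding W_def by (rule bij_betw_byWitness[of _ "\<lambda>i. i + l"]) auto
  then have "bij_betw (h \<circ> (\<lambda>w. w - l)) W M" using h by (rule bij_betw_trans)
  then have eW: "e ` W = M" by (auto simp: bij_betw_def e_def)
  have "v < l" if "v \<in> V" for v
    using member_le_sum[of v V "\<lambda>x. x"] assms(1) that by (simp add: l_def)
  then have disj: "V \<inter> W = {}" by (fastforce simp: W_def)
  have finW: "finite W" by (simp add: W_def)
  define K where "K = V \<union> W"
  have finK: "finite K" using assms(1) finW by (simp add: K_def)
  \<comment> \<open>The presentation map on exponents: variables in \<open>V\<close> go to
    themselves and the variable \<open>w\<close> goes to the generator \<open>e w\<close>; the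
    degree in \<open>W\<close> records the power of the ideal that is reached.\<close>
  define \<phi> where "\<phi> m = restr V m + (\<Sum>w\<in>W. expo_scale (coef m w) (e w))" for m
  have \<phi>_add: "\<phi> (m + m') = \<phi> m + \<phi> m'" for m m'
    by (simp add: \<phi>_def restr_add lookup_add expo_scale_simps sum.distrib add_ac)
  have \<phi>_pow: "\<phi> m \<in> epow V E (wt W m)" for m
  proof -
    have "(\<Sum>w\<in>W'. expo_scale (coef m w) (e w)) \<in> epow V E (\<Sum>w\<in>W'. coef m w)" if "W' \<subseteq> W" for W'
      using finite_subset[OF that finW] that
    proof (induction W' rule: finite_induct)
      case (insert w W')
      then have "e w \<in> E" using eW M(2) by auto
      then show ?case using insert expo_scale_epow[OF assms(2)] epow_add[OF assms(2)] by simp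
    qed simp
    from this[OF order_refl] have "(\<Sum>w\<in>W. expo_scale (coef m w) (e w)) \<in> epow V E (wt W m)" by (simp add: wt_def)
    from upsetD[OF upset_epow[OF assms(2)] this restr_exps[of V m]]
    show ?thesis by (simp add: \<phi>_def add.commute)
  qed
  have \<phi>V: "\<phi> v = v \<and> wt W v = 0" if "v \<in> exps V" for v
  proof -
    have "coef v w = 0" if "w \<in> W" for w using \<open>v \<in> exps V\<close> that disj by (auto intro: exps_coef)
    then show ?thesis using that by (simp add: \<phi>_def wt_def expo_scale_simps restr_id exps_def)
  qed
  have \<phi>W: "\<phi> (Poly_Mapping.single w 1) = e w \<and> wt W (Poly_Mapping.single w 1) = 1" if "w \<in> W" for w
  proof -
    have "restr V (Poly_Mapping.single w (1::nat)) = 0"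
      using that disj by (intro poly_mapping_eqI) (auto simp: lookup_single when_def)
    moreover have "(\<Sum>w'\<in>W. expo_scale (coef (Poly_Mapping.single w (1::nat)) w') (e w')) = (\<Sum>w'\<in>W. if w' = w then e w else 0)"
      by (intro sum.cong) (auto simp: lookup_single when_def expo_scale_simps expo_scale_simps(2)[simplified])
    ultimately show ?thesis using that finW by (simp add: \<phi>_def wt_def lookup_single when_def)
  qed
  have \<phi>_surj: "\<exists>m\<in>exps K. wt W m = t \<and> \<phi> m = u" if "u \<in> epow V E t" for u t
    using that
  proof (induction t arbitrary: u)
    case 0
    then show ?case using \<phi>V[of u] by (intro bexI[of _ u]) (auto simp: K_def exps_def)
  next
    case (Suc t)
    then obtain a f where "u = a + f" "a \<in> epow V E t" "f \<in> E" by (auto elim: msumE)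
    moreover from Suc.IH[OF this(2)] obtain m where "m \<in> exps K" "wt W m = t" "\<phi> m = a" by blast
    moreover obtain w v where "w \<in> W" "v \<in> exps V" "f = e w + v"
      using \<open>f \<in> E\<close> M(3) eW by (auto elim!: msumE)
    moreover have "v \<in> exps K" "Poly_Mapping.single w 1 \<in> exps K"
      using \<open>v \<in> exps V\<close> \<open>w \<in> W\<close> by (auto simp: K_def exps_def)
    ultimately show ?case
      using \<phi>V[of v] \<phi>W[of w]
      by (intro bexI[of _ "m + Poly_Mapping.single w 1 + v"]) (simp_all add: \<phi>_add wt_add add_ac)
  qed
  \<comment> \<open>\<open>B\<close> collects what must not be counted: exponents whose image
    already lies in the next power, and exponents that are not least in their fibre within their
    degree. The linear order on exponents is compatible with addition, so both conditions persist
    under multiplication.\<close>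
  define B where "B = {m \<in> exps K. \<phi> m \<in> epow V E (Suc (wt W m)) \<or>
    (\<exists>m'\<in>exps K. m' < m \<and> wt W m' = wt W m \<and> \<phi> m' = \<phi> m)}"
  define A where "A = {m \<in> exps K. \<exists>r. \<forall>v\<in>exps V. r \<le> wt V v \<longrightarrow> \<phi> m + v \<in> epow V E (Suc (wt W m))} \<union> B"
  have shift: "\<phi> m + \<phi> v + z \<in> epow V E (Suc (wt W m + wt W v))"
    if "\<phi> m + z \<in> epow V E (Suc (wt W m))" for m v z
    using epow_add[OF assms(2) that \<phi>_pow[of v]] by (simp add: add_ac)
  have B: "upset K B"
    unfolding upset_def
  proof (intro conjI ballI)
    show "B \<subseteq> exps K" by (auto simp: B_def)
    fix m v assume m: "m \<in> B" and v: "v \<in> exps K"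
    show "m + v \<in> B"
    proof (cases "\<phi> m \<in> epow V E (Suc (wt W m))")
      case True
      then show ?thesis using shift[of m 0 v] m v by (auto simp: B_def \<phi>_add wt_add)
    next
      case False
      then obtain m' where "m' \<in> exps K" "m' < m" "wt W m' = wt W m" "\<phi> m' = \<phi> m" using m by (auto simp: B_def)
      then have "m' + v \<in> exps K" "m' + v < m + v" "wt W (m' + v) = wt W (m + v)" "\<phi> (m' + v) = \<phi> (m + v)"
        using v by (auto simp: wt_add \<phi>_add)
      then show ?thesis using m v unfolding B_def by auto
    qed
  qed
  have A: "upset K A"
    unfolding upset_def
  proof (intro conjI ballI)
    show "A \<subseteq> exps K" by (auto simp: A_def B_def)
    fix m v assume m: "m \<in> A" and v: "v \<in> exps K"
    show "m + v \<in> A"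
    proof (cases "m \<in> B")
      case True
      then show ?thesis using upsetD[OF B] v by (auto simp: A_def)
    next
      case False
      then show ?thesis using m v shift[of m _ v] by (auto simp: A_def \<phi>_add wt_add)
    qed
  qed
  have bij: "bij_betw \<phi> {m \<in> A - B. wt W m = t} (tset V E t)" (is "bij_betw _ ?S _") for t
  proof (intro bij_betw_imageI inj_onI)
    fix m m' assume *: "m \<in> ?S" "m' \<in> ?S" "\<phi> m = \<phi> m'"
    then have "\<not> m < m'" "\<not> m' < m" "m \<in> exps K" "m' \<in> exps K" by (auto simp: A_def B_def)
    then show "m = m'" by simp
  next
    show "\<phi> ` ?S = tset V E t"
    proof (intro subset_antisym subsetI)
      fix u assume "u \<in> \<phi> ` ?S"
      then show "u \<in> tset V E t" using \<phi>_pow by (auto simp: tset_def torsion_exps_def A_def B_def)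
    next
      fix u assume u: "u \<in> tset V E t"
      \<comment> \<open>The fibre of \<open>u\<close> in degree \<open>t\<close>. It is finite
        because the degree bounds the coordinates in \<open>W\<close> and \<open>u\<close> bounds
        those in \<open>V\<close>; its least element is the one that is counted.\<close>
      define F where "F = {m \<in> exps K. wt W m = t \<and> \<phi> m = u}"
      have "F \<subseteq> {m \<in> exps K. \<forall>i\<in>K. coef m i < Suc (t + (\<Sum>i\<in>V. coef u i))}"
      proof (clarsimp simp: F_def)
        fix m i assume m: "m \<in> exps K" "i \<in> K" "t = wt W m" "u = \<phi> m"
        show "coef m i < Suc (wt W m + (\<Sum>i\<in>V. coef (\<phi> m) i))"
        proof (cases "i \<in> W")
          case True
          then show ?thesis using coef_le_wt[OF finW True, of m] by simp
        next
          case False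
          then have i: "i \<in> V" using m by (simp add: K_def)
          then have "coef m i \<le> coef (\<phi> m) i" by (simp add: \<phi>_def lookup_add)
          also have "\<dots> \<le> (\<Sum>i\<in>V. coef (\<phi> m) i)" using assms(1) i by (intro member_le_sum) auto
          finally show ?thesis by simp
        qed
      qed
      then have "finite F" using box_card(1)[OF finK] finite_subset by blast
      moreover have "F \<noteq> {}" using \<phi>_surj[of u t] u by (auto simp: F_def tset_def torsion_exps_def)
      ultimately have min: "Min F \<in> F" "\<And>m. m \<in> F \<Longrightarrow> \<not> m < Min F" by (auto simp: not_less)
      then have "Min F \<in> ?S" using u by (auto simp: F_def A_def B_def tset_def torsion_exps_def)
      moreover have "\<phi> (Min F) = u" using min(1) by (simp add: F_def)
      ultimately show "u \<in> \<phi> ` ?S" by blast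
    qed
  qed
  have "evpoly (\<lambda>t. real (card {m \<in> A - B. wt W m = t}))"
  proof (rule upset_slice_count_evpoly[OF finK _ A B])
    show "finite {m \<in> A - B. wt W m = t}" for t
      using bij_betw_finite[OF bij] finite_tset[OF assms] by blast
  qed (simp add: K_def)
  then show ?thesis unfolding bij_betw_same_card[OF bij] .
qed

text \<open>Stated as a relation and not with \<open>lim\<close>, so that a value always comes with
  convergence.\<close>

definition jlimit :: "nat set \<Rightarrow> expo set \<Rightarrow> real \<Rightarrow> bool" where
  "jlimit V E c \<longleftrightarrow> (\<lambda>t. fact (card V - 1) * (real (card (tset V E t)) / real t ^ (card V - 1))) \<longlonglongrightarrow> c"

lemma jlimit_exists:
  assumes "finite V" "V \<noteq> {}" "upset V E"
  shows "\<exists>c. jlimit V E c"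
proof -
  obtain C where "\<forall>t. (\<Sum>i\<le>t. real (card (tset V E i))) \<le> C * (real t + 1) ^ card V"
    using tset_sum_bound[OF assms(1,3)] by (elim exE)
  note C = this[rule_format]
  have "convergent (\<lambda>t. real (card (tset V E t)) / real t ^ (card V - 1))"
    using assms by (intro evpoly_tendsto[OF tset_evpoly _ C]) (auto simp: Suc_le_eq card_gt_0_iff)
  then obtain L where "(\<lambda>t. real (card (tset V E t)) / real t ^ (card V - 1)) \<longlonglongrightarrow> L" by (auto simp: convergent_def)
  from tendsto_mult[OF tendsto_const this] show ?thesis unfolding jlimit_def by blast
qed

section \<open>Sums of ideals in disjoint sets of variables\<close>

definition expo_join :: "nat set \<Rightarrow> expo set \<Rightarrow> expo set \<Rightarrow> expo set" where
  "expo_join V E1 E2 = msum E1 (exps V) \<union> msum E2 (exps V)"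

lemma upset_join:
  "E1 \<subseteq> exps V \<Longrightarrow> E2 \<subseteq> exps V \<Longrightarrow> upset V (expo_join V E1 E2)"
  using upset_gen[of E1 V] upset_gen[of E2 V] by (auto simp: expo_join_def upset_def)

lemma exps_Un_decomp:
  assumes "v \<in> exps (V1 \<union> V2)"
  obtains a b where "a \<in> exps V1" "b \<in> exps V2" "v = a + b"
proof
  show "v = restr V1 v + restr (- V1) v" by (rule restr_split)
  show "restr (- V1) v \<in> exps V2" using assms by (auto simp: exps_def)
qed simp

lemma exps_Un_unique:
  assumes "V1 \<inter> V2 = {}" "a + b = a' + b'" "a \<in> exps V1" "a' \<in> exps V1" "b \<in> exps V2" "b' \<in> exps V2"
  shows "a = a'" "b = b'"
proof -
  have z: "restr V1 c = 0" if "c \<in> exps V2" for c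
    using assms(1) that by (intro poly_mapping_eqI) (auto intro: exps_coef)
  have i: "restr V1 c = c" if "c \<in> exps V1" for c
    using that by (simp add: restr_id exps_def)
  have "restr V1 a + restr V1 b = restr V1 a' + restr V1 b'" by (simp only: restr_add[symmetric] assms(2))
  then show "a = a'" using assms(3-6) by (simp add: z i)
  then show "b = b'" using assms(2) by simp
qed

lemma epow_mono:
  assumes "E \<subseteq> E'" "V \<subseteq> V'"
  shows "epow V E t \<subseteq> epow V' E' t"
proof (induction t)
  case 0
  then show ?case using exps_mono[OF assms(2)] by simp
next
  case (Suc t)
  then show ?case using msum_mono[OF Suc assms(1)] by simp
qed

context
  fixes V1 V2 :: "nat set" and E1 E2 :: "expo set"
  assumes fin: "finite V1" "finite V2" and disj: "V1 \<inter> V2 = {}"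
    and up1: "upset V1 E1" and up2: "upset V2 E2"
begin

abbreviation (input) "V12 \<equiv> V1 \<union> V2"
abbreviation (input) "E12 \<equiv> expo_join (V1 \<union> V2) E1 E2"

lemma E12_upset: "upset V12 E12"
  using upset_join[of E1 V12 E2] upset_subset[OF up1] upset_subset[OF up2] exps_mono[of V1 V12] exps_mono[of V2 V12]
  by blast

text \<open>The binomial expansion of a power of a sum of two ideals. The cofactor of each generator
  involves all variables and is split between the two blocks.\<close>

lemma epow_join:
  "u \<in> epow V12 E12 t \<longleftrightarrow> (\<exists>i a b. i \<le> t \<and> u = a + b \<and> a \<in> epow V1 E1 i \<and> b \<in> epow V2 E2 (t - i))"
proof
  assume "u \<in> epow V12 E12 t"
  then show "\<exists>i a b. i \<le> t \<and> u = a + b \<and> a \<in> epow V1 E1 i \<and> b \<in> epow V2 E2 (t - i)"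
  proof (induction t arbitrary: u)
    case 0
    then have "u \<in> exps (V1 \<union> V2)" by simp
    then obtain a b where "a \<in> exps V1" "b \<in> exps V2" "u = a + b" by (rule exps_Un_decomp)
    then show ?case by auto
  next
    case (Suc t)
    then obtain c e where c: "c \<in> epow V12 E12 t" "e \<in> E12" "u = c + e" by (auto elim: msumE)
    from Suc.IH[OF c(1)] obtain i a b where ab: "i \<le> t" "c = a + b" "a \<in> epow V1 E1 i" "b \<in> epow V2 E2 (t - i)" by blast
    from c(2) consider e' v where "e' \<in> E1" "v \<in> exps V12" "e = e' + v" | e' v where "e' \<in> E2" "v \<in> exps V12" "e = e' + v"
      by (auto simp: expo_join_def elim!: msumE)
    then show ?case
    proof cases
      case 1
      obtain x y where xy: "x \<in> exps V1" "y \<in> exps V2" "v = x + y" by (rule exps_Un_decomp[OF 1(2)])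
      have "a + (e' + x) \<in> epow V1 E1 (Suc i)" using ab upsetD[OF up1 1(1) xy(1)] by (auto intro: msumI)
      moreover have "b + y \<in> epow V2 E2 (t - i)" using upsetD[OF upset_epow[OF up2] ab(4) xy(2)] .
      ultimately show ?thesis using ab c xy 1
        by (intro exI[of _ "Suc i"] exI[of _ "a + (e' + x)"] exI[of _ "b + y"]) (simp add: add_ac)
    next
      case 2
      obtain x y where xy: "x \<in> exps V1" "y \<in> exps V2" "v = x + y" by (rule exps_Un_decomp[OF 2(2)])
      have "b + (e' + y) \<in> epow V2 E2 (Suc t - i)" using ab upsetD[OF up2 2(1) xy(2)] by (auto simp: Suc_diff_le intro: msumI)
      moreover have "a + x \<in> epow V1 E1 i" using upsetD[OF upset_epow[OF up1] ab(3) xy(1)] .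
      ultimately show ?thesis using ab c xy 2
        by (intro exI[of _ i] exI[of _ "a + x"] exI[of _ "b + (e' + y)"]) (simp add: add_ac)
    qed
  qed
next
  assume "\<exists>i a b. i \<le> t \<and> u = a + b \<and> a \<in> epow V1 E1 i \<and> b \<in> epow V2 E2 (t - i)"
  then obtain i a b where ab: "i \<le> t" "u = a + b" "a \<in> epow V1 E1 i" "b \<in> epow V2 E2 (t - i)" by blast
  have "E1 \<subseteq> E12" "E2 \<subseteq> E12" unfolding expo_join_def using subset_gen[of E1 V12] subset_gen[of E2 V12] by blast+
  then have "a \<in> epow V12 E12 i" "b \<in> epow V12 E12 (t - i)"
    using epow_mono[of E1 E12 V1 V12 i] epow_mono[of E2 E12 V2 V12 "t - i"] ab by blast+
  then show "u \<in> epow V12 E12 t" using epow_add[OF E12_upset, of a i b "t - i"] ab by simp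
qed

lemma tset_exps: "tset V1 E1 i \<subseteq> exps V1" "tset V2 E2 i \<subseteq> exps V2"
  using upset_subset[OF upset_epow[OF up1]] upset_subset[OF upset_epow[OF up2]]
  by (auto simp: tset_def torsion_exps_def)

text \<open>The index \<open>i\<close> is the exact order of \<open>a\<close> along the first ideal,
  and \<open>t - i\<close> that of \<open>b\<close> along the second: otherwise \<open>u\<close>
  would lie in the power \<open>t + 1\<close>. Torsion passes to the components because a multiplier
  in one block of variables moves only one of them.\<close>

lemma tset_join:
  "tset V12 E12 t = (\<lambda>(i, a, b). a + b) ` (SIGMA i:{..t}. tset V1 E1 i \<times> tset V2 E2 (t - i))" (is "_ = ?f ` ?S")
proof (intro subset_antisym subsetI)
  fix u assume u: "u \<in> tset V12 E12 t"
  then obtain i a b where ab: "i \<le> t" "u = a + b" "a \<in> epow V1 E1 i" "b \<in> epow V2 E2 (t - i)"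
    by (auto simp: tset_def torsion_exps_def epow_join)
  have V: "a \<in> exps V1" "b \<in> exps V2"
    using ab upset_subset[OF upset_epow[OF up1]] upset_subset[OF upset_epow[OF up2]] by auto
  have nu: "a + b \<notin> epow V12 E12 (Suc t)" using u ab by (auto simp: tset_def torsion_exps_def)
  have na: "a \<notin> epow V1 E1 (Suc i)"
  proof
    assume "a \<in> epow V1 E1 (Suc i)"
    then have "a + b \<in> epow V12 E12 (Suc t)"
      using ab unfolding epow_join by (intro exI[of _ "Suc i"] exI[of _ a] exI[of _ b]) simp
    then show False using nu by simp
  qed
  have nb: "b \<notin> epow V2 E2 (Suc (t - i))"
  proof
    assume "b \<in> epow V2 E2 (Suc (t - i))"
    then have "a + b \<in> epow V12 E12 (Suc t)"
      using ab unfolding epow_join by (intro exI[of _ i] exI[of _ a] exI[of _ b]) (simp add: Suc_diff_le)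
    then show False using nu by simp
  qed
  obtain r where r: "\<And>v. v \<in> exps V12 \<Longrightarrow> r \<le> wt V12 v \<Longrightarrow> a + b + v \<in> epow V12 E12 (Suc t)"
    using u ab by (auto simp: tset_def torsion_exps_def)
  have wt: "wt V12 v = wt V1 v + wt V2 v" for v
    using fin disj by (simp add: wt_def sum.union_disjoint)
  have ta: "a + v \<in> epow V1 E1 (Suc i)" if v: "v \<in> exps V1" "r \<le> wt V1 v" for v
  proof -
    have "(a + v) + b \<in> epow V12 E12 (Suc t)" using r[of v] v exps_mono[of V1 V12] by (auto simp: wt add_ac)
    then obtain j a' b' where j: "j \<le> Suc t" "(a + v) + b = a' + b'" "a' \<in> epow V1 E1 j" "b' \<in> epow V2 E2 (Suc t - j)"
      unfolding epow_join by blast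
    then have "a' \<in> exps V1" "b' \<in> exps V2"
      using upset_subset[OF upset_epow[OF up1]] upset_subset[OF upset_epow[OF up2]] by auto
    with exps_Un_unique[OF disj j(2)] have eq: "a' = a + v" "b' = b" using V v by auto
    \<comment> \<open>\<open>b\<close> has not moved and does not lie in the power
      \<open>t - i + 1\<close>, so the second factor contributes at most \<open>t - i\<close>; the
      first must supply at least \<open>i + 1\<close>.\<close>
    have "Suc t - j \<le> t - i" using nb j(4) epow_antimono[OF up2, of "Suc (t - i)" "Suc t - j"] eq by (meson not_less_eq_eq subsetD)
    then have "Suc i \<le> j" using ab(1) j(1) by linarith
    then show ?thesis using j(3) eq epow_antimono[OF up1] by blast
  qed
  have tb: "b + v \<in> epow V2 E2 (Suc (t - i))" if v: "v \<in> exps V2" "r \<le> wt V2 v" for v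
  proof -
    have "a + (b + v) \<in> epow V12 E12 (Suc t)" using r[of v] v exps_mono[of V2 V12] by (auto simp: wt add_ac)
    then obtain j a' b' where j: "j \<le> Suc t" "a + (b + v) = a' + b'" "a' \<in> epow V1 E1 j" "b' \<in> epow V2 E2 (Suc t - j)"
      unfolding epow_join by blast
    then have "a' \<in> exps V1" "b' \<in> exps V2"
      using upset_subset[OF upset_epow[OF up1]] upset_subset[OF upset_epow[OF up2]] by auto
    with exps_Un_unique[OF disj j(2)] have eq: "a' = a" "b' = b + v" using V v by auto
    have "j \<le> i" using na j(3) epow_antimono[OF up1, of "Suc i" j] eq by (meson not_less_eq_eq subsetD)
    then have "Suc (t - i) \<le> Suc t - j" using ab(1) j(1) by linarith
    then show ?thesis using j(4) eq epow_antimono[OF up2] by blast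
  qed
  have "(i, a, b) \<in> ?S" using ab na nb ta tb by (auto simp: tset_def torsion_exps_def)
  then show "u \<in> ?f ` ?S" using ab(2) by (intro image_eqI[of _ _ "(i, a, b)"]) simp_all
next
  fix u assume "u \<in> ?f ` ?S"
  then obtain i a b where ab: "i \<le> t" "u = a + b" "a \<in> tset V1 E1 i" "b \<in> tset V2 E2 (t - i)" by auto
  have V: "a \<in> exps V1" "b \<in> exps V2" using ab tset_exps by auto
  have "u \<in> epow V12 E12 t" unfolding epow_join using ab by (auto simp: tset_def torsion_exps_def)
  moreover have "u \<notin> epow V12 E12 (Suc t)"
  proof
    assume "u \<in> epow V12 E12 (Suc t)"
    then obtain j a' b' where j: "j \<le> Suc t" "a + b = a' + b'" "a' \<in> epow V1 E1 j" "b' \<in> epow V2 E2 (Suc t - j)"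
      unfolding epow_join ab(2) by blast
    then have "a' \<in> exps V1" "b' \<in> exps V2"
      using upset_subset[OF upset_epow[OF up1]] upset_subset[OF upset_epow[OF up2]] by auto
    with exps_Un_unique[OF disj j(2)] have eq: "a' = a" "b' = b" using V by auto
    \<comment> \<open>Two orders that add up to \<open>t + 1\<close> exceed \<open>i\<close> in the
      first factor or \<open>t - i\<close> in the second.\<close>
    have "Suc i \<le> j \<or> Suc (t - i) \<le> Suc t - j" using ab(1) j(1) by linarith
    then have "a \<in> epow V1 E1 (Suc i) \<or> b \<in> epow V2 E2 (Suc (t - i))"
      using j eq epow_antimono[OF up1, of "Suc i" j] epow_antimono[OF up2, of "Suc (t - i)" "Suc t - j"] by blast
    then show False using ab by (simp add: tset_def torsion_exps_def)
  qed
  moreover have "\<exists>r. \<forall>v\<in>exps V12. r \<le> wt V12 v \<longrightarrow> u + v \<in> epow V12 E12 (Suc t)"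
  proof -
    obtain r1 where r1: "\<And>v. v \<in> exps V1 \<Longrightarrow> r1 \<le> wt V1 v \<Longrightarrow> a + v \<in> epow V1 E1 (Suc i)"
      using ab by (auto simp: tset_def torsion_exps_def)
    obtain r2 where r2: "\<And>v. v \<in> exps V2 \<Longrightarrow> r2 \<le> wt V2 v \<Longrightarrow> b + v \<in> epow V2 E2 (Suc (t - i))"
      using ab by (auto simp: tset_def torsion_exps_def)
    have aE: "a \<in> epow V1 E1 i" "b \<in> epow V2 E2 (t - i)" using ab by (auto simp: tset_def torsion_exps_def)
    have "u + v \<in> epow V12 E12 (Suc t)" if v: "v \<in> exps V12" "r1 + r2 \<le> wt V12 v" for v
    proof -
      obtain x y where xy: "x \<in> exps V1" "y \<in> exps V2" "v = x + y" by (rule exps_Un_decomp[OF v(1)])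
      have "wt V12 v = wt V1 x + wt V2 y"
      proof -
        have "coef x i = 0" if "i \<in> V2" for i using xy disj that by (auto intro: exps_coef)
        moreover have "coef y i = 0" if "i \<in> V1" for i using xy disj that by (auto intro: exps_coef)
        ultimately show ?thesis using fin disj xy(3) by (simp add: wt_def sum.union_disjoint lookup_add)
      qed
      \<comment> \<open>Degree at least \<open>r1 + r2\<close> pushes one block beyond its own
        threshold, and a gain of one power in that block suffices.\<close>
      then consider "r1 \<le> wt V1 x" | "r2 \<le> wt V2 y" using v by linarith
      then show ?thesis
      proof cases
        case 1
        then show ?thesis using r1[OF xy(1) 1] upsetD[OF upset_epow[OF up2] aE(2) xy(2)] ab(1,2) xy(3)
          unfolding epow_join by (intro exI[of _ "Suc i"] exI[of _ "a + x"] exI[of _ "b + y"]) (simp add: add_ac)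
      next
        case 2
        then show ?thesis using r2[OF xy(2) 2] upsetD[OF upset_epow[OF up1] aE(1) xy(1)] ab(1,2) xy(3)
          unfolding epow_join by (intro exI[of _ i] exI[of _ "a + x"] exI[of _ "b + y"]) (simp add: add_ac Suc_diff_le)
      qed
    qed
    then show ?thesis by blast
  qed
  ultimately show "u \<in> tset V12 E12 t" unfolding tset_def torsion_exps_def by blast
qed

lemma card_tset_join:
  "card (tset V12 E12 t) = (\<Sum>i\<le>t. card (tset V1 E1 i) * card (tset V2 E2 (t - i)))"
proof -
  have "inj_on (\<lambda>(i, a, b). a + b) (SIGMA i:{..t}. tset V1 E1 i \<times> tset V2 E2 (t - i))"
  proof (rule inj_onI)
    fix x y
    assume x: "x \<in> (SIGMA i:{..t}. tset V1 E1 i \<times> tset V2 E2 (t - i))"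
      and y: "y \<in> (SIGMA i:{..t}. tset V1 E1 i \<times> tset V2 E2 (t - i))"
      and xy: "(case x of (i, a, b) \<Rightarrow> a + b) = (case y of (i, a, b) \<Rightarrow> a + b)"
    obtain i a b i' a' b' where eq: "x = (i, a, b)" "y = (i', a', b')" by (metis prod_cases3)
    have *: "a \<in> tset V1 E1 i" "b \<in> tset V2 E2 (t - i)" "a' \<in> tset V1 E1 i'" "b' \<in> tset V2 E2 (t - i')" "a + b = a' + b'"
      using x y xy by (auto simp: eq)
    then have "a = a'" "b = b'" using exps_Un_unique[OF disj *(5)] tset_exps by blast+
    \<comment> \<open>Disjoint variables recover \<open>a\<close> and \<open>b\<close> from their
      sum; disjointness of the torsion sets recovers the index.\<close>
    moreover from this * have "i = i'" using tset_disjoint[OF up1, of i i'] by blast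
    ultimately show "x = y" by (simp add: eq)
  qed
  then show ?thesis
    unfolding tset_join by (subst card_image) (simp_all add: card_cartesian_product finite_tset fin up1 up2)
qed

end

section \<open>Convolution of sequences with binomial growth\<close>

definition Bin :: "nat \<Rightarrow> nat \<Rightarrow> real" where
  "Bin m t = real ((t + m) choose m)"

lemma Bin_pos: "Bin m t > 0"
  by (simp add: Bin_def)

lemma Bin_zero: "Bin m 0 = 1" "Bin 0 t = 1"
  by (simp_all add: Bin_def)

lemma Bin_Suc: "Bin (Suc m) (Suc t) = Bin (Suc m) t + Bin m (Suc t)"
  by (simp add: Bin_def)

text \<open>\<open>Bin m\<close> lists the coefficients of the power series
  \<open>1 / (1 - x)^(m + 1)\<close>, so convolution adds the exponents \<open>p + 1\<close> and
  \<open>q + 1\<close>; this explains the index \<open>p + q + 1\<close>. The proof is Pascal's rule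
  with induction on \<open>q\<close> and on \<open>t\<close>.\<close>

lemma Bin_Vandermonde: "(\<Sum>i\<le>t. Bin p i * Bin q (t - i)) = Bin (p + q + 1) t"
proof (induction q arbitrary: t)
  case 0
  show ?case
  proof (induction t)
    case (Suc t)
    then show ?case using Bin_Suc[of p t] by (simp add: Bin_zero)
  qed (simp add: Bin_zero)
next
  case (Suc q)
  note IHq = Suc.IH
  show ?case
  proof (induction t)
    case (Suc t)
    have "(\<Sum>i\<le>Suc t. Bin p i * Bin (Suc q) (Suc t - i))
      = (\<Sum>i\<le>t. Bin p i * Bin (Suc q) (Suc (t - i))) + Bin p (Suc t)"
      by (simp add: Bin_zero Suc_diff_le)
    also have "\<dots> = (\<Sum>i\<le>t. Bin p i * Bin (Suc q) (t - i)) + ((\<Sum>i\<le>t. Bin p i * Bin q (Suc t - i)) + Bin p (Suc t))"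
      by (simp add: Bin_Suc distrib_left sum.distrib Suc_diff_le)
    also have "(\<Sum>i\<le>t. Bin p i * Bin q (Suc t - i)) + Bin p (Suc t) = (\<Sum>i\<le>Suc t. Bin p i * Bin q (Suc t - i))"
      by (simp add: Bin_zero)
    also have "\<dots> = Bin (p + q + 1) (Suc t)" by (rule IHq)
    finally show ?case using Bin_Suc[of "p + q + 1" t] Suc by simp
  qed (simp add: Bin_zero)
qed

lemma Bin_mono: "m \<le> m' \<Longrightarrow> Bin m t \<le> Bin m' t"
proof -
  assume "m \<le> m'"
  then have "(t + m) choose t \<le> (t + m') choose t" by (intro binomial_right_mono) auto
  then show ?thesis by (simp add: Bin_def binomial_symmetric[of m "t + m"] binomial_symmetric[of m' "t + m'"])
qed

text \<open>By absorption, \<open>Bin q t\<close> is \<open>(q + 1) / (t + q + 1)\<close> times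
  \<open>Bin (q + 1) t\<close>. A single weight in the Vandermonde sum is thus negligible against
  the total.\<close>

lemma Bin_ratio: "Bin q t / Bin (p + q + 1) t \<le> (real q + 1) / (real t + 1)"
proof -
  have "(q + 1) * ((t + (q + 1)) choose (q + 1)) = (t + q + 1) * ((t + q) choose q)"
    using Suc_times_binomial[of q "t + q"] by simp
  then have "real ((q + 1) * ((t + (q + 1)) choose (q + 1))) = real ((t + q + 1) * ((t + q) choose q))" by (rule arg_cong)
  then have "(real q + 1) * Bin (q + 1) t = (real t + real q + 1) * Bin q t"
    by (simp add: Bin_def algebra_simps)
  moreover have "(real t + 1) * Bin q t \<le> (real t + real q + 1) * Bin q t"
    using Bin_pos[of q t] by (intro mult_right_mono) auto
  moreover have "(real q + 1) * Bin (q + 1) t \<le> (real q + 1) * Bin (p + q + 1) t"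
    by (intro mult_left_mono Bin_mono) auto
  ultimately have "(real t + 1) * Bin q t \<le> (real q + 1) * Bin (p + q + 1) t" by linarith
  then show ?thesis using Bin_pos[of "p + q + 1" t] by (simp add: field_simps)
qed

text \<open>A Cesaro argument: the weights \<open>Bin p i * Bin q (t - i)\<close>, divided by
  \<open>Bin (p + q + 1) t\<close>, add up to 1, and the weight at each fixed \<open>i\<close> tends
  to zero. The second fact disposes of the head of the sequence, the first of its tail.\<close>

lemma weighted_average_null:
  assumes "e \<longlonglongrightarrow> 0"
  shows "(\<lambda>t. (\<Sum>i\<le>t. Bin p i * Bin q (t - i) * \<bar>e i\<bar>) / Bin (p + q + 1) t) \<longlonglongrightarrow> 0"
proof (rule LIMSEQ_I)
  fix \<epsilon> :: real assume eps: "0 < \<epsilon>"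
  obtain N where N: "\<And>i. i \<ge> N \<Longrightarrow> \<bar>e i\<bar> < \<epsilon> / 2"
    using LIMSEQ_D[OF assms, of "\<epsilon> / 2"] eps by auto
  \<comment> \<open>For \<open>i < N\<close> the factor \<open>Bin q (t - i)\<close> will be
    replaced by the larger \<open>Bin q t\<close>; \<open>K\<close> is what remains of the head and
    does not depend on \<open>t\<close>.\<close>
  define K where "K = (\<Sum>i<N. Bin p i * \<bar>e i\<bar>)"
  have K: "K \<ge> 0" unfolding K_def using less_imp_le[OF Bin_pos] by (intro sum_nonneg) auto
  have "(\<lambda>t. K * ((real q + 1) / (real t + 1))) \<longlonglongrightarrow> K * 0" by (intro tendsto_mult tendsto_const) real_asymp
  then obtain M where M: "\<And>t. t \<ge> M \<Longrightarrow> \<bar>K * ((real q + 1) / (real t + 1))\<bar> < \<epsilon> / 2"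
    using LIMSEQ_D[of _ _ "\<epsilon> / 2"] eps by fastforce
  have "norm ((\<Sum>i\<le>t. Bin p i * Bin q (t - i) * \<bar>e i\<bar>) / Bin (p + q + 1) t - 0) < \<epsilon>" if t: "t \<ge> max M N" for t
  proof -
    have Bq: "Bin q (t - i) \<le> Bin q t" for i
      unfolding Bin_def by (intro of_nat_mono binomial_right_mono) auto
    have "Bin p i * Bin q (t - i) * \<bar>e i\<bar> \<le> (if i < N then Bin p i * \<bar>e i\<bar> * Bin q t else 0) + \<epsilon> / 2 * (Bin p i * Bin q (t - i))" for i
    proof (cases "i < N")
      case True
      have "(Bin p i * \<bar>e i\<bar>) * Bin q (t - i) \<le> (Bin p i * \<bar>e i\<bar>) * Bin q t"
        using Bq less_imp_le[OF Bin_pos] by (intro mult_left_mono) auto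
      moreover have "\<epsilon> / 2 * (Bin p i * Bin q (t - i)) \<ge> 0" using eps less_imp_le[OF Bin_pos] by simp
      ultimately show ?thesis using True by (simp add: mult_ac)
    next
      case False
      then have "\<bar>e i\<bar> * (Bin p i * Bin q (t - i)) \<le> \<epsilon> / 2 * (Bin p i * Bin q (t - i))"
        using N[of i] less_imp_le[OF Bin_pos] by (intro mult_right_mono) auto
      then show ?thesis using False by (simp add: mult_ac)
    qed
    then have "(\<Sum>i\<le>t. Bin p i * Bin q (t - i) * \<bar>e i\<bar>) \<le> (\<Sum>i\<le>t. (if i < N then Bin p i * \<bar>e i\<bar> * Bin q t else 0) + \<epsilon> / 2 * (Bin p i * Bin q (t - i)))"
      by (intro sum_mono) blast
    also have "\<dots> = (\<Sum>i\<in>{..t} \<inter> {..<N}. Bin p i * \<bar>e i\<bar> * Bin q t) + \<epsilon> / 2 * Bin (p + q + 1) t"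
      unfolding sum.distrib sum_distrib_left[symmetric] Bin_Vandermonde by (simp add: sum.inter_restrict)
    also have "{..t} \<inter> {..<N} = {..<N}" using t by auto
    finally have "(\<Sum>i\<le>t. Bin p i * Bin q (t - i) * \<bar>e i\<bar>) \<le> K * Bin q t + \<epsilon> / 2 * Bin (p + q + 1) t"
      by (simp add: K_def sum_distrib_right)
    then have "(\<Sum>i\<le>t. Bin p i * Bin q (t - i) * \<bar>e i\<bar>) / Bin (p + q + 1) t \<le> (K * Bin q t + \<epsilon> / 2 * Bin (p + q + 1) t) / Bin (p + q + 1) t"
      using Bin_pos[of "p + q + 1" t] by (intro divide_right_mono) auto
    also have "\<dots> = K * (Bin q t / Bin (p + q + 1) t) + \<epsilon> / 2"
      using Bin_pos[of "p + q + 1" t] by (simp add: add_divide_distrib)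
    also have "\<dots> \<le> K * ((real q + 1) / (real t + 1)) + \<epsilon> / 2"
      using K Bin_ratio[of q t p] by (intro add_right_mono mult_left_mono) auto
    also have "\<dots> < \<epsilon>"
    proof -
      have "K * ((real q + 1) / (real t + 1)) < \<epsilon> / 2"
        by (rule le_less_trans[OF abs_ge_self M]) (use t in simp)
      then show ?thesis by linarith
    qed
    finally have "(\<Sum>i\<le>t. Bin p i * Bin q (t - i) * \<bar>e i\<bar>) / Bin (p + q + 1) t < \<epsilon>" .
    moreover have "(\<Sum>i\<le>t. Bin p i * Bin q (t - i) * \<bar>e i\<bar>) / Bin (p + q + 1) t \<ge> 0"
      using less_imp_le[OF Bin_pos] by (intro divide_nonneg_nonneg sum_nonneg mult_nonneg_nonneg) auto
    ultimately show ?thesis by simp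
  qed
  then show "\<exists>no. \<forall>t\<ge>no. norm ((\<Sum>i\<le>t. Bin p i * Bin q (t - i) * \<bar>e i\<bar>) / Bin (p + q + 1) t - 0) < \<epsilon>" by blast
qed

lemma Bin_asymp: "(\<lambda>t. real t ^ m / (fact m * Bin m t)) \<longlonglongrightarrow> 1"
proof -
  have "(\<lambda>t. real ((t + m) choose m) / real (t + m) ^ m) \<longlonglongrightarrow> 1 / fact m"
    by (rule LIMSEQ_ignore_initial_segment[OF choose_tendsto])
  from tendsto_mult[OF this shift_ratio_tendsto[of m m]]
  have "(\<lambda>t. real ((t + m) choose m) / real (t + m) ^ m * ((real m + real t) / real t) ^ m) \<longlonglongrightarrow> 1 / fact m" by simp
  then have "(\<lambda>t. Bin m t / real t ^ m) \<longlonglongrightarrow> 1 / fact m"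
    by (rule Lim_transform_eventually)
       (rule eventually_mono[OF eventually_gt_at_top[of 0]], simp add: Bin_def power_divide add.commute)
  from tendsto_inverse[OF tendsto_mult[OF tendsto_const[of "fact m"] this]]
  show ?thesis by (simp add: field_simps)
qed

lemma normalized_limit_iff:
  "(\<lambda>t. fact m * (a t / real t ^ m)) \<longlonglongrightarrow> c \<longleftrightarrow> (\<lambda>t. a t / Bin m t) \<longlonglongrightarrow> c"
proof
  assume "(\<lambda>t. fact m * (a t / real t ^ m)) \<longlonglongrightarrow> c"
  from tendsto_mult[OF this Bin_asymp[of m]]
  have "(\<lambda>t. fact m * (a t / real t ^ m) * (real t ^ m / (fact m * Bin m t))) \<longlonglongrightarrow> c" by simp
  then show "(\<lambda>t. a t / Bin m t) \<longlonglongrightarrow> c"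
    by (rule Lim_transform_eventually) (rule eventually_mono[OF eventually_gt_at_top[of 0]], simp)
next
  assume "(\<lambda>t. a t / Bin m t) \<longlonglongrightarrow> c"
  from tendsto_divide[OF this Bin_asymp[of m]]
  have "(\<lambda>t. a t / Bin m t / (real t ^ m / (fact m * Bin m t))) \<longlonglongrightarrow> c" by simp
  then show "(\<lambda>t. fact m * (a t / real t ^ m)) \<longlonglongrightarrow> c"
    by (rule Lim_transform_eventually)
       (rule eventually_mono[OF eventually_gt_at_top[of 0]], use Bin_pos[of m] in \<open>simp add: field_simps less_imp_neq[symmetric]\<close>)
qed

text \<open>After division by the binomial growth the quotient is a weighted average of
  \<open>a' i * b' (t - i)\<close>. The errors of the two factors are averaged separately; for the
  second the sum is read backwards, which interchanges \<open>p\<close> and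
  \<open>q\<close>.\<close>

lemma convolution_limit:
  fixes a b :: "nat \<Rightarrow> real"
  assumes "(\<lambda>t. a t / Bin p t) \<longlonglongrightarrow> \<alpha>" "(\<lambda>t. b t / Bin q t) \<longlonglongrightarrow> \<beta>"
  shows "(\<lambda>t. (\<Sum>i\<le>t. a i * b (t - i)) / Bin (p + q + 1) t) \<longlonglongrightarrow> \<alpha> * \<beta>"
proof -
  define a' where "a' t = a t / Bin p t" for t
  define b' where "b' t = b t / Bin q t" for t
  have a: "a t = Bin p t * a' t" and b: "b t = Bin q t * b' t" for t
    using Bin_pos[of p t] Bin_pos[of q t] by (simp_all add: a'_def b'_def)
  have "Bseq b'" using assms(2) unfolding b'_def[symmetric] by (intro convergent_imp_Bseq convergentI)
  then obtain M where M: "M > 0" "\<And>t. \<bar>b' t\<bar> \<le> M" by (auto simp: Bseq_def)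
  let ?w = "\<lambda>t i. Bin p i * Bin q (t - i)"
  let ?u = "\<lambda>t. (\<Sum>i\<le>t. ?w t i * \<bar>a' i - \<alpha>\<bar>) / Bin (p + q + 1) t"
  let ?v = "\<lambda>t. (\<Sum>i\<le>t. Bin q i * Bin p (t - i) * \<bar>b' i - \<beta>\<bar>) / Bin (q + p + 1) t"
  have uv: "?u \<longlonglongrightarrow> 0" "?v \<longlonglongrightarrow> 0"
    by (rule weighted_average_null, rule LIM_zero, use assms in \<open>simp add: a'_def b'_def\<close>)+
  have "(\<lambda>t. (\<Sum>i\<le>t. a i * b (t - i)) / Bin (p + q + 1) t - \<alpha> * \<beta>) \<longlonglongrightarrow> 0"
  proof (rule tendsto_zero_norm_bound[OF always_eventually, rule_format])
    have "(\<lambda>t. M * ?u t + \<bar>\<alpha>\<bar> * ?v t) \<longlonglongrightarrow> M * 0 + \<bar>\<alpha>\<bar> * 0"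
      by (intro tendsto_add tendsto_mult tendsto_const uv)
    then show "(\<lambda>t. M * ?u t + \<bar>\<alpha>\<bar> * ?v t) \<longlonglongrightarrow> 0" by simp
    fix t
    let ?B = "Bin (p + q + 1) t"
    have vt: "?v t = (\<Sum>i\<le>t. ?w t i * \<bar>b' (t - i) - \<beta>\<bar>) / ?B"
    proof -
      have "(\<Sum>i\<le>t. Bin q i * Bin p (t - i) * \<bar>b' i - \<beta>\<bar>) = (\<Sum>i\<le>t. ?w t i * \<bar>b' (t - i) - \<beta>\<bar>)"
        by (rule sum.reindex_bij_witness[of _ "\<lambda>s. t - s" "\<lambda>i. t - i"]) auto
      then show ?thesis by (simp add: add_ac)
    qed
    \<comment> \<open>The Vandermonde identity writes the constant \<alpha>\<beta> as a weighted sum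
      too, and each difference of products is split as (a' - \<alpha>) b' + \<alpha> (b' - \<beta>).
      Convergence bounds the factor b' by \<open>M\<close>.\<close>
    have "(\<Sum>i\<le>t. a i * b (t - i)) - \<alpha> * \<beta> * ?B = (\<Sum>i\<le>t. ?w t i * ((a' i - \<alpha>) * b' (t - i) + \<alpha> * (b' (t - i) - \<beta>)))"
      unfolding a b Bin_Vandermonde[symmetric] sum_distrib_left sum_subtractf[symmetric]
      by (intro sum.cong refl) (simp add: algebra_simps)
    then have "\<bar>(\<Sum>i\<le>t. a i * b (t - i)) - \<alpha> * \<beta> * ?B\<bar> \<le> (\<Sum>i\<le>t. \<bar>?w t i * ((a' i - \<alpha>) * b' (t - i) + \<alpha> * (b' (t - i) - \<beta>))\<bar>)"
      by (simp only: sum_abs)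
    also have "\<dots> \<le> (\<Sum>i\<le>t. ?w t i * (M * \<bar>a' i - \<alpha>\<bar> + \<bar>\<alpha>\<bar> * \<bar>b' (t - i) - \<beta>\<bar>))"
    proof (rule sum_mono)
      fix i
      have "\<bar>(a' i - \<alpha>) * b' (t - i) + \<alpha> * (b' (t - i) - \<beta>)\<bar> \<le> \<bar>a' i - \<alpha>\<bar> * \<bar>b' (t - i)\<bar> + \<bar>\<alpha>\<bar> * \<bar>b' (t - i) - \<beta>\<bar>"
        by (rule order_trans[OF abs_triangle_ineq]) (simp add: abs_mult)
      also have "\<dots> \<le> M * \<bar>a' i - \<alpha>\<bar> + \<bar>\<alpha>\<bar> * \<bar>b' (t - i) - \<beta>\<bar>"
        using mult_left_mono[OF M(2)[of "t - i"], of "\<bar>a' i - \<alpha>\<bar>"] by (simp add: mult.commute)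
      finally show "\<bar>?w t i * ((a' i - \<alpha>) * b' (t - i) + \<alpha> * (b' (t - i) - \<beta>))\<bar> \<le> ?w t i * (M * \<bar>a' i - \<alpha>\<bar> + \<bar>\<alpha>\<bar> * \<bar>b' (t - i) - \<beta>\<bar>)"
        using Bin_pos[of p i] Bin_pos[of q "t - i"] by (simp add: abs_mult)
    qed
    also have "\<dots> = M * (\<Sum>i\<le>t. ?w t i * \<bar>a' i - \<alpha>\<bar>) + \<bar>\<alpha>\<bar> * (\<Sum>i\<le>t. ?w t i * \<bar>b' (t - i) - \<beta>\<bar>)"
      by (simp add: sum_distrib_left distrib_left sum.distrib mult_ac)
    finally have "\<bar>(\<Sum>i\<le>t. a i * b (t - i)) - \<alpha> * \<beta> * ?B\<bar> / ?B \<le> M * ?u t + \<bar>\<alpha>\<bar> * ?v t"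
      unfolding vt using Bin_pos[of "p + q + 1" t] by (simp add: field_simps)
    moreover have "\<bar>(\<Sum>i\<le>t. a i * b (t - i)) - \<alpha> * \<beta> * ?B\<bar> / ?B = \<bar>(\<Sum>i\<le>t. a i * b (t - i)) / ?B - \<alpha> * \<beta>\<bar>"
    proof -
      have "(\<Sum>i\<le>t. a i * b (t - i)) / ?B - \<alpha> * \<beta> = ((\<Sum>i\<le>t. a i * b (t - i)) - \<alpha> * \<beta> * ?B) / ?B"
        using Bin_pos[of "p + q + 1" t] by (simp add: diff_divide_distrib)
      then show ?thesis using Bin_pos[of "p + q + 1" t] by (simp add: abs_divide)
    qed
    ultimately show "norm ((\<Sum>i\<le>t. a i * b (t - i)) / ?B - \<alpha> * \<beta>) \<le> M * ?u t + \<bar>\<alpha>\<bar> * ?v t" by simp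
  qed
  then show ?thesis by (rule LIM_zero_cancel)
qed

lemma jlimit_join:
  assumes "finite V1" "finite V2" "V1 \<inter> V2 = {}" "V1 \<noteq> {}" "V2 \<noteq> {}" "upset V1 E1" "upset V2 E2"
    and "jlimit V1 E1 c1" "jlimit V2 E2 c2"
  shows "jlimit (V1 \<union> V2) (expo_join (V1 \<union> V2) E1 E2) (c1 * c2)"
proof -
  have "card V1 > 0" "card V2 > 0" using assms by (auto simp: card_gt_0_iff)
  \<comment> \<open>Non-emptiness keeps the natural subtraction exact; the extra 1 is the shift in
    the Vandermonde index.\<close>
  then have "card (V1 \<union> V2) - 1 = (card V1 - 1) + (card V2 - 1) + 1"
    using assms by (simp add: card_Un_disjoint)
  moreover have "real (card (tset (V1 \<union> V2) (expo_join (V1 \<union> V2) E1 E2) t))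
      = (\<Sum>i\<le>t. real (card (tset V1 E1 i)) * real (card (tset V2 E2 (t - i))))" for t
    by (simp add: card_tset_join assms)
  ultimately show ?thesis
    using convolution_limit assms(8,9) unfolding jlimit_def normalized_limit_iff by simp
qed

section \<open>Monomial ideals of the localized polynomial ring\<close>

text \<open>Both the polynomial ring and its localization are subrings of a type with ring
  structure. Viewed through \<open>tring\<close>, ideals and primes reduce to closure properties of
  plain sets.\<close>

definition tring :: "'a::comm_ring_1 set \<Rightarrow> 'a ring" where
  "tring C = ring_of_type_algebra\<lparr>carrier := C\<rparr>"

definition sring :: "'a::comm_ring_1 set \<Rightarrow> bool" where
  "sring C \<longleftrightarrow> 0 \<in> C \<and> 1 \<in> C \<and> (\<forall>x\<in>C. - x \<in> C) \<and> (\<forall>x\<in>C. \<forall>y\<in>C. x + y \<in> C \<and> x * y \<in> C)"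

lemma tring_simps [simp]:
  "carrier (tring C) = C" "x \<otimes>\<^bsub>tring C\<^esub> y = x * y" "\<one>\<^bsub>tring C\<^esub> = 1" "\<zero>\<^bsub>tring C\<^esub> = 0" "x \<oplus>\<^bsub>tring C\<^esub> y = x + y"
  by (simp_all add: tring_def ring_of_type_algebra_def)

lemma tring_cring:
  assumes "sring C"
  shows "cring (tring C)"
proof (rule cringI)
  show "abelian_group (tring C)"
  proof (rule abelian_groupI)
    show "\<exists>y\<in>carrier (tring C). y \<oplus>\<^bsub>tring C\<^esub> x = \<zero>\<^bsub>tring C\<^esub>" if "x \<in> carrier (tring C)" for x
      using that assms by (intro bexI[of _ "- x"]) (auto simp: sring_def)
  qed (use assms in \<open>auto simp: sring_def algebra_simps\<close>)
  show "comm_monoid (tring C)"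
    by (rule comm_monoidI) (use assms in \<open>auto simp: sring_def algebra_simps\<close>)
qed (simp add: algebra_simps)

text \<open>Closure under negatives follows from the last clause with the scalar
  \<open>- 1\<close>.\<close>

lemma tring_ideal_iff:
  assumes "sring C"
  shows "ideal J (tring C) \<longleftrightarrow>
    J \<subseteq> C \<and> 0 \<in> J \<and> (\<forall>x\<in>J. \<forall>y\<in>J. x + y \<in> J) \<and> (\<forall>a\<in>C. \<forall>x\<in>J. a * x \<in> J)"
proof
  assume "ideal J (tring C)"
  then interpret ideal J "tring C" .
  show "J \<subseteq> C \<and> 0 \<in> J \<and> (\<forall>x\<in>J. \<forall>y\<in>J. x + y \<in> J) \<and> (\<forall>a\<in>C. \<forall>x\<in>J. a * x \<in> J)"
    using a_subset additive_subgroup.zero_closed[OF is_additive_subgroup] additive_subgroup.a_closed[OF is_additive_subgroup] I_l_closed by simp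
next
  assume *: "J \<subseteq> C \<and> 0 \<in> J \<and> (\<forall>x\<in>J. \<forall>y\<in>J. x + y \<in> J) \<and> (\<forall>a\<in>C. \<forall>x\<in>J. a * x \<in> J)"
  interpret cring "tring C" by (rule tring_cring[OF assms])
  have inv: "inv\<^bsub>add_monoid (tring C)\<^esub> x = - x" if "x \<in> C" for x
    using minus_equality[of "- x" x] that assms by (simp add: a_inv_def sring_def)
  show "ideal J (tring C)"
  proof (rule idealI)
    show "ring (tring C)" by (rule ring_axioms)
    show "subgroup J (add_monoid (tring C))"
    proof
      fix x assume x: "x \<in> J"
      have "- 1 \<in> C" using assms by (auto simp: sring_def)
      then have "- 1 * x \<in> J" using * x by blast
      then show "inv\<^bsub>add_monoid (tring C)\<^esub> x \<in> J" using inv[of x] x * by auto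
    qed (use * in auto)
  next
    fix a x assume "a \<in> J" "x \<in> carrier (tring C)"
    then have "x * a \<in> J" using * by simp
    then show "x \<otimes>\<^bsub>tring C\<^esub> a \<in> J" "a \<otimes>\<^bsub>tring C\<^esub> x \<in> J" by (simp_all add: mult.commute)
  qed
qed

type_synonym 'k loc = "'k mpoly fract"

definition polys :: "nat set \<Rightarrow> 'k::field mpoly set" where
  "polys V = {p. supp p \<subseteq> exps V}"

text \<open>The denominators of the localization: a polynomial avoids the ideal generated by the
  variables exactly when its constant term is non-zero. Accordingly
  \<open>loc_ideal V (exps V)\<close> below is the local ring itself.\<close>

definition upolys :: "nat set \<Rightarrow> 'k::field mpoly set" where
  "upolys V = {p. supp p \<subseteq> exps V \<and> coef p 0 \<noteq> 0}"

definition loc_ideal :: "nat set \<Rightarrow> expo set \<Rightarrow> 'k::field loc set" where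
  "loc_ideal V E = {Fract f g | f g. supp f \<subseteq> E \<and> g \<in> upolys V}"

definition Xm :: "expo \<Rightarrow> 'k::field loc" where
  "Xm u = Fract (Poly_Mapping.single u 1) 1"

section \<open>Supports of polynomials and of their products\<close>

lemma expo_nonneg: "(0::expo) \<le> b"
proof -
  have "\<not> b < 0" by (auto simp: less_poly_mapping.rep_eq less_fun_def)
  then show ?thesis by simp
qed

lemma poly_sum_single: "(p :: _ \<Rightarrow>\<^sub>0 'b::comm_monoid_add) = (\<Sum>m\<in>supp p. Poly_Mapping.single m (coef p m))"
  by (rule poly_mapping_eqI) (simp add: lookup_sum lookup_single when_def in_keys_iff)

lemma supp_induct [consumes 1, case_names zero add single]:
  fixes p :: "'a \<Rightarrow>\<^sub>0 'b::comm_monoid_add"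
  assumes "supp p \<subseteq> E" "P 0" "\<And>p q. P p \<Longrightarrow> P q \<Longrightarrow> P (p + q)" "\<And>m c. m \<in> E \<Longrightarrow> P (Poly_Mapping.single m c)"
  shows "P p"
proof -
  have "P (\<Sum>m\<in>A. Poly_Mapping.single m (coef p m))" if "A \<subseteq> supp p" for A
    using finite_subset[OF that finite_keys] that
    by (induction A rule: finite_induct) (use assms in auto)
  from this[of "supp p"] show ?thesis using poly_sum_single[of p] by simp
qed

lemma coef_mult_unique:
  fixes f h :: "'k::field mpoly"
  assumes "\<And>a b. a \<in> supp f \<Longrightarrow> b \<in> supp h \<Longrightarrow> a + b = u + v \<Longrightarrow> a = u \<and> b = v"
  shows "coef (f * h) (u + v) = coef f u * coef h v"
proof -
  define f' where "f' = restr (- {u}) f"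
  define h' where "h' = restr (- {v}) h"
  have f: "f = Poly_Mapping.single u (coef f u) + f'"
    by (rule poly_mapping_eqI) (auto simp: f'_def lookup_add lookup_single when_def)
  have h: "h = Poly_Mapping.single v (coef h v) + h'"
    by (rule poly_mapping_eqI) (auto simp: h'_def lookup_add lookup_single when_def)
  have "f * h = Poly_Mapping.single u (coef f u) * (Poly_Mapping.single v (coef h v) + h') + f' * h"
    by (metis f h distrib_right)
  then have fh: "f * h = Poly_Mapping.single (u + v) (coef f u * coef h v) + Poly_Mapping.single u (coef f u) * h' + f' * h"
    by (simp add: distrib_left mult_single)
  have "u + v \<notin> supp (Poly_Mapping.single u (coef f u) * h')"
  proof
    assume "u + v \<in> supp (Poly_Mapping.single u (coef f u) * h')"
    then obtain b where "b \<in> supp h'" "u + v = u + b" "coef f u \<noteq> 0"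
      using keys_mult[of "Poly_Mapping.single u (coef f u)" h'] by (auto split: if_splits)
    then show False by (auto simp: h'_def)
  qed
  moreover have "u + v \<notin> supp (f' * h)"
  proof
    assume "u + v \<in> supp (f' * h)"
    then obtain a b where "a \<in> supp f'" "b \<in> supp h" "u + v = a + b"
      using keys_mult[of f' h] by auto
    then show False using assms[of a b] by (auto simp: f'_def)
  qed
  ultimately show ?thesis unfolding fh by (simp add: lookup_add in_keys_iff)
qed

lemma coef_mult_0: "coef (f * h) 0 = coef f 0 * coef (h :: 'k::field mpoly) 0"
proof -
  have "a = 0 \<and> b = 0" if "a + b = 0 + 0" for a b :: expo
  proof -
    have "supp (a + b) = {}" using that by simp
    then show ?thesis unfolding supp_add_nat by simp
  qed
  from coef_mult_unique[of f h 0 0, OF this] show ?thesis by simp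
qed

lemma supp_mult_upset:
  assumes "upset V E" "supp f \<subseteq> E" "supp h \<subseteq> exps V"
  shows "supp (f * (h :: 'k::field mpoly)) \<subseteq> E"
proof
  fix u assume "u \<in> supp (f * h)"
  then obtain a b where "u = a + b" "a \<in> supp f" "b \<in> supp h" using keys_mult[of f h] by blast
  then show "u \<in> E" using upsetD[OF assms(1), of a b] assms(2,3) by blast
qed

lemma supp_add_subset: "supp f \<subseteq> E \<Longrightarrow> supp g \<subseteq> E \<Longrightarrow> supp (f + g) \<subseteq> E"
  using keys_add[of f g] by blast

lemma supp_uminus [simp]: "supp (- p) = supp (p :: 'k::field mpoly)"
  by (auto simp: in_keys_iff)

text \<open>Take the least exponent \<open>u\<close> of \<open>f\<close> outside \<open>E\<close>.
  Deleting the terms of \<open>f\<close> in \<open>E\<close> changes the product only inside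
  \<open>E\<close>; afterwards \<open>u\<close> is the least exponent of the first factor, so its
  coefficient in the product is that of \<open>f\<close> times the constant term of
  \<open>h\<close>, which is non-zero.\<close>

lemma supp_unit_mult_cancel:
  fixes f h :: "'k::field mpoly"
  assumes "upset V E" "supp f \<subseteq> exps V" "h \<in> upolys V" "supp (f * h) \<subseteq> E"
  shows "supp f \<subseteq> E"
proof (rule ccontr)
  assume "\<not> supp f \<subseteq> E"
  define u where "u = Min (supp f - E)"
  have u: "u \<in> supp f - E" unfolding u_def using \<open>\<not> supp f \<subseteq> E\<close> by (intro Min_in) auto
  have min: "u \<le> a" if "a \<in> supp f - E" for a unfolding u_def using that by (intro Min_le) auto
  define g where "g = restr (- E) f"
  have "g * h = f * h + - restr E f * h"
  proof -
    have "g = f + - restr E f" using restr_split[of f E] by (simp add: g_def algebra_simps)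
    then show ?thesis by (metis distrib_right)
  qed
  moreover have "supp (- restr E f * h) \<subseteq> E"
    using assms(3) by (intro supp_mult_upset[OF assms(1)]) (auto simp: upolys_def)
  ultimately have gh: "supp (g * h) \<subseteq> E" using assms(4) supp_add_subset by metis
  have "coef (g * h) (u + 0) = coef g u * coef h 0"
  proof (rule coef_mult_unique)
    fix a b assume "a \<in> supp g" "b \<in> supp h" and ab: "a + b = u + 0"
    then have "u \<le> a" by (intro min) (auto simp: g_def)
    moreover have "a \<le> a + b" using add_left_mono[OF expo_nonneg[of b], of a] by simp
    ultimately have "a = u" using ab by simp
    then show "a = u \<and> b = 0" using ab by simp
  qed
  also have "\<dots> \<noteq> 0" using u assms(3) by (simp add: g_def upolys_def in_keys_iff)
  finally show False using gh u by (auto simp: in_keys_iff)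
qed

lemma upolys_mult: "g \<in> upolys V \<Longrightarrow> h \<in> upolys V \<Longrightarrow> g * h \<in> upolys V"
  unfolding upolys_def using supp_mult_upset[of V "exps V" g h] by (simp add: coef_mult_0)

lemma upolys_one: "1 \<in> upolys V"
  by (simp add: upolys_def)

lemma upolys_nonzero: "g \<in> upolys V \<Longrightarrow> g \<noteq> 0"
  by (auto simp: upolys_def)

lemma upolys_supp: "g \<in> upolys V \<Longrightarrow> supp g \<subseteq> exps V"
  by (simp add: upolys_def)

lemma loc_idealI: "supp f \<subseteq> E \<Longrightarrow> g \<in> upolys V \<Longrightarrow> Fract f g \<in> loc_ideal V E"
  by (auto simp: loc_ideal_def)

lemma loc_idealE:
  assumes "x \<in> loc_ideal V E"
  obtains f g where "x = Fract f g" "supp f \<subseteq> E" "g \<in> upolys V"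
  using assms by (auto simp: loc_ideal_def)

text \<open>Membership can be read off any numerator: in a cross-multiplied equation of two
  fractions, multiplication by a denominator neither leaves \<open>E\<close> nor hides a term
  outside \<open>E\<close>.\<close>

lemma loc_ideal_iff:
  assumes "upset V E" "supp f \<subseteq> exps V" "g \<in> upolys V"
  shows "Fract f g \<in> loc_ideal V E \<longleftrightarrow> supp f \<subseteq> E"
proof
  assume "Fract f g \<in> loc_ideal V E"
  then obtain f' g' where *: "Fract f g = Fract f' g'" "supp f' \<subseteq> E" "g' \<in> upolys V" by (rule loc_idealE)
  then have "f * g' = f' * g" using assms upolys_nonzero by (metis eq_fract(1))
  then have "supp (f * g') \<subseteq> E" using supp_mult_upset[OF assms(1) *(2) upolys_supp[OF assms(3)]] by simp
  then show "supp f \<subseteq> E" by (rule supp_unit_mult_cancel[OF assms(1,2) *(3)])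
qed (use assms in \<open>auto intro: loc_idealI\<close>)

lemma loc_ideal_mono: "E \<subseteq> E' \<Longrightarrow> V \<subseteq> V' \<Longrightarrow> loc_ideal V E \<subseteq> loc_ideal V' E'"
  using exps_mono[of V V'] by (fastforce simp: loc_ideal_def upolys_def)

lemma loc_ideal_zero: "0 \<in> loc_ideal V E"
  unfolding Zero_fract_def by (intro loc_idealI upolys_one) simp

lemma loc_ideal_add:
  assumes "upset V E" "x \<in> loc_ideal V E" "y \<in> loc_ideal V E"
  shows "x + y \<in> loc_ideal V E"
proof -
  obtain f g where x: "x = Fract f g" "supp f \<subseteq> E" "g \<in> upolys V" using assms(2) by (rule loc_idealE)
  obtain f' g' where y: "y = Fract f' g'" "supp f' \<subseteq> E" "g' \<in> upolys V" using assms(3) by (rule loc_idealE)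
  have "x + y = Fract (f * g' + f' * g) (g * g')" using x y upolys_nonzero[OF x(3)] upolys_nonzero[OF y(3)] by simp
  moreover have "supp (f * g' + f' * g) \<subseteq> E"
    using x y by (intro supp_add_subset supp_mult_upset[OF assms(1)] upolys_supp)
  ultimately show ?thesis using x y by (simp add: loc_idealI upolys_mult)
qed

lemma loc_ideal_mult_msum:
  assumes "x \<in> loc_ideal V E" "y \<in> loc_ideal V F"
  shows "x * y \<in> loc_ideal V (msum E F)"
proof -
  obtain f g where x: "x = Fract f g" "supp f \<subseteq> E" "g \<in> upolys V" using assms(1) by (rule loc_idealE)
  obtain f' g' where y: "y = Fract f' g'" "supp f' \<subseteq> F" "g' \<in> upolys V" using assms(2) by (rule loc_idealE)
  have "supp (f * f') \<subseteq> msum E F" using keys_mult[of f f'] x y by (auto simp: msum_def) blast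
  then show ?thesis using x y by (auto intro!: loc_idealI upolys_mult)
qed

lemma msum_exps: "upset V E \<Longrightarrow> msum (exps V) E = E" "upset V E \<Longrightarrow> msum E (exps V) = E"
proof -
  assume E: "upset V E"
  show "msum E (exps V) = E" using upsetD[OF E] subset_gen[of E V] by (auto elim: msumE)
  moreover have "msum (exps V) E = msum E (exps V)" by (auto simp: msum_def) (metis add.commute)+
  ultimately show "msum (exps V) E = E" by simp
qed

lemma loc_ideal_mult:
  assumes "upset V E" "x \<in> loc_ideal V (exps V)" "y \<in> loc_ideal V E"
  shows "x * y \<in> loc_ideal V E"
  using loc_ideal_mult_msum[OF assms(2,3)] msum_exps[OF assms(1)] by simp

lemma sring_loc: "sring (loc_ideal V (exps V) :: 'k::field loc set)"
  unfolding sring_def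
proof (intro conjI ballI)
  show "1 \<in> (loc_ideal V (exps V) :: 'k loc set)" unfolding One_fract_def by (intro loc_idealI upolys_one) simp
  show "- x \<in> loc_ideal V (exps V)" if "x \<in> loc_ideal V (exps V)" for x :: "'k loc"
    using that by (elim loc_idealE) (simp add: loc_idealI)
qed (auto intro: loc_ideal_zero loc_ideal_add loc_ideal_mult)

lemma sring_polys: "sring (polys V :: 'k::field mpoly set)"
  unfolding sring_def polys_def by (simp add: supp_add_subset supp_mult_upset[OF upset_exps])

lemma mpoly_ring_eq: "mpoly_ring V = tring (polys V)"
  unfolding mpoly_ring_def tring_def polys_def exps_def by (simp add: subset_iff Ball_def)

lemma irrelevant_ideal_eq: "irrelevant_ideal V = {p \<in> polys V. coef p 0 = (0::'k::field)}" (is "_ = ?I")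
proof (rule subset_antisym)
  interpret R: cring "tring (polys V :: 'k mpoly set)" by (rule tring_cring[OF sring_polys])
  have pv: "pvar ` V \<subseteq> (polys V :: 'k mpoly set)" by (auto simp: pvar_def polys_def exps_def)
  have c: "coef (pvar i :: 'k mpoly) 0 = 0" for i
  proof -
    have "Poly_Mapping.single i (1::nat) \<noteq> 0" by (metis single_zero zero_neq_one lookup_single_eq lookup_zero)
    then show ?thesis by (simp add: pvar_def lookup_single when_def)
  qed
  have I: "ideal ?I (tring (polys V))"
    unfolding tring_ideal_iff[OF sring_polys] using sring_polys[of V, where 'k='k]
    by (auto simp: sring_def lookup_add coef_mult_0)
  show "irrelevant_ideal V \<subseteq> ?I"
    unfolding irrelevant_ideal_def mpoly_ring_eq using R.genideal_minimal[OF I] pv c by auto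
  define J where "J = Idl\<^bsub>tring (polys V)\<^esub> (pvar ` V :: 'k mpoly set)"
  have "ideal J (tring (polys V))" unfolding J_def using pv by (intro R.genideal_ideal) simp
  then have J: "0 \<in> J" "\<And>x y. x \<in> J \<Longrightarrow> y \<in> J \<Longrightarrow> x + y \<in> J" "\<And>a x. a \<in> polys V \<Longrightarrow> x \<in> J \<Longrightarrow> a * x \<in> J"
    unfolding tring_ideal_iff[OF sring_polys] by auto
  have pvJ: "pvar i \<in> J" if "i \<in> V" for i
    using R.genideal_self[of "pvar ` V"] pv that by (auto simp: J_def)
  show "?I \<subseteq> irrelevant_ideal V"
    unfolding irrelevant_ideal_def mpoly_ring_eq J_def[symmetric]
  proof
    fix p assume "p \<in> ?I"
    then have "supp p \<subseteq> exps V - {0}" by (auto simp: polys_def in_keys_iff)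
    then show "p \<in> J"
    proof (induction rule: supp_induct)
      case (single m c)
      then obtain i where i: "i \<in> supp m" by (metis DiffE all_not_in_conv keys_eq_empty singletonI)
      then have iV: "i \<in> V" using single by (auto simp: exps_def)
      have m: "m = (m - Poly_Mapping.single i 1) + Poly_Mapping.single i 1"
        using i by (intro poly_mapping_eqI) (auto simp: lookup_add lookup_minus lookup_single when_def in_keys_iff)
      have "m - Poly_Mapping.single i 1 \<in> exps V" using m single by (metis DiffD1 exps_add)
      then have "Poly_Mapping.single (m - Poly_Mapping.single i 1) c \<in> polys V" by (auto simp: polys_def)
      then have "Poly_Mapping.single (m - Poly_Mapping.single i 1) c * pvar i \<in> J" using J(3) pvJ[OF iV] by blast
      then show ?case using m by (simp add: pvar_def mult_single)
    qed (use J in auto)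
  qed
qed

lemma loc_ring_eq: "loc_ring V = tring (loc_ideal V (exps V))"
proof -
  have "{Fract f g |f g. f \<in> carrier (mpoly_ring V) \<and> g \<in> carrier (mpoly_ring V) - irrelevant_ideal V} = (loc_ideal V (exps V) :: 'a loc set)"
    unfolding irrelevant_ideal_eq mpoly_ring_eq by (auto simp: loc_ideal_def polys_def upolys_def)
  then show ?thesis by (simp add: loc_ring_def tring_def)
qed

lemma cring_loc: "cring (loc_ring V)"
  unfolding loc_ring_eq by (rule tring_cring[OF sring_loc])

lemma carrier_loc: "carrier (loc_ring V) = loc_ideal V (exps V)"
  by (simp add: loc_ring_eq)

lemma loc_ideal_iff_ideal:
  "ideal J (loc_ring V) \<longleftrightarrow> J \<subseteq> loc_ideal V (exps V) \<and> 0 \<in> J \<and> (\<forall>x\<in>J. \<forall>y\<in>J. x + y \<in> J) \<and>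
    (\<forall>a\<in>loc_ideal V (exps V). \<forall>x\<in>J. a * x \<in> J)"
  unfolding loc_ring_eq by (rule tring_ideal_iff[OF sring_loc])

lemma ideal_loc_ideal: "upset V E \<Longrightarrow> ideal (loc_ideal V E) (loc_ring V)"
  unfolding loc_ideal_iff_ideal
  using loc_ideal_mono[of E "exps V" V V] upset_subset[of V E] loc_ideal_add[of V E] loc_ideal_mult[of V E] loc_ideal_zero[of V E]
  by blast

lemma Xm_mem: "u \<in> E \<Longrightarrow> Xm u \<in> loc_ideal V E"
  unfolding Xm_def by (intro loc_idealI upolys_one) simp

lemma Xm_add: "Xm (u + v) = Xm u * Xm v"
  by (simp add: Xm_def mult_single)

lemma loc_ideal_least:
  fixes J :: "'k::field loc set"
  assumes J: "ideal J (loc_ring V)" and E: "\<And>u. u \<in> E \<Longrightarrow> Xm u \<in> J"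
  shows "loc_ideal V E \<subseteq> J"
proof
  fix x :: "'k loc" assume "x \<in> loc_ideal V E"
  then obtain f g where x: "x = Fract f g" "supp f \<subseteq> E" "g \<in> upolys V" by (rule loc_idealE)
  have J': "0 \<in> J" "\<And>x y. x \<in> J \<Longrightarrow> y \<in> J \<Longrightarrow> x + y \<in> J" "\<And>a x. a \<in> loc_ideal V (exps V) \<Longrightarrow> x \<in> J \<Longrightarrow> a * x \<in> J"
    using J unfolding loc_ideal_iff_ideal by auto
  have "Fract f 1 \<in> J"
    using x(2)
  proof (induction rule: supp_induct)
    case (add p q)
    then have "Fract p 1 + Fract q 1 \<in> J" using J' by blast
    then show ?case by simp
  next
    case (single m c)
    have "Fract (Poly_Mapping.single 0 c) 1 \<in> loc_ideal V (exps V)"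
      by (intro loc_idealI upolys_one) simp
    then have "Fract (Poly_Mapping.single 0 c) 1 * Xm m \<in> J" using J' E single by blast
    then show ?case by (simp add: Xm_def mult_single)
  qed (use J' in \<open>simp add: Zero_fract_def[symmetric]\<close>)
  moreover have "Fract 1 g \<in> loc_ideal V (exps V)" using x by (intro loc_idealI) auto
  ultimately have "Fract 1 g * Fract f 1 \<in> J" using J' by blast
  then show "x \<in> J" using x by simp
qed

lemma monomials_eq: "monomials V = Xm ` exps V"
  by (auto simp: monomials_def Xm_def exps_def)

lemma Idl_monomials:
  assumes "M \<subseteq> exps V"
  shows "Idl\<^bsub>loc_ring V\<^esub> (Xm ` M) = (loc_ideal V (msum M (exps V)) :: 'k::field loc set)"
proof (rule subset_antisym)
  interpret R: cring "loc_ring V :: 'k loc ring" by (rule cring_loc)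
  show "Idl\<^bsub>loc_ring V\<^esub> (Xm ` M) \<subseteq> (loc_ideal V (msum M (exps V)) :: 'k loc set)"
    using subset_gen[of M V] by (intro R.genideal_minimal ideal_loc_ideal upset_gen assms) (auto intro: Xm_mem)
  have c: "(Xm ` M :: 'k loc set) \<subseteq> carrier (loc_ring V)" using assms by (auto simp: carrier_loc intro: Xm_mem)
  have I: "ideal (Idl\<^bsub>loc_ring V\<^esub> (Xm ` M)) (loc_ring V :: 'k loc ring)" by (rule R.genideal_ideal[OF c])
  show "(loc_ideal V (msum M (exps V)) :: 'k loc set) \<subseteq> Idl\<^bsub>loc_ring V\<^esub> (Xm ` M)"
  proof (rule loc_ideal_least[OF I])
    fix u assume "u \<in> msum M (exps V)"
    then obtain m v where u: "u = v + m" "m \<in> M" "v \<in> exps V" by (auto elim: msumE simp: add.commute)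
    then have "Xm m \<in> (Idl\<^bsub>loc_ring V\<^esub> (Xm ` M) :: 'k loc set)" using R.genideal_self[OF c] by blast
    then show "Xm u \<in> (Idl\<^bsub>loc_ring V\<^esub> (Xm ` M) :: 'k loc set)"
      using I u unfolding Xm_add u(1) loc_ideal_iff_ideal by (blast intro: Xm_mem)
  qed
qed

lemma Idl_extension:
  assumes "V \<subseteq> W" "E \<subseteq> exps V"
  shows "Idl\<^bsub>loc_ring W\<^esub> (loc_ideal V E) = (loc_ideal W (msum E (exps W)) :: 'k::field loc set)"
proof (rule subset_antisym)
  interpret R: cring "loc_ring W :: 'k loc ring" by (rule cring_loc)
  have EW: "E \<subseteq> exps W" using assms exps_mono by blast
  show "Idl\<^bsub>loc_ring W\<^esub> (loc_ideal V E) \<subseteq> (loc_ideal W (msum E (exps W)) :: 'k loc set)"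
    by (intro R.genideal_minimal ideal_loc_ideal upset_gen EW loc_ideal_mono assms subset_gen)
  have "Idl\<^bsub>loc_ring W\<^esub> (Xm ` E) \<subseteq> (Idl\<^bsub>loc_ring W\<^esub> (loc_ideal V E) :: 'k loc set)"
    by (rule R.subset_Idl_subset) (use loc_ideal_mono[OF EW assms(1)] in \<open>auto simp: carrier_loc intro: Xm_mem\<close>)
  then show "(loc_ideal W (msum E (exps W)) :: 'k loc set) \<subseteq> Idl\<^bsub>loc_ring W\<^esub> (loc_ideal V E)"
    by (simp add: Idl_monomials[OF EW])
qed

lemma loc_ideal_prod:
  assumes "upset V E" "upset V F"
  shows "ideal_prod (loc_ring V) (loc_ideal V E) (loc_ideal V F) = (loc_ideal V (msum E F) :: 'k::field loc set)"
proof (rule subset_antisym)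
  interpret R: cring "loc_ring V :: 'k loc ring" by (rule cring_loc)
  have EF: "upset V (msum E F)" using upset_msum[OF upset_subset[OF assms(1)] assms(2)] .
  show "ideal_prod (loc_ring V) (loc_ideal V E) (loc_ideal V F) \<subseteq> (loc_ideal V (msum E F) :: 'k loc set)"
  proof
    fix x :: "'k loc" assume "x \<in> ideal_prod (loc_ring V) (loc_ideal V E) (loc_ideal V F)"
    then show "x \<in> loc_ideal V (msum E F)"
      by induction (auto simp: loc_ring_eq intro: loc_ideal_mult_msum loc_ideal_add[OF EF])
  qed
  show "(loc_ideal V (msum E F) :: 'k loc set) \<subseteq> ideal_prod (loc_ring V) (loc_ideal V E) (loc_ideal V F)"
  proof (rule loc_ideal_least)
    show "ideal (ideal_prod (loc_ring V) (loc_ideal V E) (loc_ideal V F)) (loc_ring V :: 'k loc ring)"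
      by (intro R.ideal_prod_is_ideal ideal_loc_ideal assms)
    fix u assume "u \<in> msum E F"
    then obtain a b where "u = a + b" "a \<in> E" "b \<in> F" by (rule msumE)
    then show "Xm u \<in> ideal_prod (loc_ring V) (loc_ideal V E) (loc_ideal V F :: 'k loc set)"
      using ideal_prod.prod[OF Xm_mem Xm_mem, of a E b F "loc_ring V" V V] by (simp add: Xm_add loc_ring_eq)
  qed
qed

lemma ideal_power_loc:
  assumes "upset V E"
  shows "ideal_power (loc_ring V) (loc_ideal V E) t = (loc_ideal V (epow V E t) :: 'k::field loc set)"
proof (induction t)
  case 0
  then show ?case by (simp add: ideal_power_def ideals_set_def nat_pow_def carrier_loc)
next
  case (Suc t)
  have "ideal_power (loc_ring V) (loc_ideal V E) (Suc t)
    = ideal_prod (loc_ring V) (ideal_power (loc_ring V) (loc_ideal V E) t) (loc_ideal V E :: 'k loc set)"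
    by (simp add: ideal_power_def ideals_set_def nat_pow_def)
  then show ?case using loc_ideal_prod[OF upset_epow[OF assms] assms] Suc by simp
qed

lemma upset_UN:
  assumes "\<And>k. k \<in> A \<Longrightarrow> upset V (E k)"
  shows "upset V (\<Union>k\<in>A. E k)"
  unfolding upset_def
proof (intro conjI ballI)
  show "(\<Union>k\<in>A. E k) \<subseteq> exps V" by (intro UN_least upset_subset assms)
  fix u v assume "u \<in> (\<Union>k\<in>A. E k)" "v \<in> exps V"
  then show "u + v \<in> (\<Union>k\<in>A. E k)" using upsetD[OF assms] by auto
qed

lemma ideal_sum_loc:
  fixes E :: "nat \<Rightarrow> expo set"
  assumes fin: "finite A" and E: "\<And>k. k \<in> A \<Longrightarrow> upset V (E k)"
  shows "ideal_sum (loc_ring V) A (\<lambda>k. loc_ideal V (E k)) = (loc_ideal V (\<Union>k\<in>A. E k) :: 'k::field loc set)"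
proof (rule subset_antisym)
  interpret R: cring "loc_ring V :: 'k loc ring" by (rule cring_loc)
  have U: "upset V (\<Union>k\<in>A. E k)" by (rule upset_UN[OF E])
  have Ek: "loc_ideal V (E k) \<subseteq> (loc_ideal V (exps V) :: 'k loc set)" if "k \<in> A" for k
    using upset_subset[OF E[OF that]] by (intro loc_ideal_mono) auto
  have fs: "finsum (loc_ring V) a B = (\<Sum>k\<in>B. a k)" if "B \<subseteq> A" "a \<in> (\<Pi> k\<in>A. loc_ideal V (E k))" for a :: "nat \<Rightarrow> 'k loc" and B :: "nat set"
    using finite_subset[OF that(1) fin] that
  proof (induction B rule: finite_induct)
    case (insert k B)
    have "a j \<in> carrier (loc_ring V)" if "j \<in> A" for j
      unfolding carrier_loc by (rule subsetD[OF Ek[OF that] Pi_mem[OF insert.prems(2) that]])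
    then have c: "a \<in> B \<rightarrow> carrier (loc_ring V)" "a k \<in> carrier (loc_ring V)"
      using insert.prems(1) by auto
    show ?case using insert R.finsum_insert[OF insert.hyps c] by (simp add: loc_ring_eq)
  qed (simp only: R.finsum_empty sum.empty, simp add: loc_ring_eq)
  show "ideal_sum (loc_ring V) A (\<lambda>k. loc_ideal V (E k)) \<subseteq> (loc_ideal V (\<Union>k\<in>A. E k) :: 'k loc set)"
  proof
    fix x :: "'k loc" assume "x \<in> ideal_sum (loc_ring V) A (\<lambda>k. loc_ideal V (E k))"
    then obtain a where a: "a \<in> (\<Pi> k\<in>A. loc_ideal V (E k))" "x = finsum (loc_ring V) a A" by (auto simp: ideal_sum_def)
    have ak: "a k \<in> loc_ideal V (\<Union>k\<in>A. E k)" if "k \<in> A" for k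
      using loc_ideal_mono[of "E k" "\<Union>k\<in>A. E k" V V] a that by blast
    have "(\<Sum>k\<in>B. a k) \<in> loc_ideal V (\<Union>k\<in>A. E k)" if "B \<subseteq> A" for B
      using finite_subset[OF that fin] that
      by (induction B rule: finite_induct) (auto intro: loc_ideal_zero loc_ideal_add[OF U] ak)
    then show "x \<in> loc_ideal V (\<Union>k\<in>A. E k)" using a fs[OF order_refl a(1)] by auto
  qed
  show "(loc_ideal V (\<Union>k\<in>A. E k) :: 'k loc set) \<subseteq> ideal_sum (loc_ring V) A (\<lambda>k. loc_ideal V (E k))"
  proof
    fix x :: "'k loc" assume "x \<in> loc_ideal V (\<Union>k\<in>A. E k)"
    then obtain f g where x: "x = Fract f g" "supp f \<subseteq> (\<Union>k\<in>A. E k)" "g \<in> upolys V" by (rule loc_idealE)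
    \<comment> \<open>\<open>\<kappa>\<close> assigns every term of the numerator to one summand
      containing it; grouping by \<open>\<kappa>\<close> splits the fraction over its common
      denominator.\<close>
    then obtain \<kappa> where \<kappa>: "\<And>u. u \<in> supp f \<Longrightarrow> \<kappa> u \<in> A \<and> u \<in> E (\<kappa> u)" by (metis UN_E subsetD)
    define a where "a k = Fract (restr {u. \<kappa> u = k} f) g" for k
    have a: "a \<in> (\<Pi> k\<in>A. loc_ideal V (E k))" using \<kappa> x(3) by (auto simp: a_def intro!: loc_idealI)
    have gn: "g \<noteq> 0" using x(3) by (rule upolys_nonzero)
    have "(\<Sum>k\<in>B. a k) = Fract (\<Sum>k\<in>B. restr {u. \<kappa> u = k} f) g" if "finite B" for B
      using that
    proof (induction B rule: finite_induct)
      case (insert k B)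
      have "Fract p g + Fract q g = Fract (p + q) g" for p q
        using gn mult_fract_cancel[of g "p + q" g] by (simp add: algebra_simps)
      then show ?case using insert by (simp add: a_def)
    qed (simp add: fract_collapse)
    moreover have "(\<Sum>k\<in>A. restr {u. \<kappa> u = k} f) = f"
    proof (rule poly_mapping_eqI)
      fix u
      show "coef (\<Sum>k\<in>A. restr {u. \<kappa> u = k} f) u = coef f u"
        using \<kappa>[of u] fin by (cases "u \<in> supp f") (auto simp: lookup_sum in_keys_iff)
    qed
    ultimately have "x = finsum (loc_ring V) a A" using fs[OF order_refl a] fin x by simp
    then show "x \<in> ideal_sum (loc_ring V) A (\<lambda>k. loc_ideal V (E k))" using a by (auto simp: ideal_sum_def)
  qed
qed

section \<open>The maximal ideal and its powers\<close>

lemma upset_max: "upset V (exps V - {0})"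
proof -
  have "u + v \<noteq> 0" if "u \<noteq> 0" for u v :: expo
  proof
    assume "u + v = 0"
    then have "supp (u + v) = {}" by simp
    then show False using that unfolding supp_add_nat by simp
  qed
  then show ?thesis by (auto simp: upset_def)
qed

text \<open>An ideal not inside the candidate contains a fraction whose numerator has non-zero
  constant term, hence a unit. This gives maximality and also the uniqueness that the definite
  description requires.\<close>

lemma max_ideal_loc: "max_ideal (loc_ring V) = (loc_ideal V (exps V - {0}) :: 'k::field loc set)" (is "_ = ?m")
proof -
  interpret R: cring "loc_ring V :: 'k loc ring" by (rule cring_loc)
  have m: "ideal ?m (loc_ring V)" by (rule ideal_loc_ideal[OF upset_max])
  have unit: "J = carrier (loc_ring V)" if J: "ideal J (loc_ring V)" "\<not> J \<subseteq> ?m" for J :: "'k loc set"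
  proof -
    have J': "J \<subseteq> loc_ideal V (exps V)" "\<And>a x. a \<in> loc_ideal V (exps V) \<Longrightarrow> x \<in> J \<Longrightarrow> a * x \<in> J"
      using J(1) unfolding loc_ideal_iff_ideal by auto
    obtain x where "x \<in> J" "x \<notin> ?m" using J by auto
    moreover then obtain f g where x: "x = Fract f g" "supp f \<subseteq> exps V" "g \<in> upolys V"
      using J'(1) by (blast elim: loc_idealE)
    ultimately have "coef f 0 \<noteq> 0" using loc_idealI[of f "exps V - {0}" g V] by (auto simp: in_keys_iff)
    then have f: "f \<in> upolys V" using x by (simp add: upolys_def)
    have "y \<in> J" if "y \<in> loc_ideal V (exps V)" for y
    proof -
      have "Fract g f \<in> loc_ideal V (exps V)" using f x by (intro loc_idealI) (auto simp: upolys_def)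
      then have "y * Fract g f \<in> loc_ideal V (exps V)" using that sring_loc[of V] unfolding sring_def by blast
      then have "y * Fract g f * x \<in> J" using J'(2) \<open>x \<in> J\<close> by blast
      moreover have "Fract g f * x = 1"
        using x upolys_nonzero[OF f] upolys_nonzero[OF x(3)] by (simp add: One_fract_def eq_fract mult.commute)
      ultimately show ?thesis by (simp add: mult.assoc)
    qed
    then show ?thesis using J'(1) by (auto simp: carrier_loc)
  qed
  have ne: "carrier (loc_ring V) \<noteq> ?m"
  proof
    assume "carrier (loc_ring V) = ?m"
    then have "(1 :: 'k loc) \<in> ?m" using sring_loc[of V, where 'k='k] by (simp add: carrier_loc sring_def)
    moreover have "(1 :: 'k mpoly) \<in> upolys V" by (rule upolys_one)
    ultimately show False unfolding One_fract_def using loc_ideal_iff[OF upset_max, of "1 :: 'k mpoly" V 1] by simp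
  qed
  have "maximalideal ?m (loc_ring V)"
    using unit by (intro maximalidealI[OF m ne]) blast
  moreover have "J = ?m" if "maximalideal J (loc_ring V)" for J :: "'k loc set"
  proof -
    interpret J: maximalideal J "loc_ring V" by fact
    have "J \<subseteq> ?m" using unit[OF J.is_ideal] J.I_notcarr by blast
    then show ?thesis using J.I_maximal[OF m] ne ideal.Icarr[OF m] by blast
  qed
  ultimately show ?thesis unfolding max_ideal_def by (rule the_equality)
qed

text \<open>Makes torsion with respect to powers of the maximal ideal a condition on total
  degree.\<close>

lemma epow_max:
  assumes "finite V"
  shows "epow V (exps V - {0}) r = {v \<in> exps V. r \<le> wt V v}"
proof (induction r)
  case (Suc r)
  show ?case
  proof (intro subset_antisym subsetI)
    fix v assume "v \<in> epow V (exps V - {0}) (Suc r)"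
    then obtain a b where "v = a + b" "a \<in> exps V" "r \<le> wt V a" "b \<in> exps V" "b \<noteq> 0"
      using Suc by (auto simp: msum_def)
    then show "v \<in> {v \<in> exps V. Suc r \<le> wt V v}" using wt_eq_0[OF assms, of b] by (auto simp: wt_add)
  next
    fix v assume v: "v \<in> {v \<in> exps V. Suc r \<le> wt V v}"
    then have "v \<noteq> 0" by auto
    then obtain i where i: "i \<in> supp v" by (metis all_not_in_conv keys_eq_empty)
    let ?s = "Poly_Mapping.single i (1::nat)"
    have iV: "i \<in> V" using i v by (auto simp: exps_def)
    have m: "v = (v - ?s) + ?s"
      using i by (intro poly_mapping_eqI) (auto simp: lookup_add lookup_minus lookup_single when_def in_keys_iff)
    have "?s \<in> exps V - {0}" using iV by (auto simp: exps_def) (metis lookup_single_eq lookup_zero zero_neq_one One_nat_def)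
    moreover have "wt V ?s = 1" using iV assms by (simp add: wt_def lookup_single when_def)
    moreover have "v - ?s \<in> exps V" using m v by (metis (mono_tags, lifting) exps_add mem_Collect_eq)
    moreover have "wt V v = wt V (v - ?s) + wt V ?s" using m wt_add by metis
    ultimately show "v \<in> epow V (exps V - {0}) (Suc r)"
      using Suc v m msumI[of "v - ?s" "epow V (exps V - {0}) r" ?s "exps V - {0}"] by simp
  qed
qed simp

section \<open>Length of the torsion module\<close>

definition cst :: "'a::plus set \<Rightarrow> 'a \<Rightarrow> 'a set" where
  "cst B x = (\<lambda>b. b + x) ` B"

definition asubg :: "'a::ab_group_add set \<Rightarrow> bool" where
  "asubg B \<longleftrightarrow> 0 \<in> B \<and> (\<forall>x\<in>B. \<forall>y\<in>B. x + y \<in> B) \<and> (\<forall>x\<in>B. - x \<in> B)"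

lemma cst_eq_iff:
  assumes "asubg B"
  shows "cst B x = cst B y \<longleftrightarrow> x - y \<in> B"
proof
  assume "cst B x = cst B y"
  moreover have "x \<in> cst B x" using assms unfolding cst_def asubg_def by (intro image_eqI[of _ _ 0]) auto
  ultimately show "x - y \<in> B" by (auto simp: cst_def)
next
  assume *: "x - y \<in> B"
  have "cst B x \<subseteq> cst B y" if "x - y \<in> B" for x y
  proof
    fix z assume "z \<in> cst B x"
    then obtain b where "b \<in> B" "z = b + x" by (auto simp: cst_def)
    then show "z \<in> cst B y" using that assms unfolding cst_def asubg_def
      by (intro image_eqI[of _ _ "b + (x - y)"]) (auto simp: algebra_simps)
  qed
  moreover have "y - x \<in> B" using * assms unfolding asubg_def by (metis minus_diff_eq)
  ultimately show "cst B x = cst B y" using * by blast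
qed

lemma cst_zero: "cst B (0::'a::ab_group_add) = B"
  by (simp add: cst_def)

lemma cst_add:
  assumes "asubg B"
  shows "{a + b | a b. a \<in> cst B x \<and> b \<in> cst B y} = cst B (x + y)"
proof (intro subset_antisym subsetI)
  fix z assume "z \<in> {a + b | a b. a \<in> cst B x \<and> b \<in> cst B y}"
  then obtain b c where "b \<in> B" "c \<in> B" "z = (b + x) + (c + y)" by (auto simp: cst_def)
  then show "z \<in> cst B (x + y)" using assms unfolding cst_def asubg_def
    by (intro image_eqI[of _ _ "b + c"]) (auto simp: algebra_simps)
next
  fix z assume "z \<in> cst B (x + y)"
  then obtain b where b: "b \<in> B" "z = b + (x + y)" by (auto simp: cst_def)
  have "b + x \<in> cst B x" using b by (auto simp: cst_def)
  moreover have "0 + y \<in> cst B y" using assms unfolding cst_def asubg_def by blast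
  moreover have "z = (b + x) + (0 + y)" using b by (simp add: algebra_simps)
  ultimately show "z \<in> {a + b | a b. a \<in> cst B x \<and> b \<in> cst B y}" by blast
qed

definition mono_quot :: "nat set \<Rightarrow> expo set \<Rightarrow> expo set \<Rightarrow> ('k::field loc, 'k loc set) module" where
  "mono_quot V E F = quot_module ((self_module (loc_ring V))\<lparr>carrier := loc_ideal V E\<rparr>) (loc_ideal V F)"

lemma asubg_loc_ideal: "upset V F \<Longrightarrow> asubg (loc_ideal V F :: 'k::field loc set)"
proof -
  assume F: "upset V F"
  have "- 1 \<in> (loc_ideal V (exps V) :: 'k loc set)" using sring_loc[of V, where 'k='k] unfolding sring_def by blast
  then have "- x \<in> loc_ideal V F" if "x \<in> loc_ideal V F" for x :: "'k loc"
    using loc_ideal_mult[OF F, of "- 1" x] that by simp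
  then show ?thesis using loc_ideal_add[OF F] loc_ideal_zero unfolding asubg_def by blast
qed

lemma mono_quot_coset:
  "a_r_coset ((self_module (loc_ring V))\<lparr>carrier := C\<rparr>) (loc_ideal V F) x = cst (loc_ideal V F) x"
  by (auto simp: a_r_coset_def r_coset_def self_module_def cst_def loc_ring_eq)

lemma mono_quot_carrier: "carrier (mono_quot V E F) = cst (loc_ideal V F) ` loc_ideal V E"
  unfolding mono_quot_def quot_module_def A_RCOSETS_def RCOSETS_def a_r_coset_def[symmetric]
  using mono_quot_coset[where V = V and F = F] by (auto simp: image_def)

lemma mono_quot_zero: "\<zero>\<^bsub>mono_quot V E F\<^esub> = loc_ideal V F"
  by (simp add: mono_quot_def quot_module_def)

lemma mono_quot_add:
  assumes "upset V F"
  shows "cst (loc_ideal V F) x \<oplus>\<^bsub>mono_quot V E F\<^esub> cst (loc_ideal V F) y = cst (loc_ideal V F) (x + y)"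
proof -
  have "cst (loc_ideal V F) x \<oplus>\<^bsub>mono_quot V E F\<^esub> cst (loc_ideal V F) y
    = {a + b | a b. a \<in> cst (loc_ideal V F) x \<and> b \<in> cst (loc_ideal V F) y}"
    by (auto simp: mono_quot_def quot_module_def set_add_def set_mult_def self_module_def loc_ring_eq)
  then show ?thesis by (simp add: cst_add[OF asubg_loc_ideal[OF assms]])
qed

text \<open>The quotient module forms a union over all representatives of the class; its members
  coincide because \<open>F\<close> gives an ideal.\<close>

lemma mono_quot_smult:
  fixes a :: "'k::field loc"
  assumes "upset V F" "a \<in> carrier (loc_ring V)"
  shows "a \<odot>\<^bsub>mono_quot V E F\<^esub> cst (loc_ideal V F) x = cst (loc_ideal V F) (a * x)"
proof -
  let ?B = "loc_ideal V F :: 'k loc set"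
  have e1: "a \<odot>\<^bsub>mono_quot V E F\<^esub> cst ?B x = (\<Union>y\<in>cst ?B x. cst ?B (a * y))"
    unfolding mono_quot_def quot_module_def module.simps mono_quot_coset
    by (simp add: self_module_def loc_ring_eq)
  have "cst ?B (a * y) = cst ?B (a * x)" if y: "y \<in> cst ?B x" for y
  proof -
    obtain b where "b \<in> ?B" "y = b + x" using y by (auto simp: cst_def)
    then show ?thesis using loc_ideal_mult[OF assms(1), of a b] assms(2)
      by (simp add: cst_eq_iff[OF asubg_loc_ideal[OF assms(1)]] algebra_simps carrier_loc)
  qed
  then have e2: "(\<Union>y\<in>cst ?B x. cst ?B (a * y)) = (\<Union>y\<in>cst ?B x. cst ?B (a * x))"
    by (intro SUP_cong refl)
  have "0 + x \<in> cst ?B x" unfolding cst_def by (intro imageI loc_ideal_zero)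
  then show ?thesis unfolding e1 e2 by blast
qed

text \<open>Unlike \<open>torsion_exps\<close> this keeps the exponents of \<open>E\<close> that lie
  in \<open>F\<close>. It is therefore upward closed, the exponent set of the ideal that lies over
  the torsion part.\<close>

definition tclosure :: "nat set \<Rightarrow> expo set \<Rightarrow> expo set \<Rightarrow> expo set" where
  "tclosure V E F = {u \<in> E. \<exists>r. \<forall>v\<in>exps V. r \<le> wt V v \<longrightarrow> u + v \<in> F}"

lemma tclosure_upset:
  assumes "upset V E" "upset V F"
  shows "upset V (tclosure V E F)"
  unfolding upset_def
proof (intro conjI ballI)
  show "tclosure V E F \<subseteq> exps V" using upset_subset[OF assms(1)] by (auto simp: tclosure_def)
  fix u v assume u: "u \<in> tclosure V E F" and v: "v \<in> exps V"
  then obtain r where r: "\<And>w. w \<in> exps V \<Longrightarrow> r \<le> wt V w \<Longrightarrow> u + w \<in> F" by (auto simp: tclosure_def)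
  have "(u + v) + w \<in> F" if "w \<in> exps V" "r \<le> wt V w" for w
    using upsetD[OF assms(2) r[OF that] v] by (simp add: add_ac)
  then show "u + v \<in> tclosure V E F" using u v upsetD[OF assms(1)] by (auto simp: tclosure_def)
qed

lemma tclosure_eq: "upset V F \<Longrightarrow> F \<subseteq> E \<Longrightarrow> tclosure V E F = torsion_exps V E F \<union> F"
  by (auto simp: tclosure_def torsion_exps_def dest: upsetD)

lemma tclosure_uniform:
  assumes "finite A" "A \<subseteq> tclosure V E F"
  shows "\<exists>r. \<forall>u\<in>A. \<forall>v\<in>exps V. r \<le> wt V v \<longrightarrow> u + v \<in> F"
proof -
  have "\<forall>u\<in>A. \<exists>r. \<forall>v\<in>exps V. r \<le> wt V v \<longrightarrow> u + v \<in> F" using assms(2) by (auto simp: tclosure_def)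
  then obtain \<rho> where \<rho>: "\<forall>u\<in>A. \<forall>v\<in>exps V. \<rho> u \<le> wt V v \<longrightarrow> u + v \<in> F" by metis
  have "u + v \<in> F" if "u \<in> A" "v \<in> exps V" "(\<Sum>u\<in>A. \<rho> u) \<le> wt V v" for u v
    using \<rho> that member_le_sum[of u A \<rho>] assms(1) by auto
  then show ?thesis by blast
qed

text \<open>Multiplying by a monomial moves the terms of a numerator without merging them, so a
  monomial that kills a class kills each term separately. Conversely, a numerator has finitely many
  terms, and one threshold works for all of them.\<close>

lemma torsion_part_mono_quot:
  assumes "finite V" "upset V E" "upset V F"
  shows "torsion_part (loc_ring V) (max_ideal (loc_ring V)) (mono_quot V E F)
    = cst (loc_ideal V F) ` (loc_ideal V (tclosure V E F) :: 'k::field loc set)"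
proof -
  let ?B = "loc_ideal V F :: 'k loc set"
  have pw: "ideal_power (loc_ring V) (max_ideal (loc_ring V)) r = (loc_ideal V {v \<in> exps V. r \<le> wt V v} :: 'k loc set)" for r
    unfolding max_ideal_loc by (simp add: ideal_power_loc[OF upset_max] epow_max[OF assms(1)])
  have B0: "cst ?B y = ?B \<longleftrightarrow> y \<in> ?B" for y
    using cst_eq_iff[OF asubg_loc_ideal[OF assms(3)], of y 0] by (simp add: cst_zero)
  have smult0: "a \<odot>\<^bsub>mono_quot V E F\<^esub> cst ?B x = \<zero>\<^bsub>mono_quot V E F\<^esub> \<longleftrightarrow> a * x \<in> ?B"
    if "a \<in> loc_ideal V {v \<in> exps V. r \<le> wt V v}" for a x r
  proof -
    have "a \<in> carrier (loc_ring V)"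
      using that loc_ideal_mono[of "{v \<in> exps V. r \<le> wt V v}" "exps V" V V] by (auto simp: carrier_loc)
    then show ?thesis by (simp add: mono_quot_smult[OF assms(3)] mono_quot_zero B0)
  qed
  show ?thesis
  proof (intro subset_antisym subsetI)
    fix Z assume Z: "Z \<in> torsion_part (loc_ring V) (max_ideal (loc_ring V)) (mono_quot V E F :: ('k loc, 'k loc set) module)"
    then obtain x r where x: "Z = cst ?B x" "x \<in> loc_ideal V E"
      and "\<forall>a\<in>loc_ideal V {v \<in> exps V. r \<le> wt V v}. a \<odot>\<^bsub>mono_quot V E F\<^esub> Z = \<zero>\<^bsub>mono_quot V E F\<^esub>"
      unfolding torsion_part_def pw mono_quot_carrier by blast
    then have r: "\<And>a. a \<in> loc_ideal V {v \<in> exps V. r \<le> wt V v} \<Longrightarrow> a * x \<in> ?B" using smult0 by blast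
    obtain f g where fg: "x = Fract f g" "supp f \<subseteq> E" "g \<in> upolys V" using x(2) by (rule loc_idealE)
    have "supp f \<subseteq> tclosure V E F"
    proof
      fix u assume u: "u \<in> supp f"
      have "u + v \<in> F" if v: "v \<in> exps V" "r \<le> wt V v" for v
      proof -
        have "Xm v * x \<in> ?B" using v by (intro r Xm_mem) simp
        then have "Fract (Poly_Mapping.single v 1 * f) g \<in> ?B" by (simp add: Xm_def fg)
        moreover have "supp (Poly_Mapping.single v 1 * f) \<subseteq> exps V"
          using supp_mult_upset[of V "exps V" "Poly_Mapping.single v 1" f] upset_subset[OF assms(2)] v fg by auto
        ultimately have "supp (Poly_Mapping.single v 1 * f) \<subseteq> F"
          using loc_ideal_iff[OF assms(3) _ fg(3)] by blast
        moreover have "coef (Poly_Mapping.single v 1 * f) (v + u) = coef (Poly_Mapping.single v (1::'k)) v * coef f u"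
          by (rule coef_mult_unique) auto
        ultimately show ?thesis using u by (auto simp: in_keys_iff add.commute)
      qed
      then show "u \<in> tclosure V E F" using u fg by (auto simp: tclosure_def)
    qed
    then show "Z \<in> cst ?B ` loc_ideal V (tclosure V E F)" using x fg by (auto intro!: loc_idealI)
  next
    fix Z assume "Z \<in> cst ?B ` loc_ideal V (tclosure V E F)"
    then obtain x where x: "Z = cst ?B x" "x \<in> loc_ideal V (tclosure V E F)" by auto
    obtain f g where fg: "x = Fract f g" "supp f \<subseteq> tclosure V E F" "g \<in> upolys V" using x(2) by (rule loc_idealE)
    obtain r where "\<forall>u\<in>supp f. \<forall>v\<in>exps V. r \<le> wt V v \<longrightarrow> u + v \<in> F"
      using tclosure_uniform[OF finite_keys fg(2)] by (elim exE)
    note r = this[rule_format]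
    have "a * x \<in> ?B" if "a \<in> loc_ideal V {v \<in> exps V. r \<le> wt V v}" for a
    proof -
      have "x \<in> loc_ideal V (supp f)" using fg by (auto intro: loc_idealI)
      from loc_ideal_mult_msum[OF that this]
      have "a * x \<in> loc_ideal V (msum {v \<in> exps V. r \<le> wt V v} (supp f))" .
      moreover have "msum {v \<in> exps V. r \<le> wt V v} (supp f) \<subseteq> F"
      proof
        fix w assume "w \<in> msum {v \<in> exps V. r \<le> wt V v} (supp f)"
        then obtain v u where "w = v + u" "v \<in> exps V" "r \<le> wt V v" "u \<in> supp f" by (auto simp: msum_def)
        then show "w \<in> F" using r[of u v] by (simp add: add.commute)
      qed
      ultimately show ?thesis using loc_ideal_mono[of _ F V V] by blast
    qed
    moreover have "x \<in> loc_ideal V E" using x(2) loc_ideal_mono[of "tclosure V E F" E V V] by (auto simp: tclosure_def)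
    ultimately show "Z \<in> torsion_part (loc_ring V) (max_ideal (loc_ring V)) (mono_quot V E F)"
      unfolding torsion_part_def pw mono_quot_carrier using x smult0 by blast
  qed
qed

text \<open>Truncated geometric series: with \<open>c\<close> the inverse of the constant term,
  \<open>u = 1 - c g\<close> has no constant term, \<open>h = c (1 + u + ... + u^(r-1))\<close>, and
  \<open>1 - g h = u^r\<close> has only terms of degree at least \<open>r\<close>.\<close>

lemma unit_inverse_mod_power:
  fixes g :: "'k::field mpoly"
  assumes "finite V" "g \<in> upolys V"
  obtains h where "supp h \<subseteq> exps V" "supp (1 - g * h) \<subseteq> {v \<in> exps V. r \<le> wt V v}"
proof -
  define c where "c = (Poly_Mapping.single 0 (1 / coef g 0) :: 'k mpoly)"
  define u where "u = 1 + - (c * g)"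
  have cg: "supp (c * g) \<subseteq> exps V"
    using assms(2) by (intro supp_mult_upset[OF upset_exps]) (auto simp: c_def upolys_def)
  have "supp u \<subseteq> exps V" unfolding u_def using cg by (intro supp_add_subset) auto
  moreover have "coef u 0 = 0" using assms(2) by (simp add: u_def lookup_add coef_mult_0 c_def upolys_def del: add_uminus_conv_diff)
  ultimately have u: "supp u \<subseteq> exps V - {0}" by (auto simp: in_keys_iff)
  have ur: "supp (u ^ r) \<subseteq> epow V (exps V - {0}) r" for r
  proof (induction r)
    case (Suc r)
    have "supp (u ^ r * u) \<subseteq> msum (supp (u ^ r)) (supp u)" using keys_mult[of "u ^ r" u] by (auto simp: msum_def)
    also have "\<dots> \<subseteq> msum (epow V (exps V - {0}) r) (exps V - {0})" by (rule msum_mono[OF Suc u])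
    finally show ?case by (simp add: mult.commute)
  qed simp
  have "\<exists>h. supp h \<subseteq> exps V \<and> 1 - g * h = u ^ r" for r
  proof (induction r)
    case 0
    show ?case by (intro exI[of _ 0]) simp
  next
    case (Suc r)
    then obtain h where h: "supp h \<subseteq> exps V" "1 - g * h = u ^ r" by blast
    have "supp (c * u ^ r) \<subseteq> exps V"
      using ur[of r] upset_subset[OF upset_epow[OF upset_max], of V r] by (intro supp_mult_upset[OF upset_exps]) (auto simp: c_def)
    then have "supp (h + c * u ^ r) \<subseteq> exps V" using h by (intro supp_add_subset)
    moreover have "1 - g * (h + c * u ^ r) = u ^ Suc r"
      by (simp add: u_def[symmetric] distrib_left h(2)[symmetric] diff_diff_eq[symmetric])
         (simp add: h(2) u_def algebra_simps)
    ultimately show ?case by blast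
  qed
  then obtain h where h: "supp h \<subseteq> exps V" "1 - g * h = u ^ r" by blast
  then show ?thesis using ur[of r] that[of h] by (simp add: epow_max[OF assms(1)])
qed

text \<open>Replacing division by \<open>g\<close> with multiplication by its approximate inverse
  \<open>h\<close> changes \<open>x\<close> by \<open>f (1 - g h) / g\<close>, whose numerator lies
  over \<open>F\<close> once \<open>r\<close> is a torsion threshold for all terms of
  \<open>f\<close>. The terms of \<open>f h\<close> in \<open>F\<close> are then dropped.\<close>

lemma torsion_representative:
  fixes x :: "'k::field loc"
  assumes "finite V" "upset V E" "upset V F" "F \<subseteq> E" "x \<in> loc_ideal V (tclosure V E F)"
  obtains p where "supp p \<subseteq> torsion_exps V E F" "x - Fract p 1 \<in> loc_ideal V F"
proof -
  let ?T = "torsion_exps V E F" and ?G = "tclosure V E F"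
  have G: "upset V ?G" by (rule tclosure_upset[OF assms(2,3)])
  have GT: "?G = ?T \<union> F" by (rule tclosure_eq[OF assms(3,4)])
  obtain f g where fg: "x = Fract f g" "supp f \<subseteq> ?G" "g \<in> upolys V" using assms(5) by (rule loc_idealE)
  obtain r where "\<forall>u\<in>supp f. \<forall>v\<in>exps V. r \<le> wt V v \<longrightarrow> u + v \<in> F"
    using tclosure_uniform[OF finite_keys fg(2)] by (elim exE)
  note r = this[rule_format]
  obtain h where h: "supp h \<subseteq> exps V" "supp (1 - g * h) \<subseteq> {v \<in> exps V. r \<le> wt V v}"
    using unit_inverse_mod_power[OF assms(1) fg(3)] .
  define p where "p = restr ?T (f * h)"
  define q where "q = restr (- ?T) (f * h)"
  have fh: "f * h = p + q" unfolding p_def q_def by (rule restr_split)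
  have "supp (f * h) \<subseteq> ?G" by (rule supp_mult_upset[OF G fg(2) h(1)])
  then have q: "supp q \<subseteq> F" unfolding q_def GT by auto
  have "supp (f * (1 - g * h)) \<subseteq> F"
  proof
    fix u assume "u \<in> supp (f * (1 - g * h))"
    then obtain a b where "u = a + b" "a \<in> supp f" "b \<in> supp (1 - g * h)" using keys_mult[of f "1 - g * h"] by blast
    then show "u \<in> F" using r[of a b] h(2) by blast
  qed
  moreover have "supp (q * g) \<subseteq> F" by (rule supp_mult_upset[OF assms(3) q upolys_supp[OF fg(3)]])
  ultimately have s: "supp (f * (1 - g * h) + q * g) \<subseteq> F" by (rule supp_add_subset)
  have "x - Fract p 1 = Fract (f - p * g) g" using upolys_nonzero[OF fg(3)] by (simp add: fg(1))
  also have "f - p * g = f * (1 - g * h) + q * g"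
  proof -
    have "f * (1 - g * h) + q * g = f - (f * h) * g + q * g" by (simp add: algebra_simps)
    then show ?thesis by (simp add: fh distrib_right)
  qed
  finally have "x - Fract p 1 \<in> loc_ideal V F" using loc_idealI[OF s fg(3)] by simp
  then show ?thesis by (intro that[of p]) (auto simp: p_def)
qed

section \<open>Chains of submodules as chains of subspaces\<close>

lemma vector_space_mpoly: "vector_space (\<lambda>c p. Poly_Mapping.single 0 c * (p :: 'k::field mpoly))"
  by unfold_locales (simp_all add: distrib_left distrib_right single_add mult.assoc[symmetric] mult_single)

lemma mpoly_in_span:
  fixes p :: "'k::field mpoly"
  assumes "supp p \<subseteq> T"
  shows "p \<in> module.span (\<lambda>c p. Poly_Mapping.single 0 c * p) ((\<lambda>m. Poly_Mapping.single m 1) ` T)"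
proof -
  interpret vs: vector_space "\<lambda>c p. Poly_Mapping.single 0 c * (p :: 'k mpoly)" by (rule vector_space_mpoly)
  show ?thesis
    using assms
  proof (induction rule: supp_induct)
    case (single m c)
    have "Poly_Mapping.single m (1::'k) \<in> vs.span ((\<lambda>m. Poly_Mapping.single m 1) ` T)"
      by (intro vs.span_base imageI single)
    from vs.span_scale[OF this, of c] show ?case by (simp add: mult_single)
  qed (auto intro: vs.span_zero vs.span_add)
qed

lemma subspace_chain_bound:
  fixes W :: "nat \<Rightarrow> 'k::field mpoly set"
  assumes "finite T" "\<And>i p. i \<le> l \<Longrightarrow> p \<in> W i \<Longrightarrow> supp p \<subseteq> T" "\<And>i. i \<le> l \<Longrightarrow> 0 \<in> W i"
    and add: "\<And>i p q. i \<le> l \<Longrightarrow> p \<in> W i \<Longrightarrow> q \<in> W i \<Longrightarrow> p + q \<in> W i"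
    and scale: "\<And>i c p. i \<le> l \<Longrightarrow> p \<in> W i \<Longrightarrow> Poly_Mapping.single 0 c * p \<in> W i"
    and chain: "\<And>i. i < l \<Longrightarrow> W i \<subset> W (Suc i)"
  shows "l \<le> card T"
proof -
  interpret vs: vector_space "\<lambda>c p. Poly_Mapping.single 0 c * (p :: 'k mpoly)" by (rule vector_space_mpoly)
  have sub: "vs.subspace (W i)" if "i \<le> l" for i
    using that assms(3) add scale unfolding vs.subspace_def by blast
  have "\<exists>S. vs.independent S \<and> finite S \<and> card S = i \<and> S \<subseteq> W i" if "i \<le> l" for i
    using that
  proof (induction i)
    case 0
    then show ?case using vs.independent_empty by (intro exI[of _ "{}"]) simp
  next
    case (Suc i)
    then obtain S where S: "vs.independent S" "finite S" "card S = i" "S \<subseteq> W i" by auto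
    obtain p where p: "p \<in> W (Suc i)" "p \<notin> W i" using chain[of i] Suc.prems by auto
    have "p \<notin> vs.span S" using vs.span_minimal[OF S(4) sub[of i]] Suc.prems p by auto
    moreover then have "p \<notin> S" using vs.span_base by blast
    moreover have "W i \<subseteq> W (Suc i)" using chain[of i] Suc.prems by auto
    ultimately show ?case using S p by (intro exI[of _ "insert p S"]) (auto simp: vs.independent_insert)
  qed
  then obtain S where S: "vs.independent S" "finite S" "card S = l" "S \<subseteq> W l" by blast
  have "S \<subseteq> vs.span ((\<lambda>m. Poly_Mapping.single m 1) ` T)"
    using S(4) assms(2)[of l] mpoly_in_span by blast
  then have "card S \<le> card ((\<lambda>m. Poly_Mapping.single m (1::'k)) ` T)"
    using vs.independent_span_bound[OF _ S(1)] assms(1) by blast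
  also have "\<dots> \<le> card T" using assms(1) by (rule card_image_le)
  finally show ?thesis using S(3) by simp
qed

text \<open>The least element enters last. Closure is with respect to the linear order of
  \<open>T\<close>; for exponents this will give submodules, because adding an exponent moves upward
  in that order.\<close>

lemma upper_set_chain:
  fixes T :: "'a::linorder set"
  assumes "finite T"
  shows "\<exists>S :: nat \<Rightarrow> 'a set. (\<forall>i<card T. S i \<subset> S (Suc i)) \<and> (\<forall>i\<le>card T. S i \<subseteq> T \<and> (\<forall>u\<in>S i. \<forall>w\<in>T. u \<le> w \<longrightarrow> w \<in> S i))"
  using assms
proof (induction T rule: finite_linorder_min_induct)
  case empty
  show ?case by (intro exI[of _ "\<lambda>_. {}"]) simp
next
  case (insert b A)
  obtain S :: "nat \<Rightarrow> 'a set" where S: "\<forall>i<card A. S i \<subset> S (Suc i)"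
    "\<forall>i\<le>card A. S i \<subseteq> A \<and> (\<forall>u\<in>S i. \<forall>w\<in>A. u \<le> w \<longrightarrow> w \<in> S i)"
    using insert.IH by (elim exE conjE)
  have b: "b \<notin> A" using insert.hyps by auto
  define S' where "S' i = (if i \<le> card A then S i else insert b A)" for i
  have c: "card (insert b A) = Suc (card A)" using insert.hyps b by simp
  have "S' i \<subset> S' (Suc i)" if "i < card (insert b A)" for i
    using that S b unfolding c S'_def by (cases "i = card A") auto
  moreover have "S' i \<subseteq> insert b A \<and> (\<forall>u\<in>S' i. \<forall>w\<in>insert b A. u \<le> w \<longrightarrow> w \<in> S' i)" if "i \<le> card (insert b A)" for i
  proof (cases "i \<le> card A")
    case True
    then have "S i \<subseteq> A" "\<forall>u\<in>S i. \<forall>w\<in>A. u \<le> w \<longrightarrow> w \<in> S i" using S(2) by auto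
    moreover have "\<not> u \<le> b" if "u \<in> A" for u using insert.hyps(2) that by (simp add: not_le)
    ultimately show ?thesis using True unfolding S'_def by auto
  qed (simp add: S'_def)
  ultimately show ?case by blast
qed

text \<open>No chain is longer than the number of torsion exponents because submodules pull back to
  subspaces of polynomials on these exponents. A chain of that length arises by adjoining torsion
  exponents to \<open>F\<close> from the largest down.\<close>

lemma module_length_mono_quot:
  fixes E F :: "expo set"
  assumes V: "finite V" and E: "upset V E" and F: "upset V F" and FE: "F \<subseteq> E"
    and fin: "finite (torsion_exps V E F)"
  shows "module_length (loc_ring V :: 'k::field loc ring)
    (torsion_module (loc_ring V) (max_ideal (loc_ring V)) (mono_quot V E F)) = enat (card (torsion_exps V E F))"
proof -
  let ?R = "loc_ring V :: 'k loc ring"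
  let ?B = "loc_ideal V F :: 'k loc set"
  let ?T = "torsion_exps V E F"
  let ?G = "tclosure V E F"
  let ?M = "mono_quot V E F :: ('k loc, 'k loc set) module"
  define N where "N = torsion_module ?R (max_ideal ?R) ?M"
  have G: "upset V ?G" by (rule tclosure_upset[OF E F])
  have GT: "?G = ?T \<union> F" by (rule tclosure_eq[OF F FE])
  have B: "asubg ?B" by (rule asubg_loc_ideal[OF F])
  have Nc: "carrier N = cst ?B ` loc_ideal V ?G"
    unfolding N_def torsion_module_def by (simp add: torsion_part_mono_quot[OF V E F])
  have N0: "\<zero>\<^bsub>N\<^esub> = cst ?B 0" by (simp add: N_def torsion_module_def mono_quot_zero cst_zero)
  have Na: "cst ?B x \<oplus>\<^bsub>N\<^esub> cst ?B y = cst ?B (x + y)" for x y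
    by (simp add: N_def torsion_module_def mono_quot_add[OF F])
  have Ns: "a \<odot>\<^bsub>N\<^esub> cst ?B x = cst ?B (a * x)" if "a \<in> carrier ?R" for a x
    using mono_quot_smult[OF F that] by (simp add: N_def torsion_module_def)
  have neg: "- x \<in> loc_ideal V H" if "x \<in> loc_ideal V H" "upset V H" for x :: "'k loc" and H
    using asubg_loc_ideal[OF that(2)] that(1) by (auto simp: asubg_def)
  have grp: "group (add_monoid N)"
  proof (rule groupI)
    fix Z assume "Z \<in> carrier (add_monoid N)"
    then obtain x where x: "Z = cst ?B x" "x \<in> loc_ideal V ?G" by (auto simp: Nc)
    then show "\<exists>Y\<in>carrier (add_monoid N). Y \<otimes>\<^bsub>add_monoid N\<^esub> Z = \<one>\<^bsub>add_monoid N\<^esub>"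
      using neg[OF _ G] by (intro bexI[of _ "cst ?B (- x)"]) (auto simp: Nc Na N0)
  qed (auto simp: Nc Na N0 add.assoc intro: loc_ideal_add[OF G] loc_ideal_zero)
  have subm: "submodule (cst ?B ` loc_ideal V H) ?R N" if H: "upset V H" "H \<subseteq> ?G" for H
  proof
    have HG: "loc_ideal V H \<subseteq> (loc_ideal V ?G :: 'k loc set)" using H by (intro loc_ideal_mono) auto
    then show "cst ?B ` loc_ideal V H \<subseteq> carrier (add_monoid N)" by (auto simp: Nc)
    fix Z assume "Z \<in> cst ?B ` loc_ideal V H"
    then obtain x where x: "Z = cst ?B x" "x \<in> loc_ideal V H" by auto
    have "inv\<^bsub>add_monoid N\<^esub> Z = cst ?B (- x)"
      using HG neg[OF x(2) H(1)] by (intro group.inv_equality[OF grp]) (auto simp: x Nc Na N0 intro!: imageI)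
    then show "inv\<^bsub>add_monoid N\<^esub> Z \<in> cst ?B ` loc_ideal V H" using neg[OF x(2) H(1)] by auto
  qed (auto simp: Na N0 Ns carrier_loc intro!: imageI loc_ideal_add[OF H(1)] loc_ideal_zero loc_ideal_mult[OF H(1)])
  have upper: "l \<le> card ?T"
    if "\<forall>i\<le>l. submodule (Z i) ?R N" "\<forall>i<l. Z i \<subset> Z (Suc i)" for l Z
  proof -
    \<comment> \<open>Field constants act through the local ring, so this pullback of a submodule is
      a subspace; a strict inclusion stays strict because every class has a representative supported
      on \<open>?T\<close>.\<close>
    define W where "W i = {p :: 'k mpoly. supp p \<subseteq> ?T \<and> cst ?B (Fract p 1) \<in> Z i}" for i
    have sm: "submodule (Z i) ?R N" if "i \<le> l" for i
      using \<open>\<forall>i\<le>l. submodule (Z i) ?R N\<close> that by simp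
    note sg = submodule.axioms(1)[OF sm] submodule.smult_closed[OF sm]
    show ?thesis
    proof (rule subspace_chain_bound[OF fin, of l W])
      fix i assume i: "i \<le> l"
      show "0 \<in> W i"
        using subgroup.one_closed[OF sg(1)[OF i]] by (simp add: W_def N0 Zero_fract_def[symmetric])
      show "p + q \<in> W i" if "p \<in> W i" "q \<in> W i" for p q
      proof -
        have "cst ?B (Fract p 1) \<oplus>\<^bsub>N\<^esub> cst ?B (Fract q 1) \<in> Z i"
          using subgroup.m_closed[OF sg(1)[OF i]] that by (simp add: W_def)
        then show ?thesis using that by (simp add: W_def Na supp_add_subset)
      qed
      show "Poly_Mapping.single 0 c * p \<in> W i" if "p \<in> W i" for c p
      proof -
        have "Fract (Poly_Mapping.single 0 c) 1 \<in> carrier ?R"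
          unfolding carrier_loc by (intro loc_idealI upolys_one) simp
        from sg(2)[OF i this, of "cst ?B (Fract p 1)"] Ns[OF this]
        have "cst ?B (Fract (Poly_Mapping.single 0 c * p) 1) \<in> Z i" using that by (simp add: W_def)
        moreover have "supp (Poly_Mapping.single 0 c * p) \<subseteq> supp p"
          using keys_mult[of "Poly_Mapping.single 0 c" p] by (auto split: if_splits)
        ultimately show ?thesis using that by (auto simp: W_def)
      qed
    next
      fix i assume i: "i < l"
      have XX: "Z i \<subset> Z (Suc i)" using i that(2) by blast
      then obtain Y where Y: "Y \<in> Z (Suc i)" "Y \<notin> Z i" by auto
      then have "Y \<in> carrier N" using subgroup.subset[OF sg(1)[of "Suc i"]] i by auto
      then obtain x where x: "Y = cst ?B x" "x \<in> loc_ideal V ?G" by (auto simp: Nc)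
      obtain p where p: "supp p \<subseteq> ?T" "x - Fract p 1 \<in> ?B"
        using torsion_representative[OF V E F FE x(2)] .
      then have "cst ?B (Fract p 1) = Y" using x(1) cst_eq_iff[OF B, of x "Fract p 1"] by simp
      then have "p \<in> W (Suc i) - W i" using Y p by (simp add: W_def)
      moreover have "W i \<subseteq> W (Suc i)" using XX by (auto simp: W_def)
      ultimately show "W i \<subset> W (Suc i)" by blast
    qed (simp add: W_def)
  qed
  have lower: "\<exists>Z. (\<forall>i\<le>card ?T. submodule (Z i) ?R N) \<and> (\<forall>i<card ?T. Z i \<subset> Z (Suc i))"
  proof -
    obtain S :: "nat \<Rightarrow> expo set" where S: "\<forall>i<card ?T. S i \<subset> S (Suc i)"
      "\<forall>i\<le>card ?T. S i \<subseteq> ?T \<and> (\<forall>u\<in>S i. \<forall>w\<in>?T. u \<le> w \<longrightarrow> w \<in> S i)"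
      using upper_set_chain[OF fin] by (elim exE conjE)
    \<comment> \<open>Upward closed: a multiple of an element of \<open>S i\<close> stays in the
      torsion closure, so it lies in \<open>F\<close> or is a torsion exponent that is larger in the
      linear order.\<close>
    define H where "H i = F \<union> S i" for i
    have H: "upset V (H i)" "H i \<subseteq> ?G" if i: "i \<le> card ?T" for i
    proof -
      show HG: "H i \<subseteq> ?G" using S(2) i unfolding GT H_def by blast
      show "upset V (H i)"
        unfolding upset_def
      proof (intro conjI ballI)
        show "H i \<subseteq> exps V" using HG upset_subset[OF G] by blast
        fix u v assume u: "u \<in> H i" and v: "v \<in> exps V"
        show "u + v \<in> H i"
        proof (cases "u \<in> F")
          case True
          then show ?thesis using upsetD[OF F] v by (simp add: H_def)
        next
          case False
          then have uS: "u \<in> S i" using u by (simp add: H_def)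
          have "u + v \<in> ?G" using upsetD[OF G _ v] u HG by blast
          moreover have "u \<le> u + v" using add_left_mono[OF expo_nonneg[of v], of u] by simp
          ultimately show ?thesis using S(2) i uS unfolding GT H_def by blast
        qed
      qed
    qed
    have "cst ?B ` loc_ideal V (H i) \<subset> cst ?B ` loc_ideal V (H (Suc i))" if i: "i < card ?T" for i
    proof -
      have "H i \<subseteq> H (Suc i)" using S(1) i by (auto simp: H_def)
      then have "cst ?B ` loc_ideal V (H i) \<subseteq> cst ?B ` loc_ideal V (H (Suc i))"
        by (intro image_mono loc_ideal_mono) auto
      moreover obtain u where u: "u \<in> S (Suc i)" "u \<notin> S i" using S(1) i by blast
      have uT: "u \<in> ?T" using u S(2) i by (meson Suc_leI subsetD)
      then have uF: "u \<notin> F" by (simp add: torsion_exps_def)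
      have "cst ?B (Xm u) \<in> cst ?B ` loc_ideal V (H (Suc i))" using u by (intro imageI Xm_mem) (simp add: H_def)
      moreover have "cst ?B (Xm u) \<notin> cst ?B ` loc_ideal V (H i)"
      proof
        assume "cst ?B (Xm u) \<in> cst ?B ` loc_ideal V (H i)"
        then obtain y where y: "y \<in> loc_ideal V (H i)" "Xm u - y \<in> ?B" by (auto simp: cst_eq_iff[OF B])
        then have "Xm u - y \<in> loc_ideal V (H i)" using loc_ideal_mono[of F "H i" V V] by (auto simp: H_def)
        from loc_ideal_add[OF H(1) this y(1)] have "(Xm u :: 'k loc) \<in> loc_ideal V (H i)" using i by simp
        moreover have "supp (Poly_Mapping.single u (1::'k)) \<subseteq> exps V"
          using uT upset_subset[OF E] by (auto simp: torsion_exps_def)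
        ultimately have "supp (Poly_Mapping.single u (1::'k)) \<subseteq> H i"
          unfolding Xm_def using loc_ideal_iff[OF H(1) _ upolys_one] i by (metis less_imp_le)
        then show False using u uF by (simp add: H_def)
      qed
      ultimately show ?thesis by blast
    qed
    then show ?thesis using subm H by (intro exI[of _ "\<lambda>i. cst ?B ` loc_ideal V (H i)"]) blast
  qed
  show ?thesis
    unfolding module_length_def N_def[symmetric]
  proof (rule antisym)
    show "Sup {enat l |l. \<exists>Z. (\<forall>i\<le>l. submodule (Z i) ?R N) \<and> (\<forall>i<l. Z i \<subset> Z (Suc i))} \<le> enat (card ?T)"
      using upper by (intro Sup_least) auto
    show "enat (card ?T) \<le> Sup {enat l |l. \<exists>Z. (\<forall>i\<le>l. submodule (Z i) ?R N) \<and> (\<forall>i<l. Z i \<subset> Z (Suc i))}"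
      using lower by (intro Sup_upper) blast
  qed
qed

lemma graded_piece_length:
  assumes "finite V" "upset V E"
  shows "the_enat (module_length (loc_ring V :: 'k::field loc ring)
    (torsion_module (loc_ring V) (max_ideal (loc_ring V)) (graded_piece (loc_ring V) (loc_ideal V E) t))) = card (tset V E t)"
  using module_length_mono_quot[OF assms(1) upset_epow[OF assms(2)] upset_epow[OF assms(2)] epow_Suc_subset[OF assms(2)], of t, where 'k='k]
    finite_tset[OF assms]
  unfolding graded_piece_def ideal_power_loc[OF assms(2)] mono_quot_def[symmetric] tset_def by simp

section \<open>Krull dimension\<close>

lemma sring_sum: "sring C \<Longrightarrow> (\<And>i. i \<in> A \<Longrightarrow> f i \<in> C) \<Longrightarrow> (\<Sum>i\<in>A. f i) \<in> C"
  by (induction A rule: infinite_finite_induct) (auto simp: sring_def)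

lemma sring_prod: "sring C \<Longrightarrow> (\<And>i. i \<in> A \<Longrightarrow> f i \<in> C) \<Longrightarrow> (\<Prod>i\<in>A. f i) \<in> C"
  by (induction A rule: infinite_finite_induct) (auto simp: sring_def)

lemma sring_power: "sring C \<Longrightarrow> x \<in> C \<Longrightarrow> x ^ n \<in> C"
  by (induction n) (auto simp: sring_def)

lemma sring_mult: "sring C \<Longrightarrow> x \<in> C \<Longrightarrow> y \<in> C \<Longrightarrow> x * y \<in> C"
  by (simp add: sring_def)

lemma tring_primeideal_iff:
  assumes "sring C"
  shows "primeideal P (tring C) \<longleftrightarrow> ideal P (tring C) \<and> P \<noteq> C \<and> (\<forall>a\<in>C. \<forall>b\<in>C. a * b \<in> P \<longrightarrow> a \<in> P \<or> b \<in> P)"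
proof
  assume P: "primeideal P (tring C)"
  show "ideal P (tring C) \<and> P \<noteq> C \<and> (\<forall>a\<in>C. \<forall>b\<in>C. a * b \<in> P \<longrightarrow> a \<in> P \<or> b \<in> P)"
    using primeideal.axioms(1)[OF P] primeideal.I_notcarr[OF P] primeideal.I_prime[OF P] by auto
next
  assume *: "ideal P (tring C) \<and> P \<noteq> C \<and> (\<forall>a\<in>C. \<forall>b\<in>C. a * b \<in> P \<longrightarrow> a \<in> P \<or> b \<in> P)"
  show "primeideal P (tring C)"
    by (rule primeidealI) (use * tring_cring[OF assms] in auto)
qed

text \<open>A polynomial relation between the \<open>y i\<close> is contradicted by inspecting the terms that are
  minimal in the exponent of the first variable and then passing to the next prime of the chain.\<close>

lemma prime_chain_independent:
  fixes y :: "nat \<Rightarrow> 'a::comm_ring_1"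
  assumes C: "sring C"
    and P: "\<And>i. i \<le> L \<Longrightarrow> primeideal (P i) (tring C)"
    and mono: "\<And>i. i < L \<Longrightarrow> P i \<subseteq> P (Suc i)"
    and y: "\<And>i. i < L \<Longrightarrow> y i \<in> P (Suc i)" "\<And>i. i < L \<Longrightarrow> y i \<notin> P i"
    and "j \<le> L" "finite A" "A \<noteq> {}"
    and "\<And>a b. a \<in> A \<Longrightarrow> b \<in> A \<Longrightarrow> (\<And>i. j \<le> i \<Longrightarrow> i < L \<Longrightarrow> a i = b i) \<Longrightarrow> a = b"
    and "\<And>a. a \<in> A \<Longrightarrow> c a \<in> C \<and> (\<exists>z\<in>C. z * c a = 1)"
  shows "(\<Sum>a\<in>A. c a * (\<Prod>i=j..<L. y i ^ a i)) \<notin> P j"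
proof -
  have I: "P i \<subseteq> C" "0 \<in> P i" "\<And>u v. u \<in> P i \<Longrightarrow> v \<in> P i \<Longrightarrow> u + v \<in> P i"
      "\<And>u v. u \<in> C \<Longrightarrow> v \<in> P i \<Longrightarrow> u * v \<in> P i" "P i \<noteq> C"
      "\<And>u v. u \<in> C \<Longrightarrow> v \<in> C \<Longrightarrow> u * v \<in> P i \<Longrightarrow> u \<in> P i \<or> v \<in> P i" if "i \<le> L" for i
    using P[OF that] unfolding tring_primeideal_iff[OF C] tring_ideal_iff[OF C] by auto
  have one: "1 \<notin> P i" if "i \<le> L" for i
  proof
    assume "1 \<in> P i"
    then have "C \<subseteq> P i" using I(4)[OF that] by (metis mult.right_neutral subsetI)
    then show False using I(1,5)[OF that] by blast
  qed
  have yC: "y i \<in> C" if "i < L" for i using y(1)[OF that] I(1)[of "Suc i"] that by auto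
  have pw: "y i ^ n \<notin> P i" if "i < L" for i n
  proof (induction n)
    case 0
    then show ?case using one[of i] that by simp
  next
    case (Suc n)
    then show ?case using I(6)[of i "y i" "y i ^ n"] y(2)[OF that] yC[OF that] sring_power[OF C] that by auto
  qed
  show ?thesis
    using assms(6-10)
  proof (induction arbitrary: A rule: inc_induct)
    case base
    \<comment> \<open>At the end of the chain the products are empty, so \<open>A\<close> has one
      element and the sum is a unit.\<close>
    obtain a where a: "a \<in> A" using base by auto
    have "b = a" if "b \<in> A" for b by (rule base(3)[OF that a]) simp
    then have "A = {a}" using a by blast
    moreover have "c a \<notin> P L"
    proof
      assume "c a \<in> P L"
      moreover obtain z where "z \<in> C" "z * c a = 1" using base(4)[OF a] by auto
      ultimately show False using I(4)[of L z "c a"] one[of L] by simp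
    qed
    ultimately show ?case by simp
  next
    case (step j)
    have jL: "j < L" by fact
    define e where "e = Min ((\<lambda>a. a j) ` A)"
    define A0 where "A0 = {a \<in> A. a j = e}"
    have e: "e \<le> a j" if "a \<in> A" for a unfolding e_def using step.prems(1) that by (intro Min_le) auto
    have "e \<in> (\<lambda>a. a j) ` A" unfolding e_def using step.prems by (intro Min_in) auto
    then have A0: "A0 \<noteq> {}" "finite A0" "A0 \<subseteq> A" using step.prems(1) by (auto simp: A0_def)
    let ?S0 = "\<Sum>a\<in>A0. c a * (\<Prod>i=Suc j..<L. y i ^ a i)"
    let ?r = "\<Sum>a\<in>A - A0. c a * y j ^ (a j - e - 1) * (\<Prod>i=Suc j..<L. y i ^ a i)"
    have S0: "?S0 \<notin> P (Suc j)"
    proof (rule step.IH)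
      fix a b assume ab: "a \<in> A0" "b \<in> A0" "\<And>i. Suc j \<le> i \<Longrightarrow> i < L \<Longrightarrow> a i = b i"
      show "a = b"
      proof (rule step.prems(3))
        fix i assume "j \<le> i" "i < L"
        then show "a i = b i" using ab by (cases "i = j") (auto simp: A0_def)
      qed (use ab A0 in auto)
    qed (use A0 step.prems(4) in auto)
    have tC: "c a \<in> C" "y j ^ n \<in> C" "(\<Prod>i=Suc j..<L. y i ^ a i) \<in> C" if "a \<in> A" for a n
      using step.prems(4)[OF that] sring_power[OF C yC] jL by (auto intro!: sring_prod[OF C])
    have S0C: "?S0 \<in> C" using A0 tC by (intro sring_sum[OF C] sring_mult[OF C]) auto
    have rC: "?r \<in> C" using tC by (intro sring_sum[OF C] sring_mult[OF C]) auto
    have prod: "(\<Prod>i=j..<L. y i ^ a i) = y j ^ a j * (\<Prod>i=Suc j..<L. y i ^ a i)" for a :: "nat \<Rightarrow> nat"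
      using jL by (rule prod.atLeast_Suc_lessThan)
    have "(\<Sum>a\<in>A. c a * (\<Prod>i=j..<L. y i ^ a i)) = (\<Sum>a\<in>A0. c a * (\<Prod>i=j..<L. y i ^ a i)) + (\<Sum>a\<in>A - A0. c a * (\<Prod>i=j..<L. y i ^ a i))"
      using sum.subset_diff[OF A0(3) step.prems(1)] by (simp add: add.commute)
    also have "(\<Sum>a\<in>A0. c a * (\<Prod>i=j..<L. y i ^ a i)) = y j ^ e * ?S0"
      unfolding sum_distrib_left by (intro sum.cong refl) (simp add: prod A0_def mult_ac)
    also have "(\<Sum>a\<in>A - A0. c a * (\<Prod>i=j..<L. y i ^ a i)) = y j ^ e * (y j * ?r)"
      unfolding sum_distrib_left
    proof (intro sum.cong refl)
      fix a assume "a \<in> A - A0"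
      then have "e < a j" using e[of a] by (auto simp: A0_def le_less)
      then have "y j ^ a j = y j ^ e * (y j * y j ^ (a j - e - 1))"
        by (metis Suc_diff_1 Suc_eq_plus1 diff_Suc_eq_diff_pred le_add_diff_inverse less_imp_le power_Suc power_add zero_less_diff diff_diff_left)
      then show "c a * (\<Prod>i=j..<L. y i ^ a i) = y j ^ e * (y j * (c a * y j ^ (a j - e - 1) * (\<Prod>i=Suc j..<L. y i ^ a i)))"
        by (simp add: prod mult_ac)
    qed
    finally have eq: "(\<Sum>a\<in>A. c a * (\<Prod>i=j..<L. y i ^ a i)) = y j ^ e * (?S0 + y j * ?r)"
      by (simp add: distrib_left)
    have yr: "y j * ?r \<in> P (Suc j)" using I(4)[of "Suc j" ?r "y j"] rC y(1)[OF jL] jL by (simp add: mult.commute)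
    \<comment> \<open>\<open>y j\<close> lies outside the prime \<open>P j\<close>, so the power
      \<open>y j ^ e\<close> can be cancelled. The multiples of \<open>y j\<close> belong to
      \<open>P (Suc j)\<close>, so there only \<open>?S0\<close> remains, which the induction
      hypothesis excludes.\<close>
    show ?case
    proof
      assume "(\<Sum>a\<in>A. c a * (\<Prod>i=j..<L. y i ^ a i)) \<in> P j"
      moreover have "?S0 + y j * ?r \<in> C" using S0C rC yC[OF jL] C by (simp add: sring_def)
      ultimately have "?S0 + y j * ?r \<in> P j"
        using I(6)[of j "y j ^ e" "?S0 + y j * ?r"] pw[OF jL] sring_power[OF C yC[OF jL]] jL unfolding eq by auto
      then have "?S0 + y j * ?r \<in> P (Suc j)" using mono[OF jL] by blast
      moreover have "- (y j * ?r) \<in> P (Suc j)"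
        using I(4)[of "Suc j" "- 1" "y j * ?r"] yr C jL by (auto simp: sring_def)
      ultimately have "?S0 + y j * ?r + - (y j * ?r) \<in> P (Suc j)" using I(3)[of "Suc j"] jL by (meson Suc_leI)
      then show False using S0 by simp
    qed
  qed
qed

section \<open>Upper bound for the Krull dimension\<close>

lemma mpoly_family_dependent:
  fixes b :: "'i \<Rightarrow> 'k::field mpoly"
  assumes "finite A" "finite T" "card T < card A" "\<And>i. i \<in> A \<Longrightarrow> supp (b i) \<subseteq> T"
  shows "\<exists>c. (\<exists>i\<in>A. c i \<noteq> 0) \<and> (\<Sum>i\<in>A. Poly_Mapping.single 0 (c i) * b i) = 0"
proof (cases "inj_on b A")
  case False
  then obtain i j where ij: "i \<in> A" "j \<in> A" "i \<noteq> j" "b i = b j" by (auto simp: inj_on_def)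
  \<comment> \<open>Linear dependence is a notion for sets, so a repeated member of the family is
    treated apart, with coefficients 1 and -1.\<close>
  define c where "c k = (if k = i then 1 else if k = j then - 1 else (0::'k))" for k
  have "(\<Sum>k\<in>A. Poly_Mapping.single 0 (c k) * b k) = (\<Sum>k\<in>{i, j}. Poly_Mapping.single 0 (c k) * b k)"
    using ij assms(1) by (intro sum.mono_neutral_right) (auto simp: c_def)
  also have "\<dots> = 0" using ij by (simp add: c_def single_uminus)
  finally show ?thesis using ij by (intro exI[of _ c]) (auto simp: c_def)
next
  case True
  interpret vs: vector_space "\<lambda>c p. Poly_Mapping.single 0 c * (p :: 'k mpoly)" by (rule vector_space_mpoly)
  have "vs.dependent (b ` A)"
  proof (rule ccontr)
    assume "\<not> vs.dependent (b ` A)"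
    moreover have "b ` A \<subseteq> vs.span ((\<lambda>m. Poly_Mapping.single m 1) ` T)" using assms(4) mpoly_in_span by blast
    ultimately have "card (b ` A) \<le> card ((\<lambda>m. Poly_Mapping.single m (1::'k)) ` T)"
      using vs.independent_span_bound assms(2) by blast
    also have "\<dots> \<le> card T" using assms(2) by (rule card_image_le)
    finally show False using assms(3) True by (simp add: card_image)
  qed
  then obtain u where "\<exists>v\<in>b ` A. u v \<noteq> 0" "(\<Sum>v\<in>b ` A. Poly_Mapping.single 0 (u v) * v) = 0"
    using vs.dependent_finite[of "b ` A"] assms(1) by auto
  then show ?thesis using True by (intro exI[of _ "\<lambda>i. u (b i)"]) (auto simp: sum.reindex)
qed

definition expo_box :: "nat set \<Rightarrow> nat \<Rightarrow> expo set" where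
  "expo_box V n = {m \<in> exps V. \<forall>i. coef m i \<le> n}"

lemma expo_box_mult:
  fixes p q :: "'k::field mpoly"
  assumes "supp p \<subseteq> expo_box V a" "supp q \<subseteq> expo_box V b"
  shows "supp (p * q) \<subseteq> expo_box V (a + b)"
proof
  fix m assume "m \<in> supp (p * q)"
  then obtain u v where "m = u + v" "u \<in> supp p" "v \<in> supp q" using keys_mult[of p q] by blast
  then show "m \<in> expo_box V (a + b)" using assms by (auto simp: expo_box_def lookup_add intro!: add_mono)
qed

lemma expo_box_one: "supp (1 :: 'k::field mpoly) \<subseteq> expo_box V 0"
  by (simp add: expo_box_def)

lemma expo_box_power: "supp (p :: 'k::field mpoly) \<subseteq> expo_box V a \<Longrightarrow> supp (p ^ k) \<subseteq> expo_box V (k * a)"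
proof (induction k)
  case (Suc k)
  then show ?case using expo_box_mult[of p V a "p ^ k" "k * a"] by simp
qed (use expo_box_one in simp)

lemma expo_box_prod:
  assumes "finite A" "\<And>i. i \<in> A \<Longrightarrow> supp (p i :: 'k::field mpoly) \<subseteq> expo_box V (a i)"
  shows "supp (\<Prod>i\<in>A. p i) \<subseteq> expo_box V (\<Sum>i\<in>A. a i)"
  using assms
proof (induction A rule: finite_induct)
  case empty
  then show ?case using expo_box_one by simp
next
  case (insert x F)
  then show ?case using expo_box_mult[of "p x" V "a x" "\<Prod>i\<in>F. p i" "\<Sum>i\<in>F. a i"] by simp
qed

text \<open>A count: there are \<open>D ^ (card V + 1)\<close> products with all exponents below
  \<open>D\<close>, while they lie in a space whose dimension grows only like
  \<open>D ^ card V\<close>.\<close>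

lemma polys_algebraically_dependent:
  fixes f :: "nat \<Rightarrow> 'k::field mpoly"
  assumes V: "finite V" and f: "\<forall>i<L. supp (f i) \<subseteq> exps V" and L: "L = Suc (card V)"
  shows "\<exists>A c. finite A \<and> A \<subseteq> (\<Pi>\<^sub>E i\<in>{0..<L}. UNIV) \<and> A \<noteq> {} \<and> (\<forall>a\<in>A. c a \<noteq> 0) \<and>
    (\<Sum>a\<in>A. Poly_Mapping.single 0 (c a) * (\<Prod>i=0..<L. f i ^ a i)) = 0"
proof -
  define e where "e = (\<Sum>i<L. \<Sum>m\<in>supp (f i). \<Sum>x\<in>V. coef m x)"
  have fe: "supp (f i) \<subseteq> expo_box V e" if i: "i < L" for i
  proof
    fix m assume m: "m \<in> supp (f i)"
    have mV: "m \<in> exps V" using f i m by blast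
    have "coef m x \<le> e" for x
    proof (cases "x \<in> V")
      case True
      have "coef m x \<le> (\<Sum>x\<in>V. coef m x)" using V True by (intro member_le_sum) auto
      also have "\<dots> \<le> (\<Sum>m\<in>supp (f i). \<Sum>x\<in>V. coef m x)"
        using m by (intro member_le_sum[of m "supp (f i)" "\<lambda>m. \<Sum>x\<in>V. coef m x"]) auto
      also have "\<dots> \<le> e" unfolding e_def
        using i by (intro member_le_sum[of i "{..<L}" "\<lambda>i. \<Sum>m\<in>supp (f i). \<Sum>x\<in>V. coef m x"]) auto
      finally show ?thesis .
    qed (use exps_coef[OF mV] in simp)
    then show "m \<in> expo_box V e" using mV by (simp add: expo_box_def)
  qed
  \<comment> \<open>Any number above \<open>(L * e + 1) ^ card V\<close> would do: the box has at
    most \<open>(L * D * e + 1) ^ card V\<close> points, which is at most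
    \<open>D ^ card V * (L * e + 1) ^ card V\<close> and hence below \<open>D ^ L\<close>.\<close>
  define D where "D = (L * e + 1) ^ card V + 1"
  define T where "T = {u \<in> exps V. \<forall>i\<in>V. coef u i < L * (D * e) + 1}"
  define A where "A = (\<Pi>\<^sub>E i\<in>{0..<L}. {..<D})"
  have finA: "finite A" unfolding A_def by (intro finite_PiE) auto
  have cardA: "card A = D ^ L" unfolding A_def by (simp add: card_PiE)
  have finT: "finite T" unfolding T_def by (rule box_card(1)[OF V])
  have "card T \<le> (L * (D * e) + 1) ^ card V" unfolding T_def by (rule box_card(2)[OF V])
  also have "\<dots> \<le> (D * (L * e + 1)) ^ card V"
    by (intro power_mono) (auto simp: D_def algebra_simps)
  also have "\<dots> = D ^ card V * (L * e + 1) ^ card V" by (rule power_mult_distrib)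
  also have "\<dots> < D ^ card V * D" by (intro mult_strict_left_mono) (auto simp: D_def)
  also have "\<dots> = card A" by (simp add: cardA L)
  finally have TA: "card T < card A" .
  have "supp (\<Prod>i=0..<L. f i ^ a i) \<subseteq> T" if "a \<in> A" for a
  proof -
    have ai: "a i * e \<le> D * e" if "i < L" for i
      using \<open>a \<in> A\<close> that by (intro mult_right_mono) (auto simp: A_def PiE_def Pi_def less_imp_le)
    have "supp (\<Prod>i=0..<L. f i ^ a i) \<subseteq> expo_box V (\<Sum>i=0..<L. a i * e)"
      using fe by (intro expo_box_prod expo_box_power) auto
    moreover have "(\<Sum>i=0..<L. a i * e) \<le> L * (D * e)"
      using sum_bounded_above[of "{0..<L}" "\<lambda>i. a i * e" "D * e"] ai by simp
    moreover have "expo_box V n \<subseteq> T" if "n \<le> L * (D * e)" for n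
      using that by (auto simp: expo_box_def T_def less_Suc_eq_le intro: order_trans)
    ultimately show ?thesis by blast
  qed
  then obtain c where c: "\<exists>a\<in>A. c a \<noteq> 0" "(\<Sum>a\<in>A. Poly_Mapping.single 0 (c a) * (\<Prod>i=0..<L. f i ^ a i)) = 0"
    using mpoly_family_dependent[OF finA finT TA, of "\<lambda>a. \<Prod>i=0..<L. f i ^ a i"] by blast
  let ?A = "{a \<in> A. c a \<noteq> 0}"
  have "(\<Sum>a\<in>?A. Poly_Mapping.single 0 (c a) * (\<Prod>i=0..<L. f i ^ a i)) = 0"
    using c(2) finA by (subst sum.mono_neutral_left[of A]) auto
  moreover have "?A \<subseteq> (\<Pi>\<^sub>E i\<in>{0..<L}. UNIV)" by (auto simp: A_def PiE_def)
  ultimately show ?thesis using c(1) finA by (intro exI[of _ ?A] exI[of _ c]) auto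
qed

lemma Fract_one_hom:
  "Fract (p * q) 1 = Fract p 1 * Fract (q :: 'k::field mpoly) 1" "Fract (p ^ n) 1 = Fract p 1 ^ n"
  "Fract (\<Sum>i\<in>A. g i) 1 = (\<Sum>i\<in>A. Fract (g i :: 'k mpoly) 1)" "Fract (\<Prod>i\<in>A. g i) 1 = (\<Prod>i\<in>A. Fract (g i) 1)"
proof -
  show m: "Fract (p * q) 1 = Fract p 1 * Fract q 1" for p q :: "'k mpoly" by simp
  show "Fract (p ^ n) 1 = Fract p 1 ^ n"
    by (induction n) (simp_all only: power.simps m One_fract_def)
  show "Fract (\<Sum>i\<in>A. g i) 1 = (\<Sum>i\<in>A. Fract (g i :: 'k mpoly) 1)"
  proof -
    have "Fract (p + q) 1 = Fract p 1 + Fract q 1" for p q :: "'k mpoly" by simp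
    then show ?thesis
      by (induction A rule: infinite_finite_induct) (simp_all add: Zero_fract_def del: add_fract)
  qed
  show "Fract (\<Prod>i\<in>A. g i) 1 = (\<Prod>i\<in>A. Fract (g i) 1)"
    by (induction A rule: infinite_finite_induct) (simp_all add: One_fract_def m del: mult_fract)
qed

text \<open>In a chain of length \<open>card V + 1\<close>, pick an element that is new at each
  step; its numerator is new as well, since denominators are units. These numerators satisfy an
  algebraic relation by counting, and none by \<open>prime_chain_independent\<close>.\<close>

lemma prime_chain_length:
  fixes P :: "nat \<Rightarrow> 'k::field loc set"
  assumes V: "finite V" and P: "\<forall>i\<le>l. primeideal (P i) (loc_ring V)" and chain: "\<forall>i<l. P i \<subset> P (Suc i)"
  shows "l \<le> card V"
proof (rule ccontr)
  assume "\<not> l \<le> card V"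
  define L where "L = Suc (card V)"
  have Ll: "L \<le> l" using \<open>\<not> l \<le> card V\<close> by (simp add: L_def)
  let ?C = "loc_ideal V (exps V) :: 'k loc set"
  have id: "ideal (P i) (loc_ring V)" if "i \<le> L" for i using P that Ll by (intro primeideal.axioms(1)) simp
  have "\<exists>f. supp f \<subseteq> exps V \<and> Fract f 1 \<in> P (Suc i) \<and> Fract f 1 \<notin> P i" if i: "i < L" for i
  proof -
    obtain x where x: "x \<in> P (Suc i)" "x \<notin> P i" using chain i Ll by (meson less_le_trans psubset_imp_ex_mem DiffE)
    have I: "P (Suc i) \<subseteq> ?C" "\<And>a x. a \<in> ?C \<Longrightarrow> x \<in> P (Suc i) \<Longrightarrow> a * x \<in> P (Suc i)"
      using id[of "Suc i"] i unfolding loc_ideal_iff_ideal by auto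
    have I0: "\<And>a x. a \<in> ?C \<Longrightarrow> x \<in> P i \<Longrightarrow> a * x \<in> P i"
      using id[of i] i unfolding loc_ideal_iff_ideal by auto
    have "x \<in> ?C" using x(1) I(1) by blast
    then obtain f g where fg: "x = Fract f g" "supp f \<subseteq> exps V" "g \<in> upolys V" by (rule loc_idealE)
    have "Fract g 1 \<in> ?C" "Fract 1 g \<in> ?C" using fg(3) upolys_supp[OF fg(3)] upolys_one by (auto intro!: loc_idealI)
    moreover have "Fract g 1 * x = Fract f 1" "Fract 1 g * Fract f 1 = x"
      using upolys_nonzero[OF fg(3)] by (simp_all add: fg(1) eq_fract)
    ultimately have "Fract f 1 \<in> P (Suc i)" "Fract f 1 \<in> P i \<Longrightarrow> x \<in> P i"
      using I(2)[of "Fract g 1" x] I0[of "Fract 1 g" "Fract f 1"] x(1) by auto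
    then show ?thesis using fg(2) x(2) by blast
  qed
  then obtain f where f: "\<And>i. i < L \<Longrightarrow> supp (f i) \<subseteq> exps V" "\<And>i. i < L \<Longrightarrow> Fract (f i) 1 \<in> P (Suc i)" "\<And>i. i < L \<Longrightarrow> Fract (f i) 1 \<notin> P i"
    by metis
  have fs: "\<forall>i<L. supp (f i) \<subseteq> exps V" using f(1) by blast
  obtain A c where A: "finite A" "A \<subseteq> (\<Pi>\<^sub>E i\<in>{0..<L}. UNIV)" "A \<noteq> {}" "\<forall>a\<in>A. c a \<noteq> 0"
    "(\<Sum>a\<in>A. Poly_Mapping.single 0 (c a) * (\<Prod>i=0..<L. f i ^ a i)) = 0"
    using polys_algebraically_dependent[OF V fs L_def] by (elim exE conjE)
  let ?c = "\<lambda>a. Fract (Poly_Mapping.single 0 (c a)) 1 :: 'k loc"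
  have "(\<Sum>a\<in>A. ?c a * (\<Prod>i=0..<L. Fract (f i) 1 ^ a i)) = Fract (\<Sum>a\<in>A. Poly_Mapping.single 0 (c a) * (\<Prod>i=0..<L. f i ^ a i)) 1"
    unfolding Fract_one_hom ..
  also have "\<dots> = 0" unfolding A(5) Zero_fract_def ..
  also have "0 \<in> P 0" using id[of 0] unfolding loc_ideal_iff_ideal by simp
  finally have "(\<Sum>a\<in>A. ?c a * (\<Prod>i=0..<L. Fract (f i) 1 ^ a i)) \<in> P 0" .
  moreover have "(\<Sum>a\<in>A. ?c a * (\<Prod>i=0..<L. Fract (f i) 1 ^ a i)) \<notin> P 0"
  proof (rule prime_chain_independent[OF sring_loc[of V]])
    show "primeideal (P i) (tring ?C)" if "i \<le> L" for i using P that Ll by (simp flip: loc_ring_eq)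
    show "P i \<subseteq> P (Suc i)" if "i < L" for i using chain that Ll by (auto simp: psubset_eq)
    show "a = b" if "a \<in> A" "b \<in> A" "\<And>i. 0 \<le> i \<Longrightarrow> i < L \<Longrightarrow> a i = b i" for a b
      using A(2) that by (intro PiE_ext[of a "{0..<L}" "\<lambda>_. UNIV" b]) auto
    show "?c a \<in> ?C \<and> (\<exists>z\<in>?C. z * ?c a = 1)" if "a \<in> A" for a
    proof -
      have "(Fract (Poly_Mapping.single 0 (1 / c a)) 1 :: 'k loc) * ?c a = 1"
        using A(4) that by (simp add: mult_single One_fract_def)
      moreover have "(Fract (Poly_Mapping.single 0 k) 1 :: 'k loc) \<in> ?C" for k
        by (intro loc_idealI upolys_one) simp
      ultimately show ?thesis by blast
    qed
  qed (use A f in auto)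
  ultimately show False by simp
qed

section \<open>Coordinate primes and the Krull dimension\<close>

definition meets :: "nat set \<Rightarrow> nat set \<Rightarrow> expo set" where
  "meets V A = {u \<in> exps V. supp u \<inter> A \<noteq> {}}"

lemma upset_meets: "upset V (meets V A)"
  by (auto simp: upset_def meets_def supp_add_nat)

text \<open>\<open>meets V A\<close> consists of the monomials divisible by a variable in
  \<open>A\<close>, so the ideal is generated by these variables. Modulo it a numerator is
  represented by its terms in the remaining variables; the product of two such non-zero polynomials
  is non-zero and again involves only the remaining variables.\<close>

lemma prime_meets:
  "primeideal (loc_ideal V (meets V A) :: 'k::field loc set) (loc_ring V)"
  unfolding loc_ring_eq tring_primeideal_iff[OF sring_loc]
proof (intro conjI ballI impI)
  let ?M = "meets V A"
  show "ideal (loc_ideal V ?M) (tring (loc_ideal V (exps V) :: 'k loc set))"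
    using ideal_loc_ideal[OF upset_meets] by (simp add: loc_ring_eq)
  have "Fract 1 1 \<notin> (loc_ideal V ?M :: 'k loc set)"
    using loc_ideal_iff[OF upset_meets _ upolys_one, of "1 :: 'k mpoly" V A] by (simp add: meets_def)
  moreover have "Fract 1 1 \<in> (loc_ideal V (exps V) :: 'k loc set)" by (intro loc_idealI upolys_one) simp
  ultimately show "loc_ideal V ?M \<noteq> (loc_ideal V (exps V) :: 'k loc set)" by blast
  fix x y :: "'k loc"
  assume x: "x \<in> loc_ideal V (exps V)" and y: "y \<in> loc_ideal V (exps V)" and xy: "x * y \<in> loc_ideal V ?M"
  obtain f g where fg: "x = Fract f g" "supp f \<subseteq> exps V" "g \<in> upolys V" using x by (rule loc_idealE)
  obtain f' g' where fg': "y = Fract f' g'" "supp f' \<subseteq> exps V" "g' \<in> upolys V" using y by (rule loc_idealE)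
  have "supp (f * f') \<subseteq> exps V" by (rule supp_mult_upset[OF upset_exps fg(2) fg'(2)])
  then have ff: "supp (f * f') \<subseteq> ?M"
    using xy loc_ideal_iff[OF upset_meets _ upolys_mult[OF fg(3) fg'(3)]] by (simp add: fg(1) fg'(1))
  show "x \<in> loc_ideal V ?M \<or> y \<in> loc_ideal V ?M"
  proof (rule ccontr)
    assume "\<not> (x \<in> loc_ideal V ?M \<or> y \<in> loc_ideal V ?M)"
    then have n: "\<not> supp f \<subseteq> ?M" "\<not> supp f' \<subseteq> ?M" using fg fg' by (auto intro: loc_idealI)
    define h where "h = restr (- ?M) f"
    define h' where "h' = restr (- ?M) f'"
    have "supp h \<noteq> {}" "supp h' \<noteq> {}" using n by (auto simp: h_def h'_def)
    then have "h \<noteq> 0" "h' \<noteq> 0" by auto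
    then have "h * h' \<noteq> 0" by simp
    moreover have "supp (h * h') \<subseteq> ?M"
    proof -
      have s: "f = restr ?M f + h" "f' = restr ?M f' + h'" unfolding h_def h'_def by (rule restr_split)+
      have "h * h' = f * f' + (- restr ?M f * f' + - restr ?M f' * h)"
      proof -
        have "f * f' = restr ?M f * f' + h * f'" by (metis s(1) distrib_right)
        moreover have "h * f' = h * restr ?M f' + h * h'" by (metis s(2) distrib_left)
        ultimately show ?thesis by (simp add: algebra_simps)
      qed
      moreover have "supp (- restr ?M f * f') \<subseteq> ?M" by (rule supp_mult_upset[OF upset_meets _ fg'(2)]) simp
      moreover have "supp (- restr ?M f' * h) \<subseteq> ?M"
        by (rule supp_mult_upset[OF upset_meets]) (use fg(2) in \<open>auto simp: h_def\<close>)
      ultimately show ?thesis using ff supp_add_subset by metis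
    qed
    moreover have "supp (h * h') \<subseteq> exps (V - A)"
      using fg fg' by (intro supp_mult_upset[OF upset_exps]) (auto simp: h_def h'_def meets_def exps_def)
    ultimately have "supp (h * h') = {}" by (fastforce simp: meets_def exps_def)
    then show False using \<open>h * h' \<noteq> 0\<close> by simp
  qed
qed

text \<open>A chain of full length consists of the ideals generated by the first \<open>i\<close>
  variables in an enumeration of \<open>V\<close>.\<close>

lemma krull_dim_loc:
  assumes V: "finite V"
  shows "krull_dim (loc_ring V :: 'k::field loc ring) = enat (card V)"
  unfolding krull_dim_def
proof (rule antisym)
  show "Sup {enat l |l. \<exists>P. (\<forall>i\<le>l. primeideal (P i) (loc_ring V :: 'k loc ring)) \<and> (\<forall>i<l. P i \<subset> P (Suc i))} \<le> enat (card V)"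
    using prime_chain_length[OF V] by (intro Sup_least) auto
  obtain h where h: "bij_betw h {0..<card V} V" using ex_bij_betw_nat_finite[OF V] by blast
  define P where "P i = (loc_ideal V (meets V (h ` {0..<i})) :: 'k loc set)" for i
  have "P i \<subset> P (Suc i)" if i: "i < card V" for i
  proof -
    have "P i \<subseteq> P (Suc i)" unfolding P_def by (intro loc_ideal_mono) (auto simp: meets_def)
    moreover have hi: "h i \<in> V" "h i \<notin> h ` {0..<i}"
    proof -
      show "h i \<in> V" using h i by (auto simp: bij_betw_def)
      show "h i \<notin> h ` {0..<i}"
        using inj_onD[OF bij_betw_imp_inj_on[OF h], of i] i by fastforce
    qed
    let ?u = "Poly_Mapping.single (h i) (1::nat)"
    have "?u \<in> meets V (h ` {0..<Suc i})" "?u \<notin> meets V (h ` {0..<i})" using hi by (auto simp: meets_def exps_def)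
    then have "Xm ?u \<in> P (Suc i)" unfolding P_def by (intro Xm_mem)
    moreover have "Xm ?u \<notin> P i"
      using \<open>?u \<notin> meets V (h ` {0..<i})\<close> unfolding P_def using loc_ideal_iff[OF upset_meets _ upolys_one, of "Poly_Mapping.single ?u (1::'k)" V "h ` {0..<i}"] hi
      by (auto simp: Xm_def exps_def)
    ultimately show ?thesis by blast
  qed
  then show "enat (card V) \<le> Sup {enat l |l. \<exists>P. (\<forall>i\<le>l. primeideal (P i) (loc_ring V :: 'k loc ring)) \<and> (\<forall>i<l. P i \<subset> P (Suc i))}"
    using prime_meets by (intro Sup_upper CollectI exI[of _ "card V"] exI[of _ P] conjI refl) (auto simp: P_def)
qed

section \<open>The product formula\<close>

lemma j_multiplicity_loc:
  assumes "finite V" "upset V E" "jlimit V E c"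
  shows "j_multiplicity (loc_ring V) (loc_ideal V E :: 'k::field loc set) = c"
proof -
  let ?a = "\<lambda>t. real (card (tset V E t)) / real t ^ (card V - 1)"
  have "(\<lambda>t. fact (card V - 1) * ?a t * (1 / fact (card V - 1))) \<longlonglongrightarrow> c * (1 / fact (card V - 1))"
    using assms(3) unfolding jlimit_def by (rule tendsto_mult[OF _ tendsto_const])
  then have "?a \<longlonglongrightarrow> c / fact (card V - 1)" by simp
  then have "lim ?a = c / fact (card V - 1)" by (rule limI)
  then show ?thesis
    by (simp add: j_multiplicity_def krull_dim_loc[OF assms(1)] graded_piece_length[OF assms(1,2)])
qed

text \<open>The induction starts at a single block because \<open>jlimit_join\<close> takes two
  non-empty sets of variables; each further block is joined to the union of the earlier
  ones.\<close>

lemma jlimit_family: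
  fixes s :: nat
  assumes "\<And>k. k \<in> {1..Suc s} \<Longrightarrow> finite (V k) \<and> V k \<noteq> {} \<and> upset (V k) (E k) \<and> jlimit (V k) (E k) (c k)"
    and "disjoint_family_on V {1..Suc s}"
  shows "jlimit (\<Union>k\<in>{1..Suc s}. V k) (\<Union>k\<in>{1..Suc s}. msum (E k) (exps (\<Union>k\<in>{1..Suc s}. V k))) (\<Prod>k=1..Suc s. c k)"
  using assms
proof (induction s)
  case 0
  then show ?case by (simp add: msum_exps)
next
  case (Suc s)
  let ?I = "{1..Suc s}"
  let ?U = "\<Union>k\<in>?I. V k" and ?s = "Suc (Suc s)"
  let ?F = "\<Union>k\<in>?I. msum (E k) (exps ?U)"
  let ?W = "?U \<union> V ?s"
  have I: "{1..?s} = insert ?s ?I" by auto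
  have prems: "finite (V k) \<and> V k \<noteq> {} \<and> upset (V k) (E k) \<and> jlimit (V k) (E k) (c k)" if "k \<in> {1..?s}" for k
    using Suc.prems(1)[OF that] .
  have IH: "jlimit ?U ?F (\<Prod>k=1..Suc s. c k)"
    using Suc.prems by (intro Suc.IH) (auto simp: disjoint_family_on_def)
  have EU: "E k \<subseteq> exps ?U" if "k \<in> ?I" for k
  proof -
    have "k \<in> {1..?s}" using that by auto
    then have "E k \<subseteq> exps (V k)" using upset_subset prems by blast
    also have "\<dots> \<subseteq> exps ?U" using that by (intro exps_mono) blast
    finally show ?thesis .
  qed
  have F: "upset ?U ?F" by (rule upset_UN) (rule upset_gen[OF EU])
  have "V k \<inter> V ?s = {}" if "k \<in> ?I" for k
    using disjoint_family_onD[OF Suc.prems(2), of k ?s] that by simp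
  then have disj: "?U \<inter> V ?s = {}" by blast
  have "jlimit ?W (expo_join ?W ?F (E ?s)) ((\<Prod>k=1..Suc s. c k) * c ?s)"
  proof (rule jlimit_join[OF _ _ disj _ _ F _ IH])
    show "finite ?U" "?U \<noteq> {}" using prems by auto
  qed (use prems[of ?s] in auto)
  moreover have "expo_join ?W ?F (E ?s) = (\<Union>k\<in>{1..?s}. msum (E k) (exps ?W))"
  proof -
    have "msum (msum (E k) (exps ?U)) (exps ?W) = msum (E k) (exps ?W)" for k
    proof (intro subset_antisym subsetI)
      fix u assume "u \<in> msum (msum (E k) (exps ?U)) (exps ?W)"
      then obtain a b d where "u = a + b + d" "a \<in> E k" "b \<in> exps ?U" "d \<in> exps ?W" by (auto simp: msum_def)
      moreover then have "b + d \<in> exps ?W" using exps_mono[of ?U ?W] by auto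
      ultimately show "u \<in> msum (E k) (exps ?W)" using msumI[of a "E k" "b + d"] by (simp add: add.assoc)
    next
      fix u assume "u \<in> msum (E k) (exps ?W)"
      then show "u \<in> msum (msum (E k) (exps ?U)) (exps ?W)"
        using msum_mono[OF subset_gen[of "E k" ?U] order_refl] by blast
    qed
    moreover have "msum ?F (exps ?W) = (\<Union>k\<in>?I. msum (msum (E k) (exps ?U)) (exps ?W))"
      by (fastforce simp: msum_def)
    ultimately show ?thesis unfolding expo_join_def I by auto
  qed
  moreover have "?W = (\<Union>k\<in>{1..?s}. V k)" unfolding I by auto
  ultimately show ?case by simp
qed

theorem theorem4p6:
  fixes n s :: nat
    and V :: "nat \<Rightarrow> nat set"
    and I :: "nat \<Rightarrow> 'k::field mpoly fract set"
  assumes "n \<ge> 1"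
    and "(\<Union>k\<in>{1..s}. V k) = {1..n}"
    and "disjoint_family_on V {1..s}"
    and "\<And>k. k \<in> {1..s} \<Longrightarrow> V k \<noteq> {}"
    and "\<And>k. k \<in> {1..s} \<Longrightarrow> monomial_ideal (V k) (I k)"
  shows "j_multiplicity (loc_ring {1..n})
           (ideal_sum (loc_ring {1..n}) {1..s} (\<lambda>k. Idl\<^bsub>loc_ring {1..n}\<^esub> (I k)))
         = (\<Prod>k = 1..s. j_multiplicity (loc_ring (V k)) (I k))"
proof -
  let ?U = "{1..n}"
  have VU: "V k \<subseteq> ?U" if "k \<in> {1..s}" for k using assms(2) that by blast
  have fin: "finite (V k)" if "k \<in> {1..s}" for k using VU[OF that] finite_subset by blast
  have "\<exists>E. upset (V k) E \<and> I k = loc_ideal (V k) E" if k: "k \<in> {1..s}" for k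
  proof -
    obtain S where S: "S \<subseteq> Xm ` exps (V k)" "I k = Idl\<^bsub>loc_ring (V k)\<^esub> S"
      using assms(5)[OF k] unfolding monomial_ideal_def monomials_eq by blast
    then obtain M where "M \<subseteq> exps (V k)" "S = Xm ` M" by (meson subset_imageE)
    then show ?thesis using S(2) Idl_monomials upset_gen by metis
  qed
  then obtain E where E: "\<And>k. k \<in> {1..s} \<Longrightarrow> upset (V k) (E k)" "\<And>k. k \<in> {1..s} \<Longrightarrow> I k = loc_ideal (V k) (E k)"
    by metis
  obtain c where c: "\<And>k. k \<in> {1..s} \<Longrightarrow> jlimit (V k) (E k) (c k)"
    using jlimit_exists[OF fin assms(4) E(1)] by metis
  have EU: "E k \<subseteq> exps ?U" if "k \<in> {1..s}" for k
    using upset_subset[OF E(1)[OF that]] exps_mono[OF VU[OF that]] by blast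
  \<comment> \<open>With no blocks the union would be empty, but it is \<open>{1..n}\<close> with
    \<open>n \<ge> 1\<close>; this provides the start for \<open>jlimit_family\<close>.\<close>
  obtain s' where s': "s = Suc s'" using assms(1,2) by (cases s) auto
  let ?E = "\<Union>k\<in>{1..s}. msum (E k) (exps ?U)"
  have upE: "upset ?U (msum (E k) (exps ?U))" if "k \<in> {1..s}" for k by (rule upset_gen[OF EU[OF that]])
  have "ideal_sum (loc_ring ?U) {1..s} (\<lambda>k. Idl\<^bsub>loc_ring ?U\<^esub> (I k))
    = ideal_sum (loc_ring ?U) {1..s} (\<lambda>k. loc_ideal ?U (msum (E k) (exps ?U)) :: 'k loc set)"
  proof -
    have "Idl\<^bsub>loc_ring ?U\<^esub> (I k) = loc_ideal ?U (msum (E k) (exps ?U))" if "k \<in> {1..s}" for k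
      unfolding E(2)[OF that] by (rule Idl_extension[OF VU[OF that] upset_subset[OF E(1)[OF that]]])
    then have "(\<Pi> k\<in>{1..s}. Idl\<^bsub>loc_ring ?U\<^esub> (I k)) = (\<Pi> k\<in>{1..s}. loc_ideal ?U (msum (E k) (exps ?U)))"
      unfolding Pi_def by simp
    then show ?thesis unfolding ideal_sum_def by simp
  qed
  also have "\<dots> = loc_ideal ?U ?E" by (rule ideal_sum_loc[OF _ upE]) auto
  also have "j_multiplicity (loc_ring ?U) (loc_ideal ?U ?E :: 'k loc set) = (\<Prod>k=1..s. c k)"
  proof (rule j_multiplicity_loc)
    show "upset ?U ?E" by (rule upset_UN[OF upE])
    show "jlimit ?U ?E (\<Prod>k=1..s. c k)"
      using jlimit_family[of s' V E c] fin assms(3,4) E(1) c unfolding s' assms(2)[unfolded s'] by blast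
  qed simp
  also have "\<dots> = (\<Prod>k = 1..s. j_multiplicity (loc_ring (V k)) (I k))"
    using j_multiplicity_loc[OF fin E(1) c, where 'k='k] E(2) by (intro prod.cong refl) simp
  finally show ?thesis .
qed

end
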